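(* Let $(M,[g])$ be a $K$-homogeneous conformal geometry of signature $(p,q)$, $n=p+q$, and let $H\subset K$ be the stabilizer of a point $o\in M$; let $\mathfrak{k},\mathfrak{h}$ be the Lie algebras of $K,H$. Let $\alpha_{-1}:T_oM=\mathfrak{k}/\mathfrak{h}\to\mathbb{R}^n$ be a linear isomorphism such that $\alpha_{-1}^*\nu_{p,q}\in[g]_o$. Then there is a linear map $\alpha:\mathfrak{k}\to\mathfrak{so}(p+1,q+1)$ such that (1) $\{\alpha(Y_1),\alpha(Y_h)\}-\alpha([Y_1,Y_h])=0$ for all $Y_1\in\mathfrak{k}$, $Y_h\in\mathfrak{h}$; (2) $\alpha(\mathfrak{k}/\mathfrak{h})=\mathfrak{so}(p+1,q+1)/\mathfrak{p}$ (i.e. $\alpha$ maps $\mathfrak{h}$ into $\mathfrak{p}$ and induces an isomorphism of the quotients), and moreover the restriction of $\alpha$ to a map $\mathfrak{k}/\mathfrak{h}\to\mathbb{R}^n$ along $\mathfrak{p}$ coincides with $\alpha_{-1}$; (3) the curvature $$\kappa(\alpha(Y_1)+\mathfrak{p},\alpha(Y_2)+\mathfrak{p}):=\{\alpha(Y_1),\alpha(Y_2)\}-\alpha([Y_1,Y_2])$$ in $\wedge^2\mathbb{R}^{n*}\otimes\mathfrak{so}(p+1,q+1)$ satisfies the normalization condition $$\sum_i\{Z_i,\kappa(\alpha(Y)+\mathfrak{p},\alpha(X_i)+\mathfrak{p})\}=0\quad\text{for all }Y\in\mathfrak{k},$$ where the elements $X_i\in\mathfrak{k}$ are representatives of a basis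 $\alpha_{-1}(X_i)$ of $\mathbb{R}^n$ and the elements $Z_i\in\mathbb{R}^{n*}$ form the corresponding dual basis.
   Context: $K$-homogeneous means that the Lie group $K$ acts transitively on the connected smooth manifold $M$ of dimension $n=p+q$ by conformal symmetries of $[g]$; $p\le q$. $\nu_{p,q}=\left[\begin{smallmatrix} 0 & 0 & I_p \\ 0 & I_{q-p} & 0 \\ I_p & 0 & 0 \end{smallmatrix}\right]$ on $\mathbb{R}^n$, where $I_r$ denotes the identity matrix of order $r$. The Lie algebra $\mathfrak{so}(p+1,q+1)$ consists of the block matrices (block sizes $1,n,1$) $$\left[\begin{smallmatrix} a&z&0\\ x&A&-\nu_{p,q}z^t\\ 0&-x^t\nu_{p,q}&-a\end{smallmatrix}\right],\quad a\in\mathbb{R},\ x\in\mathbb{R}^n,\ z\in\mathbb{R}^{n*},\ A\in\mathfrak{so}(\nu_{p,q}).$$ $\mathbb{R}^n$ is the subalgebra of $x$-parts, $\mathfrak{co}(p,q)$ the subalgebra of $(a,A)$-parts, $\mathbb{R}^{n*}$ the subalgebra of $z$-parts, $\mathfrak{p}=\mathfrak{co}(p,q)\oplus\mathbb{R}^{n*}$, so $\mathfrak{so}(p+1,q+1)/\mathfrak{p}\cong\mathbb{R}^n$. The duality between $\mathbb{R}^n$ and $\mathbb{R}^{n*}$ is given by the Killing form (a multiple of the natural pairing). $\{\ ,\ \}$ is the bracket in $\mathfrak{so}(p+1,q+1)$, $[\ ,\ ]$ that of $\mathfrak{k}$. *)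

theory Defs
  imports "HOL-Analysis.Analysis"
begin

section \<open>Smooth manifolds\<close>

text \<open>Manifolds are types carrying a Hausdorff second countable topology, together with a
  smooth atlas. A chart is a pair of its domain and its coordinate map; values of the coordinate
  map outside the domain are irrelevant.\<close>

primrec Ck_on :: "nat \<Rightarrow> 'a::euclidean_space set \<Rightarrow> ('a \<Rightarrow> 'b::euclidean_space) \<Rightarrow> bool" where
  "Ck_on 0 S f \<longleftrightarrow> continuous_on S f"
| "Ck_on (Suc k) S f \<longleftrightarrow> (\<forall>x\<in>S. f differentiable (at x)) \<and>
     (\<forall>v. Ck_on k S (\<lambda>x. frechet_derivative f (at x) v))"

text \<open>These notions are only used for open \<open>S\<close>.\<close>

definition smooth_on :: "'a::euclidean_space set \<Rightarrow> ('a \<Rightarrow> 'b::euclidean_space) \<Rightarrow> bool" where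
  "smooth_on S f \<longleftrightarrow> (\<forall>k. Ck_on k S f)"

type_synonym ('m, 'e) chart = "'m set \<times> ('m \<Rightarrow> 'e)"

definition chart_inv :: "('m, 'e) chart \<Rightarrow> 'e \<Rightarrow> 'm" where
  "chart_inv c = inv_into (fst c) (snd c)"

definition is_chart :: "('m::topological_space, 'e::euclidean_space) chart \<Rightarrow> bool" where
  "is_chart c \<longleftrightarrow> open (fst c) \<and> open (snd c ` fst c) \<and>
     homeomorphism (fst c) (snd c ` fst c) (snd c) (chart_inv c)"

definition smooth_atlas ::
    "('m::{t2_space, second_countable_topology}, 'e::euclidean_space) chart set \<Rightarrow> bool" where
  "smooth_atlas A \<longleftrightarrow> (\<forall>c\<in>A. is_chart c) \<and> (\<Union>c\<in>A. fst c) = UNIV \<and>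
     (\<forall>c\<in>A. \<forall>d\<in>A. smooth_on (snd c ` (fst c \<inter> fst d)) (snd d \<circ> chart_inv c))"

definition prod_atlas :: "('m, 'e) chart set \<Rightarrow> ('n, 'f) chart set \<Rightarrow> ('m \<times> 'n, 'e \<times> 'f) chart set" where
  "prod_atlas A B = {(fst c \<times> fst d, map_prod (snd c) (snd d)) | c d. c \<in> A \<and> d \<in> B}"

definition euclidean_atlas :: "('e, 'e) chart set" where
  "euclidean_atlas = {(UNIV, id)}"

definition smooth_map ::
    "('m::topological_space, 'e::euclidean_space) chart set \<Rightarrow>
     ('n::topological_space, 'f::euclidean_space) chart set \<Rightarrow> ('m \<Rightarrow> 'n) \<Rightarrow> bool" where
  "smooth_map A B f \<longleftrightarrow> continuous_on UNIV f \<and>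
     (\<forall>c\<in>A. \<forall>d\<in>B. smooth_on (snd c ` (fst c \<inter> f -` fst d)) (snd d \<circ> f \<circ> chart_inv c))"

text \<open>The tangent map of \<open>f\<close> at \<open>x\<close>, where the tangent spaces at \<open>x\<close> and \<open>f x\<close> are identified
  with the model spaces by means of the charts \<open>c\<close> and \<open>d\<close>.\<close>

definition tangent_map ::
    "('m, 'e::euclidean_space) chart \<Rightarrow> ('n, 'f::euclidean_space) chart \<Rightarrow> ('m \<Rightarrow> 'n) \<Rightarrow> 'm \<Rightarrow> 'e \<Rightarrow> 'f" where
  "tangent_map c d f x = frechet_derivative (snd d \<circ> f \<circ> chart_inv c) (at (snd c x))"


section \<open>Conformal structures\<close>

text \<open>Signature \<open>(p, q)\<close> means \<open>p\<close> negative and \<open>q\<close> positive squares, as for the form \<open>nu p q\<close> below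
  when \<open>p \<le> q\<close>.\<close>

definition has_signature :: "nat \<Rightarrow> nat \<Rightarrow> ('e::euclidean_space \<Rightarrow> 'e \<Rightarrow> real) \<Rightarrow> bool" where
  "has_signature p q b \<longleftrightarrow>
     (\<exists>N P. N \<inter> P = {} \<and> card N = p \<and> card P = q \<and>
        finite (N \<union> P) \<and> independent (N \<union> P) \<and> span (N \<union> P) = UNIV \<and>
        (\<forall>u\<in>N \<union> P. \<forall>v\<in>N \<union> P. u \<noteq> v \<longrightarrow> b u v = 0) \<and>
        (\<forall>u\<in>N. b u u = -1) \<and> (\<forall>u\<in>P. b u u = 1))"

text \<open>A covariant 2-tensor field \<open>g\<close> is given by its coordinate expressions: \<open>g c x u v\<close> is the
  value at the point \<open>x\<close> on the tangent vectors with coordinates \<open>u\<close>, \<open>v\<close> in the chart \<open>c\<close>.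
  It is only relevant for charts \<open>c\<close> of the atlas and points \<open>x\<close> in the domain of \<open>c\<close>.\<close>

type_synonym ('m, 'e) tensor2 = "('m, 'e) chart \<Rightarrow> 'm \<Rightarrow> 'e \<Rightarrow> 'e \<Rightarrow> real"

definition pseudo_riemannian_metric ::
    "('m::topological_space, 'e::euclidean_space) chart set \<Rightarrow> nat \<Rightarrow> nat \<Rightarrow> ('m, 'e) tensor2 \<Rightarrow> bool" where
  "pseudo_riemannian_metric A p q g \<longleftrightarrow>
     (\<forall>c\<in>A. \<forall>x\<in>fst c. bilinear (g c x) \<and> (\<forall>u v. g c x u v = g c x v u) \<and> has_signature p q (g c x)) \<and>
     (\<forall>c\<in>A. \<forall>u v. smooth_on (snd c ` fst c) (\<lambda>y. g c (chart_inv c y) u v)) \<and>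
     (\<forall>c\<in>A. \<forall>d\<in>A. \<forall>x\<in>fst c \<inter> fst d. \<forall>u v.
        g c x u v = g d x (tangent_map c d id x u) (tangent_map c d id x v))"

definition positive_function :: "('m::topological_space, 'e::euclidean_space) chart set \<Rightarrow> ('m \<Rightarrow> real) \<Rightarrow> bool" where
  "positive_function A s \<longleftrightarrow> smooth_map A euclidean_atlas s \<and> (\<forall>x. s x > 0)"

definition conformal_class ::
    "('m::topological_space, 'e::euclidean_space) chart set \<Rightarrow> ('m, 'e) tensor2 \<Rightarrow> ('m, 'e) tensor2 set" where
  "conformal_class A g =
     {g'. \<exists>s. positive_function A s \<and> (\<forall>c\<in>A. \<forall>x\<in>fst c. \<forall>u v. g' c x u v = s x * g c x u v)}"

text \<open>The pullback of some (equivalently, every) metric of the class is again in the class.\<close>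

definition conformal_map ::
    "('m::topological_space, 'e::euclidean_space) chart set \<Rightarrow> ('m, 'e) tensor2 \<Rightarrow> ('m \<Rightarrow> 'm) \<Rightarrow> bool" where
  "conformal_map A g f \<longleftrightarrow> smooth_map A A f \<and>
     (\<exists>s. positive_function A s \<and>
        (\<forall>c\<in>A. \<forall>d\<in>A. \<forall>x\<in>fst c. f x \<in> fst d \<longrightarrow> (\<forall>u v.
           g d (f x) (tangent_map c d f x u) (tangent_map c d f x v) = s x * g c x u v)))"


section \<open>Lie groups\<close>

definition lie_group ::
    "('k::{t2_space, second_countable_topology}, 'l::euclidean_space) chart set \<Rightarrow>
     ('k \<Rightarrow> 'k \<Rightarrow> 'k) \<Rightarrow> 'k \<Rightarrow> ('k \<Rightarrow> 'k) \<Rightarrow> bool" where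
  "lie_group A gmul e ginv \<longleftrightarrow> smooth_atlas A \<and> Groups.group gmul e ginv \<and>
     smooth_map (prod_atlas A A) A (\<lambda>(a, b). gmul a b) \<and> smooth_map A A ginv"

definition smooth_action ::
    "('k::{t2_space, second_countable_topology}, 'l::euclidean_space) chart set \<Rightarrow> ('k \<Rightarrow> 'k \<Rightarrow> 'k) \<Rightarrow> 'k \<Rightarrow>
     ('m::{t2_space, second_countable_topology}, 'e::euclidean_space) chart set \<Rightarrow>
     ('k \<Rightarrow> 'm \<Rightarrow> 'm) \<Rightarrow> bool" where
  "smooth_action A gmul e B act \<longleftrightarrow>
     (\<forall>x. act e x = x) \<and> (\<forall>a b x. act (gmul a b) x = act a (act b x)) \<and>
     smooth_map (prod_atlas A B) B (\<lambda>(a, x). act a x)"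

text \<open>The Lie algebra of a Lie group is the tangent space at the unit \<open>e\<close>, identified with the model
  space \<open>'l\<close> by a chart \<open>c\<close> around \<open>e\<close>; the bracket is that of left-invariant vector fields.
  \<open>left_invariant_field gmul e c u\<close> is the coordinate expression, on the image of \<open>c\<close>, of the
  left-invariant vector field with value \<open>u\<close> at \<open>e\<close>.\<close>

definition left_invariant_field ::
    "('k \<Rightarrow> 'k \<Rightarrow> 'k) \<Rightarrow> 'k \<Rightarrow> ('k, 'l::euclidean_space) chart \<Rightarrow> 'l \<Rightarrow> 'l \<Rightarrow> 'l" where
  "left_invariant_field gmul e c u y = tangent_map c c (gmul (chart_inv c y)) e u"

definition field_bracket :: "('l::euclidean_space \<Rightarrow> 'l) \<Rightarrow> ('l \<Rightarrow> 'l) \<Rightarrow> 'l \<Rightarrow> 'l" where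
  "field_bracket V W y = frechet_derivative W (at y) (V y) - frechet_derivative V (at y) (W y)"

definition lie_bracket ::
    "('k \<Rightarrow> 'k \<Rightarrow> 'k) \<Rightarrow> 'k \<Rightarrow> ('k, 'l::euclidean_space) chart \<Rightarrow> 'l \<Rightarrow> 'l \<Rightarrow> 'l" where
  "lie_bracket gmul e c u v =
     field_bracket (left_invariant_field gmul e c u) (left_invariant_field gmul e c v) (snd c e)"

text \<open>The Lie algebra of a closed subgroup \<open>H\<close>: all initial velocities of one-parameter
  subgroups running in \<open>H\<close>, i.e. all \<open>Y\<close> with \<open>exp (t Y) \<in> H\<close> for all \<open>t\<close>.\<close>

definition subgroup_lie_algebra ::
    "('k::topological_space, 'l::euclidean_space) chart set \<Rightarrow> ('k \<Rightarrow> 'k \<Rightarrow> 'k) \<Rightarrow> 'k \<Rightarrow>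
     ('k, 'l) chart \<Rightarrow> 'k set \<Rightarrow> 'l set" where
  "subgroup_lie_algebra A gmul e c H =
     {Y. \<exists>\<gamma> :: real \<Rightarrow> 'k. smooth_map euclidean_atlas A \<gamma> \<and> \<gamma> 0 = e \<and>
        (\<forall>s t. \<gamma> (s + t) = gmul (\<gamma> s) (\<gamma> t)) \<and> (\<forall>t. \<gamma> t \<in> H) \<and>
        ((snd c \<circ> \<gamma>) has_vector_derivative Y) (at 0)}"


section \<open>The Lie algebra of the conformal group\<close>

text \<open>Coordinates on \<open>real ^ 'n\<close> are numbered \<open>0, \<dots>, n - 1\<close> along the linear order of \<open>'n\<close>.\<close>

definition pos :: "'n::{finite, linorder} \<Rightarrow> nat" where
  "pos i = card {j. j < i}"

definition nu :: "nat \<Rightarrow> nat \<Rightarrow> real ^ ('n::{finite, linorder}) ^ ('n::{finite, linorder})" where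
  "nu p q = (\<chi> i j. if (pos i < p \<and> pos j = pos i + q) \<or>
                       (p \<le> pos i \<and> pos i < q \<and> pos j = pos i) \<or>
                       (q \<le> pos i \<and> pos i = pos j + q) then 1 else 0)"

definition so_nu :: "nat \<Rightarrow> nat \<Rightarrow> (real ^ ('n::{finite, linorder}) ^ ('n::{finite, linorder})) set" where
  "so_nu p q = {A. transpose A ** nu p q + nu p q ** A = 0}"

text \<open>Square matrices with blocks of sizes \<open>1\<close>, \<open>n\<close>, \<open>1\<close>.\<close>

type_synonym 'n bmat = "real ^ (unit + 'n + unit) ^ (unit + 'n + unit)"

definition block_mat ::
    "real \<Rightarrow> real ^ 'n \<Rightarrow> real \<Rightarrow> real ^ 'n \<Rightarrow> real ^ 'n ^ 'n \<Rightarrow> real ^ 'n \<Rightarrow> real \<Rightarrow> real ^ 'n \<Rightarrow> real \<Rightarrow> 'n::finite bmat" where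
  "block_mat m11 m12 m13 m21 m22 m23 m31 m32 m33 = (\<chi> i j.
     case i of
       Inl _ \<Rightarrow> (case j of Inl _ \<Rightarrow> m11 | Inr (Inl l) \<Rightarrow> m12 $ l | Inr (Inr _) \<Rightarrow> m13)
     | Inr (Inl k) \<Rightarrow> (case j of Inl _ \<Rightarrow> m21 $ k | Inr (Inl l) \<Rightarrow> m22 $ k $ l | Inr (Inr _) \<Rightarrow> m23 $ k)
     | Inr (Inr _) \<Rightarrow> (case j of Inl _ \<Rightarrow> m31 | Inr (Inl l) \<Rightarrow> m32 $ l | Inr (Inr _) \<Rightarrow> m33))"

definition conf_mat ::
    "nat \<Rightarrow> nat \<Rightarrow> real \<Rightarrow> real ^ ('n::{finite, linorder}) \<Rightarrow> real ^ ('n::{finite, linorder}) \<Rightarrow> real ^ ('n::{finite, linorder}) ^ ('n::{finite, linorder}) \<Rightarrow> ('n::{finite, linorder}) bmat" where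
  "conf_mat p q a x z A =
     block_mat a z              0
               x A              (- (nu p q *v z))
               0 (- (x v* nu p q)) (- a)"

text \<open>The parameters \<open>p\<close>, \<open>q\<close> are those of \<open>\<nu>\<^sub>p\<^sub>q\<close>, so \<open>so_conf p q\<close> is \<open>so(p+1, q+1)\<close>.\<close>

definition so_conf :: "nat \<Rightarrow> nat \<Rightarrow> (('n::{finite, linorder}) bmat) set" where
  "so_conf p q = {conf_mat p q a x z A | a x z A. A \<in> so_nu p q}"

definition par_conf :: "nat \<Rightarrow> nat \<Rightarrow> (('n::{finite, linorder}) bmat) set" where
  "par_conf p q = {conf_mat p q a 0 z A | a z A. A \<in> so_nu p q}"

definition neg_elem :: "nat \<Rightarrow> nat \<Rightarrow> real ^ ('n::{finite, linorder}) \<Rightarrow> ('n::{finite, linorder}) bmat" where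
  "neg_elem p q x = conf_mat p q 0 x 0 0"

definition pos_elem :: "nat \<Rightarrow> nat \<Rightarrow> real ^ ('n::{finite, linorder}) \<Rightarrow> ('n::{finite, linorder}) bmat" where
  "pos_elem p q z = conf_mat p q 0 0 z 0"

text \<open>Applied to elements of \<open>so_conf p q\<close>, this is the projection along \<open>par_conf p q\<close>, i.e. it
  realises the quotient of the two as \<open>real ^ 'n\<close>.\<close>

definition x_part :: "'n::finite bmat \<Rightarrow> real ^ 'n" where
  "x_part X = (\<chi> i. X $ Inr (Inl i) $ Inl ())"

definition mat_bracket :: "real ^ 'i ^ 'i \<Rightarrow> real ^ 'i ^ 'i \<Rightarrow> real ^ 'i ^ ('i::finite)" where
  "mat_bracket X Y = X ** Y - Y ** X"

definition trace_on :: "'v::euclidean_space set \<Rightarrow> ('v \<Rightarrow> 'v) \<Rightarrow> real" where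
  "trace_on L f = (let B = (SOME B. independent B \<and> span B = L) in \<Sum>b\<in>B. representation B (f b) b)"

definition killing_form ::
    "(real ^ 'i ^ ('i::finite)) set \<Rightarrow> real ^ 'i ^ 'i \<Rightarrow> real ^ 'i ^ 'i \<Rightarrow> real" where
  "killing_form L X Y = trace_on L (\<lambda>W. mat_bracket X (mat_bracket Y W))"

end

theory Submission
  imports Defs
begin

text \<open>Everything happens at the unit of \<open>K\<close>. Differentiating the adjoint action of the stabilizer
  shows that h acts on \<open>k/h\<close> by conformal endomorphisms, and the rest is linear algebra: the
  map \<open>\<alpha>\<close> is built degree by degree. The Koszul formula extends the isotropy representation to a
  torsion-free \<open>\<omega> : k \<rightarrow> co(p, q)\<close>. Since the first prolongation of \<open>co(p, q)\<close> is the dual of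
  the tangent space, the failure of \<open>\<omega>\<close> to be h-equivariant determines the positive part of \<open>\<alpha>\<close>
  on h. For \<open>n \<ge> 3\<close> the Ricci contraction is injective on the remaining freedom, so the normalization
  determines the positive part on all of k, and this uniqueness makes it equivariant.

  For \<open>n \<le> 2\<close> the normalization no longer determines it, but a flat \<open>\<alpha>\<close> (a Lie algebra homomorphism)
  exists: the null directions yield one or two actions on a real or complex line, and by Lie's
  classification a transitive finite-dimensional algebra of vector fields on a line is projective.\<close>

section \<open>Symmetry of second derivatives\<close>

text \<open>A covector is represented throughout by the vector \<open>z\<close> with covector
  \<open>b z\<close>, and \<open>S z x\<close> is the co(p, q)-part of the bracket of
  \<open>x\<close> with that covector. What separates n \<ge> 3 from n \<le> 2 is the second
  prolongation of co(p, q): the maps \<open>P\<close> with \<open>S (P x) y\<close> =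
  \<open>S (P y) x\<close>. They lie in the kernel of the Ricci contraction, and nonzero ones exist
  exactly for n \<le> 2. For n \<ge> 3 equivariance is then automatic: the Bianchi identity
  expresses the non-invariance of the curvature under h by the defect \<open>K1\<close>, the trace
  condition is itself invariant, so the defect has Ricci contraction zero and vanishes. For n \<le>
  2 the pointwise algebra bounds no jets, but the finite dimension of k does: a field with a zero of
  order m \<ge> 3, bracketed with its own derivative, has a zero of order 2 m - 2 > m, and iteration
  gives infinitely many independent jets. So zeros have order at most two, and in the coordinate of
  a fixed field all fields satisfy f''' = K f', the equation of a copy of sl(2).\<close>

abbreviation D :: "('a::euclidean_space \<Rightarrow> 'b::euclidean_space) \<Rightarrow> 'a \<Rightarrow> 'a \<Rightarrow> 'b" where
  "D f x \<equiv> frechet_derivative f (at x)"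

abbreviation D2 :: "('a::euclidean_space \<Rightarrow> 'b::euclidean_space) \<Rightarrow> 'a \<Rightarrow> 'a \<Rightarrow> 'a \<Rightarrow> 'b" where
  "D2 f x u v \<equiv> D (\<lambda>y. D f y v) x u"

text \<open>Weak enough to depend only on the germ of \<open>f\<close> and to pass to compositions,
  strong enough for symmetry of \<open>D2\<close>; continuity of the second derivatives is not asked
  for.\<close>

definition twice_differentiable_at :: "('a::euclidean_space \<Rightarrow> 'b::euclidean_space) \<Rightarrow> 'a \<Rightarrow> bool" where
  "twice_differentiable_at f x \<longleftrightarrow> (\<forall>\<^sub>F y in nhds x. f differentiable (at y)) \<and>
     (\<forall>v. (\<lambda>y. D f y v) differentiable (at x))"

lemma D_eqI: "(f has_derivative f') (at x) \<Longrightarrow> D f x = f'"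
  by (metis frechet_derivative_at)

lemma D_works: "f differentiable (at x) \<Longrightarrow> (f has_derivative D f x) (at x)"
  by (simp add: frechet_derivative_works)

lemma has_derivative_cong_nhds:
  assumes "\<forall>\<^sub>F y in nhds x. f y = g y"
  shows "(f has_derivative f') (at x) \<longleftrightarrow> (g has_derivative f') (at x)"
proof -
  have "\<forall>\<^sub>F y in at x. f y = g y" "\<forall>\<^sub>F y in at x. g y = f y" "f x = g x"
    using assms by (auto simp: eventually_nhds_conv_at elim!: eventually_mono)
  then show ?thesis by (metis UNIV_I has_derivative_transform_eventually)
qed

lemma D_cong: "\<forall>\<^sub>F y in nhds x. f y = g y \<Longrightarrow> D f x = D g x"
  by (simp add: frechet_derivative_def has_derivative_cong_nhds)

lemma differentiable_cong:
  "\<forall>\<^sub>F y in nhds x. f y = g y \<Longrightarrow> f differentiable (at x) \<Longrightarrow> g differentiable (at x)"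
  by (simp add: differentiable_def has_derivative_cong_nhds)

lemma twice_differentiable_atD1: "twice_differentiable_at f x \<Longrightarrow> f differentiable (at x)"
  unfolding twice_differentiable_at_def using eventually_nhds_x_imp_x by blast

lemma smooth_on_imp_twice_differentiable_at:
  assumes "smooth_on S f" "open S" "x \<in> S"
  shows "twice_differentiable_at f x"
proof -
  have "Ck_on (Suc (Suc 0)) S f" using assms(1) unfolding smooth_on_def by blast
  then show ?thesis using assms
    unfolding twice_differentiable_at_def by (auto simp: eventually_nhds)
qed

text \<open>The difference quotient is symmetric in \<open>u\<close> and \<open>v\<close>, hence so is its limit.\<close>

lemma second_difference_tendsto:
  fixes f :: "'a::euclidean_space \<Rightarrow> real"
  assumes "twice_differentiable_at f x"
  shows "((\<lambda>t. (f (x + t *\<^sub>R u + t *\<^sub>R v) - f (x + t *\<^sub>R u) - f (x + t *\<^sub>R v) + f x) / t\<^sup>2)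
           \<longlongrightarrow> D2 f x v u) (at_right 0)"
proof (rule tendstoI)
  fix e :: real assume e: "e > 0"
  define L where "L = D (\<lambda>y. D f y u) x"
  define N where "N = 2 * norm u + norm v + 1"
  have N: "N > 0" unfolding N_def by (simp add: add_nonneg_pos)
  have L: "((\<lambda>y. D f y u) has_derivative L) (at x)"
    using assms unfolding twice_differentiable_at_def L_def by (blast intro: D_works)
  obtain d1 where d1: "d1 > 0" "\<And>y. dist y x < d1 \<Longrightarrow> f differentiable (at y)"
    using assms unfolding twice_differentiable_at_def eventually_nhds_metric by blast
  \<comment> \<open>\<open>N\<close> bounds offsets: \<open>s *\<^sub>R u + r *\<^sub>R v\<close>
    has norm at most \<open>t * N\<close> when s and r lie between 0 and t. Two errors of size
    \<open>e' * (t * N)\<close>, divided by t, add up to e / 2.\<close>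
  define e' where "e' = e / (4 * N)"
  have e': "e' > 0" using e N by (simp add: e'_def)
  obtain d2 where d2: "d2 > 0"
    "\<And>y. norm (y - x) < d2 \<Longrightarrow> norm (D f y u - D f x u - L (y - x)) \<le> e' * norm (y - x)"
    using L e' unfolding has_derivative_at_alt by blast
  define d where "d = min d1 d2 / N"
  have d: "d > 0" using d1 d2 N by (simp add: d_def)
  have lin: "linear L" using L has_derivative_linear by blast
  have main: "dist ((f (x + t *\<^sub>R u + t *\<^sub>R v) - f (x + t *\<^sub>R u) - f (x + t *\<^sub>R v) + f x) / t\<^sup>2) (L v) < e"
    if t: "0 < t" "t < d" for t
  proof -
    \<comment> \<open>The increment in direction v as a function of the step along u. The mean value
      theorem turns the second difference into a difference of first derivatives, to which the
      expansion at x applies.\<close>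
    define \<phi> where "\<phi> s = f (x + s *\<^sub>R u + t *\<^sub>R v) - f (x + s *\<^sub>R u)" for s
    have tN: "t * N < min d1 d2" using t N by (simp add: d_def field_simps)
    have small: "norm (s *\<^sub>R u + r *\<^sub>R v) \<le> t * N" if "0 \<le> s" "s \<le> t" "0 \<le> r" "r \<le> t" for s r
    proof -
      have "norm (s *\<^sub>R u + r *\<^sub>R v) \<le> s * norm u + r * norm v"
        using that by (metis abs_of_nonneg norm_scaleR norm_triangle_ineq)
      also have "\<dots> \<le> t * norm u + t * norm v"
        using that by (intro add_mono mult_right_mono) auto
      also have "\<dots> \<le> t * N" using t unfolding N_def by (simp add: algebra_simps)
      finally show ?thesis .
    qed
    have \<phi>': "(\<phi> has_real_derivative (D f (x + s *\<^sub>R u + t *\<^sub>R v) u - D f (x + s *\<^sub>R u) u)) (at s)"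
      if "0 \<le> s" "s \<le> t" for s
    proof -
      have a: "f differentiable (at (x + s *\<^sub>R u + t *\<^sub>R v))"
        using small[of s t] that tN t by (intro d1) (auto simp: dist_norm add.assoc)
      have b: "f differentiable (at (x + s *\<^sub>R u))"
        using small[of s 0] that tN t by (intro d1) (auto simp: dist_norm)
      have h1: "((\<lambda>s. x + s *\<^sub>R u + t *\<^sub>R v) has_derivative (\<lambda>r. r *\<^sub>R u)) (at s)"
        by (auto intro!: derivative_eq_intros)
      have h2: "((\<lambda>s. x + s *\<^sub>R u) has_derivative (\<lambda>r. r *\<^sub>R u)) (at s)"
        by (auto intro!: derivative_eq_intros)
      have "(\<phi> has_derivative (\<lambda>r. D f (x + s *\<^sub>R u + t *\<^sub>R v) (r *\<^sub>R u) - D f (x + s *\<^sub>R u) (r *\<^sub>R u))) (at s)"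
        unfolding \<phi>_def
        using has_derivative_diff[OF has_derivative_compose[OF h1 D_works[OF a]]
            has_derivative_compose[OF h2 D_works[OF b]]] by simp
      moreover have "D f (x + s *\<^sub>R u + t *\<^sub>R v) (r *\<^sub>R u) - D f (x + s *\<^sub>R u) (r *\<^sub>R u)
         = r * (D f (x + s *\<^sub>R u + t *\<^sub>R v) u - D f (x + s *\<^sub>R u) u)" for r
        using linear_frechet_derivative[OF a] linear_frechet_derivative[OF b]
        by (simp add: linear_cmul right_diff_distrib)
      ultimately show ?thesis
        unfolding has_field_derivative_def by (simp add: mult.commute[of _ "D f _ u - D f _ u"])
    qed
    obtain \<xi> where \<xi>: "0 < \<xi>" "\<xi> < t" 
      "\<phi> t - \<phi> 0 = (t - 0) * (D f (x + \<xi> *\<^sub>R u + t *\<^sub>R v) u - D f (x + \<xi> *\<^sub>R u) u)"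
      using MVT2[of 0 t \<phi>, OF t(1) \<phi>'] by blast
    define r1 where "r1 = D f (x + \<xi> *\<^sub>R u + t *\<^sub>R v) u - D f x u - L (\<xi> *\<^sub>R u + t *\<^sub>R v)"
    define r2 where "r2 = D f (x + \<xi> *\<^sub>R u) u - D f x u - L (\<xi> *\<^sub>R u)"
    have r1: "norm r1 \<le> e' * (t * N)"
    proof -
      have "norm (\<xi> *\<^sub>R u + t *\<^sub>R v) \<le> t * N" using small[of \<xi> t] \<xi> by auto
      moreover have "norm r1 \<le> e' * norm (\<xi> *\<^sub>R u + t *\<^sub>R v)"
        using d2(2)[of "x + \<xi> *\<^sub>R u + t *\<^sub>R v"] calculation tN by (simp add: r1_def add.assoc)
      ultimately show ?thesis using e' by (meson less_imp_le mult_left_mono order_trans)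
    qed
    have r2: "norm r2 \<le> e' * (t * N)"
    proof -
      have "norm (\<xi> *\<^sub>R u) \<le> t * N" using small[of \<xi> 0] \<xi> t by auto
      moreover have "norm r2 \<le> e' * norm (\<xi> *\<^sub>R u)"
        using d2(2)[of "x + \<xi> *\<^sub>R u"] calculation tN by (simp add: r2_def)
      ultimately show ?thesis using e' by (meson less_imp_le mult_left_mono order_trans)
    qed
    have "L (\<xi> *\<^sub>R u + t *\<^sub>R v) = L (\<xi> *\<^sub>R u) + t * L v"
      using lin by (simp add: linear_add linear_cmul)
    then have "\<phi> t - \<phi> 0 = t * (t * L v + (r1 - r2))" 
      unfolding \<xi>(3) r1_def r2_def by simp
    then have eq: "f (x + t *\<^sub>R u + t *\<^sub>R v) - f (x + t *\<^sub>R u) - f (x + t *\<^sub>R v) + f x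
        = t * (t * L v + (r1 - r2))"
      unfolding \<phi>_def by simp
    have "(f (x + t *\<^sub>R u + t *\<^sub>R v) - f (x + t *\<^sub>R u) - f (x + t *\<^sub>R v) + f x) / t\<^sup>2 - L v = (r1 - r2) / t"
      unfolding eq using t by (simp add: field_simps power2_eq_square)
    moreover have "\<bar>(r1 - r2) / t\<bar> \<le> (2 * e' * (t * N)) / t"
    proof -
      have "\<bar>r1 - r2\<bar> \<le> 2 * e' * (t * N)" using r1 r2 by simp
      then show ?thesis using t by (simp only: abs_divide abs_of_pos divide_right_mono)
    qed
    moreover have "(2 * e' * (t * N)) / t < e" using t N e by (simp add: e'_def field_simps)
    ultimately show ?thesis by (simp add: dist_norm)
  qed
  show "\<forall>\<^sub>F t in at_right 0. dist ((f (x + t *\<^sub>R u + t *\<^sub>R v) - f (x + t *\<^sub>R u) - f (x + t *\<^sub>R v) + f x) / t\<^sup>2) (D2 f x v u) < e"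
    unfolding L_def[symmetric] eventually_at_right_field
    using main d by (intro exI[of _ d]) auto
qed

lemma D_inner:
  assumes "f differentiable (at x)"
  shows "D (\<lambda>y. f y \<bullet> b) x u = D f x u \<bullet> b"
  using has_derivative_inner_left[OF D_works[OF assms], of b] by (simp add: D_eqI)

lemma D2_symmetric:
  fixes f :: "'a::euclidean_space \<Rightarrow> 'b::euclidean_space"
  assumes f: "twice_differentiable_at f x"
  shows "D2 f x u v = D2 f x v u"
proof (rule euclidean_eqI)
  fix b :: 'b
  let ?g = "\<lambda>y. f y \<bullet> b"
  have ev: "\<forall>\<^sub>F y in nhds x. f differentiable (at y)"
    using f by (simp add: twice_differentiable_at_def)
  have Dg: "\<forall>\<^sub>F y in nhds x. D ?g y w = D f y w \<bullet> b" for w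
    using ev by eventually_elim (rule D_inner)
  have dd: "(\<lambda>y. D f y w) differentiable (at x)" for w
    using f by (simp add: twice_differentiable_at_def)
  have D2g: "D2 ?g x w w' = D2 f x w w' \<bullet> b" for w w'
    using D_cong[OF Dg[of w']] D_inner[OF dd] by simp
  have ig: "(\<lambda>y. D f y w \<bullet> b) differentiable (at x)" for w
    using dd by (intro differentiable_inner) auto
  have g: "twice_differentiable_at ?g x"
    unfolding twice_differentiable_at_def
  proof
    show "\<forall>\<^sub>F y in nhds x. ?g differentiable (at y)"
      using ev by eventually_elim (auto intro: differentiable_inner)
    show "\<forall>v. (\<lambda>y. D ?g y v) differentiable (at x)"
    proof
      fix v
      have "\<forall>\<^sub>F y in nhds x. D f y v \<bullet> b = D ?g y v" using Dg[of v] by eventually_elim simp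
      then show "(\<lambda>y. D ?g y v) differentiable (at x)" using ig by (rule differentiable_cong)
    qed
  qed
  have "D2 ?g x v u = D2 ?g x u v"
    using tendsto_unique[OF _ second_difference_tendsto[OF g, of u v] ]
      second_difference_tendsto[OF g, of v u]
    by (simp add: algebra_simps)
  then show "D2 f x u v \<bullet> b = D2 f x v u \<bullet> b" by (simp add: D2g)
qed

text \<open>The product rule for a field of linear maps applied to a vector field, without
  operator-valued derivatives: expanding \<open>V\<close> in the basis leaves finitely many scalar
  multiples \<open>(V y \<bullet> b) *\<^sub>R F y b\<close>.\<close>

lemma has_derivative_apply_linear:
  fixes F :: "'a::euclidean_space \<Rightarrow> 'b::euclidean_space \<Rightarrow> 'c::euclidean_space"
  assumes lin: "\<forall>\<^sub>F y in nhds x. linear (F y)"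
    and F: "\<And>v. ((\<lambda>y. F y v) has_derivative F' v) (at x)"
    and V: "(V has_derivative V') (at x)"
  shows "((\<lambda>y. F y (V y)) has_derivative (\<lambda>u. F' (V x) u + F x (V' u))) (at x)"
proof -
  have expand: "linear G \<Longrightarrow> G w = (\<Sum>b\<in>Basis. (w \<bullet> b) *\<^sub>R G b)" for G :: "'b \<Rightarrow> 'c" and w
    by (metis (mono_tags, lifting) euclidean_representation linear_cmul linear_sum sum.cong)
  have lx: "linear (F x)" using lin eventually_nhds_x_imp_x by blast
  have lin': "linear (\<lambda>v. F' v u)" for u
  proof (rule linearI)
    fix v w :: 'b and r :: real
    have e1: "\<forall>\<^sub>F y in at x. F y v + F y w = F y (v + w)"
      using lin unfolding eventually_nhds_conv_at by (auto elim!: eventually_mono simp: linear_add)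
    have e2: "\<forall>\<^sub>F y in at x. r *\<^sub>R F y v = F y (r *\<^sub>R v)"
      using lin unfolding eventually_nhds_conv_at by (auto elim!: eventually_mono simp: linear_cmul)
    have "((\<lambda>y. F y (v + w)) has_derivative (\<lambda>u. F' v u + F' w u)) (at x)"
      by (rule has_derivative_transform_eventually[OF has_derivative_add[OF F F] e1])
        (use lx in \<open>auto simp: linear_add\<close>)
    then show "F' (v + w) u = F' v u + F' w u"
      using has_derivative_unique[OF F[of "v+w"]] by metis
    have "((\<lambda>y. F y (r *\<^sub>R v)) has_derivative (\<lambda>u. r *\<^sub>R F' v u)) (at x)"
      by (rule has_derivative_transform_eventually[OF has_derivative_scaleR_right[OF F] e2])
        (use lx in \<open>auto simp: linear_cmul\<close>)
    then show "F' (r *\<^sub>R v) u = r *\<^sub>R F' v u"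
      using has_derivative_unique[OF F[of "r *\<^sub>R v"]] by metis
  qed
  have "((\<lambda>y. \<Sum>b\<in>Basis. (V y \<bullet> b) *\<^sub>R F y b) has_derivative
      (\<lambda>u. \<Sum>b\<in>Basis. ((V x \<bullet> b) *\<^sub>R F' b u + (V' u \<bullet> b) *\<^sub>R F x b))) (at x)"
    by (intro has_derivative_sum has_derivative_scaleR has_derivative_inner_left V F)
  moreover have "(\<lambda>u. \<Sum>b\<in>Basis. ((V x \<bullet> b) *\<^sub>R F' b u + (V' u \<bullet> b) *\<^sub>R F x b))
     = (\<lambda>u. F' (V x) u + F x (V' u))"
    by (simp only: sum.distrib expand[OF lin', symmetric] expand[OF lx, symmetric])
  moreover have "\<forall>\<^sub>F y in at x. (\<Sum>b\<in>Basis. (V y \<bullet> b) *\<^sub>R F y b) = F y (V y)"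
    using lin unfolding eventually_nhds_conv_at by (auto elim!: eventually_mono intro: expand[symmetric])
  moreover have "(\<Sum>b\<in>Basis. (V x \<bullet> b) *\<^sub>R F x b) = F x (V x)" by (simp add: expand[OF lx, symmetric])
  ultimately show ?thesis
    using has_derivative_transform_eventually[of "\<lambda>y. \<Sum>b\<in>Basis. (V y \<bullet> b) *\<^sub>R F y b" _ x UNIV] by simp
qed

lemma eventually_nhds_continuous:
  assumes "isCont f x" "\<forall>\<^sub>F y in nhds (f x). P y"
  shows "\<forall>\<^sub>F y in nhds x. P (f y)"
proof -
  have "filterlim f (nhds (f x)) (nhds x)"
    using assms(1) by (simp only: continuous_at tendsto_at_iff_tendsto_nhds)
  then show ?thesis using assms(2) by (auto simp: filterlim_iff)
qed

lemma twice_differentiable_at_compose: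
  assumes f: "twice_differentiable_at f x" and g: "twice_differentiable_at g (f x)"
  shows "twice_differentiable_at (\<lambda>y. g (f y)) x"
proof -
  have df: "f differentiable (at x)" by (rule twice_differentiable_atD1[OF f])
  have cont: "isCont f x" using df differentiable_imp_continuous_within by blast
  have ef: "\<forall>\<^sub>F y in nhds x. f differentiable (at y)" using f by (simp add: twice_differentiable_at_def)
  have eg: "\<forall>\<^sub>F y in nhds x. g differentiable (at (f y))"
    using eventually_nhds_continuous[OF cont, of "\<lambda>z. g differentiable (at z)"] g
    by (simp add: twice_differentiable_at_def)
  have hd: "\<forall>\<^sub>F y in nhds x. ((\<lambda>y. g (f y)) has_derivative (\<lambda>v. D g (f y) (D f y v))) (at y)"
    using ef eg by eventually_elim (blast intro: has_derivative_compose D_works)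
  have "(\<lambda>y. D (\<lambda>y. g (f y)) y v) differentiable (at x)" for v
  proof (rule differentiable_cong)
    show "\<forall>\<^sub>F y in nhds x. D g (f y) (D f y v) = D (\<lambda>y. g (f y)) y v"
      using hd by eventually_elim (simp add: D_eqI)
    have "(\<lambda>z. D g z w) differentiable (at (f x))" for w
      using g by (simp add: twice_differentiable_at_def)
    then have F: "((\<lambda>y. D g (f y) w) has_derivative (\<lambda>u. D (\<lambda>z. D g z w) (f x) (D f x u))) (at x)" for w
      by (rule has_derivative_compose[OF D_works[OF df] D_works])
    have V: "((\<lambda>y. D f y v) has_derivative D (\<lambda>y. D f y v) x) (at x)"
      using f by (intro D_works) (simp add: twice_differentiable_at_def)
    have "\<forall>\<^sub>F y in nhds x. linear (D g (f y))"
      using eg by eventually_elim (rule linear_frechet_derivative)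
    from has_derivative_apply_linear[OF this F V]
    show "(\<lambda>y. D g (f y) (D f y v)) differentiable (at x)" by (rule differentiableI)
  qed
  moreover have "\<forall>\<^sub>F y in nhds x. (\<lambda>y. g (f y)) differentiable (at y)"
    using hd by eventually_elim (rule differentiableI)
  ultimately show ?thesis by (simp add: twice_differentiable_at_def)
qed

lemma twice_differentiable_at_cong:
  assumes "\<forall>\<^sub>F y in nhds x. f y = g y" "twice_differentiable_at f x"
  shows "twice_differentiable_at g x"
  unfolding twice_differentiable_at_def
proof (intro conjI allI)
  have ev: "\<forall>\<^sub>F y in nhds x. \<forall>\<^sub>F z in nhds y. f z = g z" using assms(1) by (simp add: eventually_eventually)
  have "\<forall>\<^sub>F y in nhds x. f differentiable (at y)"
    using assms(2) by (simp add: twice_differentiable_at_def)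
  with ev show "\<forall>\<^sub>F y in nhds x. g differentiable (at y)"
    by eventually_elim (rule differentiable_cong)
  fix v
  have "\<forall>\<^sub>F y in nhds x. D f y v = D g y v"
    using ev by eventually_elim (metis D_cong)
  then show "(\<lambda>y. D g y v) differentiable (at x)"
    by (rule differentiable_cong) (use assms(2) in \<open>simp add: twice_differentiable_at_def\<close>)
qed

section \<open>Smooth maps in charts\<close>

lemma is_chart_homeo:
  "is_chart c \<Longrightarrow> homeomorphism (fst c) (snd c ` fst c) (snd c) (chart_inv c)"
  by (simp add: is_chart_def)

lemma chart_inv_chart: "is_chart c \<Longrightarrow> x \<in> fst c \<Longrightarrow> chart_inv c (snd c x) = x"
  using is_chart_homeo by (metis homeomorphism_apply1)

lemma chart_chart_inv: "is_chart c \<Longrightarrow> y \<in> snd c ` fst c \<Longrightarrow> snd c (chart_inv c y) = y"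
  using is_chart_homeo by (metis homeomorphism_apply2)

lemma chart_inv_in: "is_chart c \<Longrightarrow> y \<in> snd c ` fst c \<Longrightarrow> chart_inv c y \<in> fst c"
  by (metis chart_inv_chart imageE)

lemma chart_image_open:
  assumes "is_chart c" "open V" "V \<subseteq> fst c"
  shows "open (snd c ` V)"
proof -
  have "openin (top_of_set (snd c ` fst c)) (snd c ` V)"
    using homeomorphism_imp_open_map[OF is_chart_homeo[OF assms(1)]] assms(2,3)
    by (metis open_openin_trans openin_open_Int inf.absorb_iff2 is_chart_def assms(1))
  then show ?thesis using assms(1) openin_open_trans is_chart_def by blast
qed

lemma chart_inv_prod:
  assumes "is_chart c" "is_chart d" "u \<in> snd c ` fst c" "v \<in> snd d ` fst d"
  shows "chart_inv (fst c \<times> fst d, map_prod (snd c) (snd d)) (u, v) = (chart_inv c u, chart_inv d v)"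
proof -
  have inj: "inj_on (map_prod (snd c) (snd d)) (fst c \<times> fst d)"
    by (auto simp: inj_on_def) (metis assms(1,2) chart_inv_chart)+
  have "(u, v) = map_prod (snd c) (snd d) (chart_inv c u, chart_inv d v)"
    using assms by (simp add: chart_chart_inv)
  then show ?thesis
    unfolding chart_inv_def using assms inj
    by (simp del: map_prod_simp) (metis (no_types, lifting) SigmaI chart_inv_def chart_inv_in inv_into_f_f)
qed

lemma is_chart_prod:
  assumes c: "is_chart c" and d: "is_chart d"
  shows "is_chart (fst c \<times> fst d, map_prod (snd c) (snd d))" (is "is_chart ?p")
proof -
  have im: "snd ?p ` fst ?p = (snd c ` fst c) \<times> (snd d ` fst d)"
    by (auto simp: map_prod_def image_iff)
  have cont: "continuous_on ((snd c ` fst c) \<times> (snd d ` fst d)) (\<lambda>(u, v). (chart_inv c u, chart_inv d v))"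
    using c d unfolding is_chart_def homeomorphism_def case_prod_beta
    by (intro continuous_on_Pair continuous_on_compose2[OF _ continuous_on_fst]
        continuous_on_compose2[OF _ continuous_on_snd] continuous_on_id) auto
  have "homeomorphism (fst ?p) (snd ?p ` fst ?p) (snd ?p) (chart_inv ?p)"
    unfolding homeomorphism_def im
  proof (intro conjI ballI)
    show "chart_inv ?p (snd ?p x) = x" if "x \<in> fst ?p" for x
      using that c d by (auto simp: chart_inv_prod chart_inv_chart)
    show "(snd c ` fst c) \<times> (snd d ` fst d) = (snd c ` fst c) \<times> (snd d ` fst d)" by (rule refl)
    show "continuous_on (fst ?p) (snd ?p)"
      using c d unfolding is_chart_def homeomorphism_def map_prod_def case_prod_beta fst_conv snd_conv
      by (intro continuous_on_Pair continuous_on_compose2[OF _ continuous_on_fst]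
        continuous_on_compose2[OF _ continuous_on_snd] continuous_on_id) auto
    show "snd ?p (chart_inv ?p y) = y" if "y \<in> (snd c ` fst c) \<times> (snd d ` fst d)" for y
      using that c d by (auto simp: chart_inv_prod chart_inv_chart)
    show "chart_inv ?p ` ((snd c ` fst c) \<times> (snd d ` fst d)) = fst ?p"
    proof
      show "chart_inv ?p ` ((snd c ` fst c) \<times> (snd d ` fst d)) \<subseteq> fst ?p"
        using c d by (auto simp: chart_inv_prod chart_inv_chart)
      show "fst ?p \<subseteq> chart_inv ?p ` ((snd c ` fst c) \<times> (snd d ` fst d))"
      proof
        fix x assume x: "x \<in> fst ?p"
        then have "x = chart_inv ?p (snd c (fst x), snd d (snd x))"
          using c d by (auto simp: chart_inv_prod chart_inv_chart)
        moreover have "(snd c (fst x), snd d (snd x)) \<in> (snd c ` fst c) \<times> (snd d ` fst d)"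
          using x by (auto simp: mem_Times_iff)
        ultimately show "x \<in> chart_inv ?p ` ((snd c ` fst c) \<times> (snd d ` fst d))"
          by (rule image_eqI)
      qed
    qed
    show "continuous_on ((snd c ` fst c) \<times> (snd d ` fst d)) (chart_inv ?p)"
      by (rule continuous_on_eq[OF cont]) (use c d in \<open>auto simp: chart_inv_prod\<close>)
  qed
  moreover have "open (fst ?p)" "open (snd ?p ` fst ?p)"
    unfolding im using c d by (auto simp: is_chart_def intro: open_Times)
  ultimately show ?thesis unfolding is_chart_def by simp
qed

lemma smooth_map_twice_differentiable_at:
  assumes f: "smooth_map A B f" and c: "c \<in> A" "is_chart c" and d: "d \<in> B" "is_chart d"
    and x: "x \<in> fst c" "f x \<in> fst d"
  shows "twice_differentiable_at (\<lambda>y. snd d (f (chart_inv c y))) (snd c x)"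
proof -
  have "open (fst c \<inter> f -` fst d)"
    using f c d unfolding smooth_map_def is_chart_def
    by (intro open_Int open_vimage) auto
  then have "open (snd c ` (fst c \<inter> f -` fst d))"
    using c by (intro chart_image_open) auto
  moreover have "smooth_on (snd c ` (fst c \<inter> f -` fst d)) (\<lambda>y. snd d (f (chart_inv c y)))"
    using f c d unfolding smooth_map_def comp_def by blast
  ultimately show ?thesis
    using x by (intro smooth_on_imp_twice_differentiable_at) auto
qed

text \<open>The inverse of the product chart equals the pair of inverses only on the image of the
  chart, an open set; this is enough because \<open>twice_differentiable_at\<close> sees only
  germs.\<close>

lemma smooth_map_prod_twice_differentiable_at:
  assumes f: "smooth_map (prod_atlas A B) C f" and a: "a \<in> A" "is_chart a"
    and b: "b \<in> B" "is_chart b" and d: "d \<in> C" "is_chart d"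
    and xy: "x \<in> fst a" "y \<in> fst b" "f (x, y) \<in> fst d"
  shows "twice_differentiable_at (\<lambda>z. snd d (f (chart_inv a (fst z), chart_inv b (snd z)))) (snd a x, snd b y)"
proof -
  let ?p = "(fst a \<times> fst b, map_prod (snd a) (snd b))"
  have "?p \<in> prod_atlas A B" using a b unfolding prod_atlas_def by blast
  from smooth_map_twice_differentiable_at[OF f this is_chart_prod[OF a(2) b(2)] d, of "(x, y)"]
  have "twice_differentiable_at (\<lambda>z. snd d (f (chart_inv ?p z))) (snd a x, snd b y)"
    using xy by simp
  moreover have "\<forall>\<^sub>F z in nhds (snd a x, snd b y).
      snd d (f (chart_inv ?p z)) = snd d (f (chart_inv a (fst z), chart_inv b (snd z)))"
    unfolding eventually_nhds
    using a b xy
    by (intro exI[of _ "(snd a ` fst a) \<times> (snd b ` fst b)"])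
      (auto simp: is_chart_def chart_inv_prod intro!: open_Times)
  ultimately show ?thesis by (rule twice_differentiable_at_cong[rotated])
qed

section \<open>The Lie algebra of a Lie group\<close>

lemma D_compose:
  "f differentiable (at x) \<Longrightarrow> g differentiable (at (f x)) \<Longrightarrow>
   ((\<lambda>y. g (f y)) has_derivative (\<lambda>v. D g (f x) (D f x v))) (at x)"
  by (rule has_derivative_compose[OF D_works D_works])

lemma twice_differentiable_at_affine:
  assumes "\<And>y. (f has_derivative f') (at y)"
  shows "twice_differentiable_at f x"
  using assms unfolding twice_differentiable_at_def
  by (auto simp: D_eqI[OF assms] intro!: differentiableI eventuallyI)

lemma twice_differentiable_at_Pair1: "twice_differentiable_at (\<lambda>y. (a, y)) x"
  by (rule twice_differentiable_at_affine[of _ "\<lambda>w. (0, w)"])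
    (rule has_derivative_Pair[OF has_derivative_const has_derivative_ident])

lemma twice_differentiable_at_Pair2: "twice_differentiable_at (\<lambda>y. (y, a)) x"
  by (rule twice_differentiable_at_affine[of _ "\<lambda>w. (w, 0)"])
    (rule has_derivative_Pair[OF has_derivative_ident has_derivative_const])

lemma has_derivative_transform_nhds:
  "(f has_derivative f') (at x) \<Longrightarrow> \<forall>\<^sub>F y in nhds x. f y = g y \<Longrightarrow> (g has_derivative f') (at x)"
  by (simp add: has_derivative_cong_nhds)

locale lie_group_chart =
  fixes A :: "('k::{t2_space, second_countable_topology}, 'l::euclidean_space) chart set"
    and gmul e ginv c
  assumes lie_group: "lie_group A gmul e ginv" and c_in: "c \<in> A" and e_in: "e \<in> fst c"
begin

abbreviation "\<phi> \<equiv> snd c"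
abbreviation "\<psi> \<equiv> chart_inv c"

definition "y0 = \<phi> e"
definition "\<mu> z = \<phi> (gmul (\<psi> (fst z)) (\<psi> (snd z)))"
definition "L x w = D (\<lambda>z. \<mu> (x, z)) y0 w"
text \<open>The mixed second-order term of the multiplication at the unit. It is also the derivative
  in direction u of the left-invariant field of w, so its skew part is the bracket.\<close>

definition "B u w = D2 \<mu> (y0, y0) (u, 0) (0, w)"
text \<open>Conjugation by k in the chart. It is studied for k near the unit, where k and its
  inverse both lie in \<open>c\<close> and conjugation is two applications of \<mu>.\<close>

definition "cnjg k y = \<phi> (gmul (gmul k (\<psi> y)) (ginv k))"
definition "Ad k = D (cnjg k) y0"

abbreviation "br \<equiv> lie_bracket gmul e c"

lemma group: "Groups.group gmul e ginv"
  using lie_group by (simp add: lie_group_def)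

lemma assoc: "gmul (gmul x y) z = gmul x (gmul y z)"
  using group by (simp add: Groups.group_def semigroup.assoc)

lemma e_left [simp]: "gmul e x = x"
  using group by (simp add: Groups.group.group_left_neutral)

lemma inv_left [simp]: "gmul (ginv x) x = e"
  using group by (simp add: Groups.group.left_inverse)

lemma inv_right [simp]: "gmul x (ginv x) = e"
  using group by (simp add: Groups.group.right_inverse)

lemma e_right [simp]: "gmul x e = x"
  by (metis assoc e_left inv_left inv_right)

lemma inv_e [simp]: "ginv e = e"
  by (metis e_left inv_right)

lemma chart: "is_chart c"
  using lie_group c_in by (auto simp: lie_group_def smooth_atlas_def)

lemma \<psi>\<phi> [simp]: "x \<in> fst c \<Longrightarrow> \<psi> (\<phi> x) = x"
  by (rule chart_inv_chart[OF chart])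

lemma \<psi>_y0 [simp]: "\<psi> y0 = e"
  by (simp add: y0_def e_in)

lemma y0_in: "y0 \<in> \<phi> ` fst c"
  by (simp add: y0_def e_in)

lemma continuous_mul: "continuous_on UNIV (\<lambda>(a, b). gmul a b)"
  using lie_group by (simp add: lie_group_def smooth_map_def)

lemma continuous_mul_left: "continuous_on UNIV (\<lambda>b. gmul a b)"
  using continuous_on_compose2[OF continuous_mul, of UNIV "\<lambda>b. (a, b)"]
  by (simp add: continuous_on_Pair)

lemma continuous_mul_right: "continuous_on UNIV (\<lambda>a. gmul a b)"
  using continuous_on_compose2[OF continuous_mul, of UNIV "\<lambda>a. (a, b)"]
  by (simp add: continuous_on_Pair)

lemma continuous_inv: "continuous_on UNIV ginv"
  using lie_group by (simp add: lie_group_def smooth_map_def)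

lemma eventually_chart:
  assumes "k \<in> fst c" "open S" "k \<in> S"
  shows "\<forall>\<^sub>F x in nhds (\<phi> k). x \<in> \<phi> ` fst c \<and> \<psi> x \<in> fst c \<and> \<phi> (\<psi> x) = x \<and> \<psi> x \<in> S"
  unfolding eventually_nhds
  using assms by (intro exI[of _ "\<phi> ` (fst c \<inter> S)"] conjI chart_image_open[OF chart])
    (use chart in \<open>auto simp: is_chart_def\<close>)

lemmas eventually_chart_y0 = eventually_chart[of e, folded y0_def, OF e_in]

lemma \<mu>_twice:
  assumes "a \<in> fst c" "b \<in> fst c" "gmul a b \<in> fst c"
  shows "twice_differentiable_at \<mu> (\<phi> a, \<phi> b)"
proof -
  have "smooth_map (prod_atlas A A) A (\<lambda>(a, b). gmul a b)"
    using lie_group by (simp add: lie_group_def)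
  from smooth_map_prod_twice_differentiable_at[OF this c_in chart c_in chart c_in chart]
  show ?thesis using assms unfolding \<mu>_def by simp
qed

lemma \<mu>_diff:
  "a \<in> fst c \<Longrightarrow> b \<in> fst c \<Longrightarrow> gmul a b \<in> fst c \<Longrightarrow> \<mu> differentiable (at (\<phi> a, \<phi> b))"
  by (rule twice_differentiable_atD1[OF \<mu>_twice])

lemma \<mu>_right: "x \<in> \<phi> ` fst c \<Longrightarrow> \<mu> (x, y0) = x"
  by (simp add: \<mu>_def chart_chart_inv[OF chart])

lemma \<mu>_left: "x \<in> \<phi> ` fst c \<Longrightarrow> \<mu> (y0, x) = x"
  by (simp add: \<mu>_def chart_chart_inv[OF chart])

lemma \<mu>_slice_right:
  assumes "\<mu> differentiable (at (x, y))"
  shows "((\<lambda>z. \<mu> (x, z)) has_derivative (\<lambda>w. D \<mu> (x, y) (0, w))) (at y)"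
proof -
  have "((\<lambda>z. (x, z)) has_derivative (\<lambda>w. (0, w))) (at y)"
    by (intro has_derivative_Pair has_derivative_const has_derivative_ident)
  from has_derivative_compose[OF this D_works[OF assms]] show ?thesis .
qed

lemma \<mu>_slice_left:
  assumes "\<mu> differentiable (at (x, y))"
  shows "((\<lambda>z. \<mu> (z, y)) has_derivative (\<lambda>w. D \<mu> (x, y) (w, 0))) (at x)"
proof -
  have "((\<lambda>z. (z, y)) has_derivative (\<lambda>w. (w, 0))) (at x)"
    by (intro has_derivative_Pair has_derivative_const has_derivative_ident)
  from has_derivative_compose[OF this D_works[OF assms]] show ?thesis .
qed

lemma \<mu>_diff_y0: "x \<in> \<phi> ` fst c \<Longrightarrow> \<mu> differentiable (at (x, y0))"
  using \<mu>_diff[of "\<psi> x" e] e_in chart by (auto simp: y0_def)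

lemma L_eq: "x \<in> \<phi> ` fst c \<Longrightarrow> L x w = D \<mu> (x, y0) (0, w)"
  unfolding L_def by (rule fun_cong[OF D_eqI[OF \<mu>_slice_right[OF \<mu>_diff_y0]]])

lemma has_derivative_L: "x \<in> \<phi> ` fst c \<Longrightarrow> ((\<lambda>z. \<mu> (x, z)) has_derivative L x) (at y0)"
  by (rule has_derivative_eq_rhs[OF \<mu>_slice_right[OF \<mu>_diff_y0]]) (simp_all add: L_eq fun_eq_iff)

lemma linear_L: "x \<in> \<phi> ` fst c \<Longrightarrow> linear (L x)"
  using has_derivative_L has_derivative_linear by blast

lemma eventually_U: "\<forall>\<^sub>F x in nhds y0. x \<in> \<phi> ` fst c"
  using eventually_chart_y0[of UNIV] by (auto elim!: eventually_mono)

lemma L_y0 [simp]: "L y0 w = w"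
proof -
  have "\<forall>\<^sub>F z in nhds y0. \<mu> (y0, z) = z" using eventually_U by eventually_elim (rule \<mu>_left)
  then show ?thesis unfolding L_def by (subst D_cong) auto
qed

lemma D\<mu>_y0: "D \<mu> (y0, y0) (u, w) = u + w"
proof -
  have d: "\<mu> differentiable (at (y0, y0))" by (rule \<mu>_diff_y0[OF y0_in])
  have "\<forall>\<^sub>F z in nhds y0. \<mu> (z, y0) = z" using eventually_U by eventually_elim (rule \<mu>_right)
  then have "D (\<lambda>z. \<mu> (z, y0)) y0 = (\<lambda>z. z)" by (subst D_cong) auto
  then have "D \<mu> (y0, y0) (u, 0) = u" for u
    using D_eqI[OF \<mu>_slice_left[OF d]] by metis
  moreover have "D \<mu> (y0, y0) (0, w) = w" for w using L_eq[OF y0_in] by simp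
  moreover have "D \<mu> (y0, y0) ((u, 0) + (0, w)) = D \<mu> (y0, y0) (u, 0) + D \<mu> (y0, y0) (0, w)"
    using linear_frechet_derivative[OF d] by (rule linear_add)
  ultimately show ?thesis by simp
qed

lemma \<mu>_twice_y0: "twice_differentiable_at \<mu> (y0, y0)"
  unfolding y0_def by (rule \<mu>_twice) (simp_all add: e_in)

lemma D2\<mu>: "((\<lambda>z. D \<mu> z w) has_derivative (\<lambda>u. D2 \<mu> (y0, y0) u w)) (at (y0, y0))"
  using \<mu>_twice_y0 unfolding twice_differentiable_at_def by (intro D_works) blast

lemma has_derivative_B: "((\<lambda>x. L x w) has_derivative (\<lambda>u. B u w)) (at y0)"
proof -
  have "((\<lambda>z. (z, y0)) has_derivative (\<lambda>w. (w, 0))) (at y0)"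
    by (intro has_derivative_Pair has_derivative_const has_derivative_ident)
  from has_derivative_compose[OF this D2\<mu>]
  have "((\<lambda>x. D \<mu> (x, y0) (0, w)) has_derivative (\<lambda>u. B u w)) (at y0)" by (simp add: B_def)
  moreover have "\<forall>\<^sub>F x in nhds y0. D \<mu> (x, y0) (0, w) = L x w"
    using eventually_U by eventually_elim (simp add: L_eq)
  ultimately show ?thesis by (rule has_derivative_transform_nhds)
qed

lemma bracket_eq: "br u v = B u v - B v u"
proof -
  have "left_invariant_field gmul e c u = (\<lambda>y. L y u)" for u
    by (simp add: left_invariant_field_def tangent_map_def L_def \<mu>_def y0_def comp_def fun_eq_iff)
  then show ?thesis
    unfolding lie_bracket_def field_bracket_def y0_def[symmetric]
    by (simp add: D_eqI[OF has_derivative_B])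
qed

lemma linear_B_left: "linear (\<lambda>u. B u w)"
  using has_derivative_B has_derivative_linear by blast

lemma linear_B_right: "linear (\<lambda>w. B u w)"
proof (rule linearI)
  fix v w :: 'l and r :: real
  have e1: "\<forall>\<^sub>F x in nhds y0. L x v + L x w = L x (v + w)"
    using eventually_U by eventually_elim (simp add: linear_add[OF linear_L])
  have e2: "\<forall>\<^sub>F x in nhds y0. r *\<^sub>R L x w = L x (r *\<^sub>R w)"
    using eventually_U by eventually_elim (simp add: linear_cmul[OF linear_L])
  show "B u (v + w) = B u v + B u w"
    using has_derivative_add[OF has_derivative_B has_derivative_B, of v w]
      has_derivative_unique[OF has_derivative_B] has_derivative_cong_nhds[OF e1] by metis
  show "B u (r *\<^sub>R w) = r *\<^sub>R B u w"
    using has_derivative_scaleR_right[OF has_derivative_B, of r w]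
      has_derivative_unique[OF has_derivative_B] has_derivative_cong_nhds[OF e2] by metis
qed

lemma bilinear_bracket: "bilinear br"
  unfolding bilinear_def bracket_eq[abs_def]
  using linear_B_left linear_B_right by (auto intro: linear_compose_sub)

lemma bracket_skew: "br u v = - br v u"
  by (simp add: bracket_eq)

text \<open>Differentiating the homomorphism property once shows that f carries left-invariant
  fields to left-invariant fields (\<open>key\<close>). Differentiating again produces a term
  \<open>D2 f\<close>, which is symmetric and cancels in the bracket. The hypothesis is about germs
  because a conjugation read in one chart is multiplicative only near the unit.\<close>

lemma hom_bracket:
  assumes f: "twice_differentiable_at f y0" and f0: "f y0 = y0"
    and hom: "\<forall>\<^sub>F x in nhds y0. \<forall>\<^sub>F y in nhds y0. f (\<mu> (x, y)) = \<mu> (f x, f y)"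
  shows "D f y0 (br u v) = br (D f y0 u) (D f y0 v)"
proof -
  have df: "f differentiable (at y0)" by (rule twice_differentiable_atD1[OF f])
  have cont: "isCont f y0" using df differentiable_imp_continuous_within by blast
  have efU: "\<forall>\<^sub>F x in nhds y0. f x \<in> \<phi> ` fst c"
    using eventually_nhds_continuous[OF cont, of "\<lambda>x. x \<in> \<phi> ` fst c"] eventually_U by (simp add: f0)
  have ef: "\<forall>\<^sub>F x in nhds y0. f differentiable (at x)"
    using f by (simp add: twice_differentiable_at_def)
  have key: "\<forall>\<^sub>F x in nhds y0. D f x (L x w) = L (f x) (D f y0 w)" for w
    using hom efU ef eventually_U
  proof eventually_elim
    case (elim x)
    have "((\<lambda>y. f (\<mu> (x, y))) has_derivative (\<lambda>w. D f x (L x w))) (at y0)"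
      by (rule has_derivative_compose[OF has_derivative_L[OF elim(4)]])
        (simp add: \<mu>_right[OF elim(4)] D_works[OF elim(3)])
    moreover have "((\<lambda>y. \<mu> (f x, f y)) has_derivative (\<lambda>w. L (f x) (D f y0 w))) (at y0)"
      by (rule has_derivative_compose[OF D_works[OF df]]) (simp add: f0 has_derivative_L[OF elim(2)])
    then have "((\<lambda>y. f (\<mu> (x, y))) has_derivative (\<lambda>w. L (f x) (D f y0 w))) (at y0)"
      by (simp only: has_derivative_cong_nhds[OF elim(1)])
    ultimately have "(\<lambda>w. D f x (L x w)) = (\<lambda>w. L (f x) (D f y0 w))" by (rule has_derivative_unique)
    then show ?case by (simp only: fun_eq_iff)
  qed
  have "D2 f y0 u w + D f y0 (B u w) = B (D f y0 u) (D f y0 w)" for u w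
  proof -
    have "((\<lambda>x. D f x (L x w)) has_derivative (\<lambda>u. D2 f y0 u (L y0 w) + D f y0 (B u w))) (at y0)"
    proof (rule has_derivative_apply_linear[OF _ _ has_derivative_B])
      show "\<forall>\<^sub>F y in nhds y0. linear (D f y)"
        using ef by eventually_elim (rule linear_frechet_derivative)
      show "((\<lambda>y. D f y v) has_derivative (\<lambda>u. D2 f y0 u v)) (at y0)" for v
        using f by (intro D_works) (simp add: twice_differentiable_at_def)
    qed
    moreover have "((\<lambda>x. L (f x) (D f y0 w)) has_derivative (\<lambda>u. B (D f y0 u) (D f y0 w))) (at y0)"
      by (rule has_derivative_compose[OF D_works[OF df]]) (simp add: f0 has_derivative_B)
    then have "((\<lambda>x. D f x (L x w)) has_derivative (\<lambda>u. B (D f y0 u) (D f y0 w))) (at y0)"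
      by (simp only: has_derivative_cong_nhds[OF key])
    ultimately have "(\<lambda>u. D2 f y0 u (L y0 w) + D f y0 (B u w)) = (\<lambda>u. B (D f y0 u) (D f y0 w))"
      by (rule has_derivative_unique)
    then show ?thesis by (simp add: fun_eq_iff)
  qed
  from this[of u v] this[of v u] D2_symmetric[OF f, of u v]
  have "B (D f y0 u) (D f y0 v) - B (D f y0 v) (D f y0 u) =
      (D2 f y0 u v + D f y0 (B u v)) - (D2 f y0 u v + D f y0 (B v u))" by simp
  then show ?thesis
    by (simp add: bracket_eq linear_diff[OF linear_frechet_derivative[OF df]])
qed

section \<open>The adjoint action and the Jacobi identity\<close>

lemma cnjg_y0: "cnjg k y0 = y0"
  by (simp add: cnjg_def y0_def[symmetric])

lemma eventually_cnjg:
  assumes k: "k \<in> fst c"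
  shows "\<forall>\<^sub>F y in nhds y0. cnjg k y = \<mu> (\<mu> (\<phi> k, y), \<phi> (ginv k)) \<or> ginv k \<notin> fst c"
proof -
  have "open ((\<lambda>b. gmul k b) -` fst c)"
    using chart by (intro open_vimage continuous_mul_left) (simp add: is_chart_def)
  from eventually_chart_y0[OF this] k show ?thesis
    by (auto elim!: eventually_mono simp: cnjg_def \<mu>_def)
qed

lemma cnjg_twice:
  assumes k: "k \<in> fst c" "ginv k \<in> fst c"
  shows "twice_differentiable_at (cnjg k) y0"
proof -
  have k0: "\<mu> (\<phi> k, y0) = \<phi> k" using k by (simp add: \<mu>_right)
  have l: "twice_differentiable_at (\<lambda>y. \<mu> (\<phi> k, y)) y0"
    by (rule twice_differentiable_at_compose[OF twice_differentiable_at_Pair1])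
      (use \<mu>_twice[of k e] k e_in in \<open>simp add: y0_def\<close>)
  have "twice_differentiable_at (\<lambda>y. \<mu> (y, \<phi> (ginv k))) (\<phi> k)"
    by (rule twice_differentiable_at_compose[OF twice_differentiable_at_Pair2])
      (use \<mu>_twice[of k "ginv k"] k e_in in simp)
  then have "twice_differentiable_at (\<lambda>y. \<mu> (\<mu> (\<phi> k, y), \<phi> (ginv k))) y0"
    using twice_differentiable_at_compose[OF l, of "\<lambda>y. \<mu> (y, \<phi> (ginv k))"] k0 by simp
  moreover have "\<forall>\<^sub>F y in nhds y0. \<mu> (\<mu> (\<phi> k, y), \<phi> (ginv k)) = cnjg k y"
    using eventually_cnjg[OF k(1)] by eventually_elim (use k in auto)
  ultimately show ?thesis by (rule twice_differentiable_at_cong[rotated])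
qed

lemma open_cnjg_vimage: "open ((\<lambda>b. gmul (gmul k b) (ginv k)) -` fst c)"
  using chart continuous_on_compose2[OF continuous_mul_right[of "ginv k"] continuous_mul_left[of k]]
  by (intro open_vimage) (simp_all add: is_chart_def)

lemma eventually_cnjg_in:
  "\<forall>\<^sub>F y in nhds y0. \<psi> y \<in> fst c \<and> \<psi> (cnjg k y) = gmul (gmul k (\<psi> y)) (ginv k) \<and> cnjg k y \<in> \<phi> ` fst c"
  using eventually_chart_y0[OF open_cnjg_vimage[of k]] e_in
  by (auto elim!: eventually_mono simp: cnjg_def)

lemma Ad_bracket:
  assumes k: "k \<in> fst c" "ginv k \<in> fst c"
  shows "Ad k (br u v) = br (Ad k u) (Ad k v)"
  unfolding Ad_def
proof (rule hom_bracket[OF cnjg_twice[OF k] cnjg_y0])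
  show "\<forall>\<^sub>F x in nhds y0. \<forall>\<^sub>F y in nhds y0. cnjg k (\<mu> (x, y)) = \<mu> (cnjg k x, cnjg k y)"
    using eventually_cnjg_in[of k]
  proof eventually_elim
    case (elim x)
    have "open ((\<lambda>b. gmul (\<psi> x) b) -` fst c)"
      using chart by (intro open_vimage continuous_mul_left) (simp add: is_chart_def)
    from eventually_chart_y0[OF this] elim have "\<forall>\<^sub>F y in nhds y0. gmul (\<psi> x) (\<psi> y) \<in> fst c"
      by (auto elim!: eventually_mono)
    with eventually_cnjg_in[of k] show ?case
    proof eventually_elim
      case (elim y)
      have "gmul (gmul k (gmul (\<psi> x) (\<psi> y))) (ginv k) =
          gmul (gmul (gmul k (\<psi> x)) (ginv k)) (gmul (gmul k (\<psi> y)) (ginv k))"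
        by (metis assoc e_left inv_left)
      then show ?case
        using elim \<open>\<psi> x \<in> fst c \<and> _\<close> by (simp add: \<mu>_def) (simp add: cnjg_def)
    qed
  qed
qed

text \<open>The derivative of Ad is ad. By \<open>key\<close>, \<open>Ad\<close> at x is the left
  translation \<open>L x\<close> followed by right translation by the inverse \<iota> x; the first
  factor contributes \<open>B u w\<close>, the second \<open>- B w u\<close>.\<close>

lemma has_derivative_Ad: "((\<lambda>x. Ad (\<psi> x) w) has_derivative (\<lambda>u. br u w)) (at y0)"
proof -
  define \<iota> where "\<iota> x = \<phi> (ginv (\<psi> x))" for x
  have ev: "\<forall>\<^sub>F x in nhds y0. x \<in> \<phi> ` fst c \<and> \<psi> x \<in> fst c \<and> \<phi> (\<psi> x) = x \<and> ginv (\<psi> x) \<in> fst c"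
  proof -
    have "open (ginv -` fst c)"
      using chart by (intro open_vimage continuous_inv) (simp add: is_chart_def)
    from eventually_chart_y0[OF this] show ?thesis using e_in by (auto elim!: eventually_mono)
  qed
  have diff: "\<mu> differentiable (at (x, \<iota> x))" if "\<psi> x \<in> fst c \<and> \<phi> (\<psi> x) = x \<and> ginv (\<psi> x) \<in> fst c" for x
    using \<mu>_diff[of "\<psi> x" "ginv (\<psi> x)"] that e_in by (simp add: \<iota>_def)
  have \<iota>0: "\<iota> y0 = y0" by (simp add: \<iota>_def y0_def e_in)
  have "smooth_map A A ginv" using lie_group by (simp add: lie_group_def)
  from twice_differentiable_atD1[OF smooth_map_twice_differentiable_at[OF this c_in chart c_in chart e_in]]
  have \<iota>_diff: "\<iota> differentiable (at y0)" using e_in by (simp add: \<iota>_def[abs_def] y0_def)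
  have pair: "((\<lambda>x. (x, \<iota> x)) has_derivative (\<lambda>u. (u, D \<iota> y0 u))) (at y0)"
    by (intro has_derivative_Pair has_derivative_ident D_works \<iota>_diff)
  \<comment> \<open>Differentiate the constant function \<mu> (x, \<iota> x), using that \<mu> is
    addition to first order.\<close>
  have \<iota>': "D \<iota> y0 u = - u" for u
  proof -
    have "((\<lambda>x. \<mu> (x, \<iota> x)) has_derivative (\<lambda>u. D \<mu> (y0, y0) (u, D \<iota> y0 u))) (at y0)"
      by (rule has_derivative_compose[OF pair]) (simp add: \<iota>0 D_works[OF \<mu>_diff_y0[OF y0_in]])
    moreover have "\<forall>\<^sub>F x in nhds y0. \<mu> (x, \<iota> x) = y0"
      using ev by eventually_elim (simp add: \<mu>_def \<iota>_def y0_def)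
    then have "((\<lambda>x. \<mu> (x, \<iota> x)) has_derivative (\<lambda>u. 0)) (at y0)"
      by (subst has_derivative_cong_nhds) auto
    ultimately have "(\<lambda>u. D \<mu> (y0, y0) (u, D \<iota> y0 u)) = (\<lambda>u. 0)" by (rule has_derivative_unique)
    then have "u + D \<iota> y0 u = 0" by (metis D\<mu>_y0)
    then show ?thesis by (simp add: eq_neg_iff_add_eq_0 add.commute)
  qed
  have key: "\<forall>\<^sub>F x in nhds y0. D \<mu> (x, \<iota> x) (L x w, 0) = Ad (\<psi> x) w"
    using ev
  proof eventually_elim
    case (elim x)
    have "((\<lambda>y. \<mu> (\<mu> (x, y), \<iota> x)) has_derivative (\<lambda>w. D \<mu> (x, \<iota> x) (L x w, 0))) (at y0)"
      using elim by (intro has_derivative_compose[OF has_derivative_L, of _ "\<lambda>z. \<mu> (z, \<iota> x)"])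
        (auto simp: \<mu>_right intro: \<mu>_slice_left diff)
    moreover have "\<forall>\<^sub>F y in nhds y0. \<mu> (\<mu> (x, y), \<iota> x) = cnjg (\<psi> x) y"
      using eventually_cnjg[of "\<psi> x"] elim by (auto elim!: eventually_mono simp: \<iota>_def)
    ultimately have "(cnjg (\<psi> x) has_derivative (\<lambda>w. D \<mu> (x, \<iota> x) (L x w, 0))) (at y0)"
      by (rule has_derivative_transform_nhds)
    then show ?case unfolding Ad_def by (simp add: D_eqI)
  qed
  have F: "((\<lambda>x. D \<mu> (x, \<iota> x) (v, 0)) has_derivative (\<lambda>u. D2 \<mu> (y0, y0) (u, - u) (v, 0))) (at y0)" for v
    using has_derivative_compose[OF pair, unfolded \<iota>0, OF D2\<mu>] by (simp add: \<iota>')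
  have lin: "\<forall>\<^sub>F x in nhds y0. linear (\<lambda>v. D \<mu> (x, \<iota> x) (v, 0))"
    using ev
  proof eventually_elim
    case (elim x)
    have "((\<lambda>z. \<mu> (z, \<iota> x)) has_derivative (\<lambda>w. D \<mu> (x, \<iota> x) (w, 0))) (at x)"
      using elim by (intro \<mu>_slice_left diff) auto
    then show ?case by (rule has_derivative_linear)
  qed
  have "((\<lambda>x. D \<mu> (x, \<iota> x) (L x w, 0)) has_derivative
      (\<lambda>u. D2 \<mu> (y0, y0) (u, - u) (L y0 w, 0) + D \<mu> (y0, \<iota> y0) (B u w, 0))) (at y0)"
    by (rule has_derivative_apply_linear[OF lin F has_derivative_B])
  \<comment> \<open>Moving the first slot contributes nothing, since right translation by the unit
    is the identity; moving the second slot gives \<open>B w u\<close> by symmetry of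
    \<open>D2\<close>.\<close>
  moreover have "D2 \<mu> (y0, y0) (u, - u) (w, 0) = - B w u" for u
  proof -
    have lin: "linear (\<lambda>u. D2 \<mu> (y0, y0) u (w, 0))" using D2\<mu> has_derivative_linear by blast
    have "((\<lambda>z. (z, y0)) has_derivative (\<lambda>w. (w, 0))) (at y0)"
      by (intro has_derivative_Pair has_derivative_const has_derivative_ident)
    from has_derivative_compose[OF this D2\<mu>]
    have "((\<lambda>x. D \<mu> (x, y0) (w, 0)) has_derivative (\<lambda>u. D2 \<mu> (y0, y0) (u, 0) (w, 0))) (at y0)" .
    moreover have "\<forall>\<^sub>F x in nhds y0. D \<mu> (x, y0) (w, 0) = w"
      using eventually_eventually[THEN iffD2, OF eventually_U] eventually_U
    proof eventually_elim
      case (elim x)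
      have "\<forall>\<^sub>F z in nhds x. \<mu> (z, y0) = z" using elim(1) by eventually_elim (rule \<mu>_right)
      then have "D (\<lambda>z. \<mu> (z, y0)) x = (\<lambda>z. z)" by (subst D_cong) auto
      then show ?case using D_eqI[OF \<mu>_slice_left[OF \<mu>_diff_y0[OF elim(2)]]] by metis
    qed
    then have "((\<lambda>x. D \<mu> (x, y0) (w, 0)) has_derivative (\<lambda>u. 0)) (at y0)"
      by (subst has_derivative_cong_nhds) auto
    ultimately have "(\<lambda>u. D2 \<mu> (y0, y0) (u, 0) (w, 0)) = (\<lambda>u. 0)" by (rule has_derivative_unique)
    then have "D2 \<mu> (y0, y0) (u, 0) (w, 0) = 0" by metis
    moreover have "D2 \<mu> (y0, y0) (0, u) (w, 0) = B w u"
      unfolding B_def by (rule D2_symmetric[OF \<mu>_twice_y0])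
    moreover have "(u, - u) = (u, 0) - (0, u)" by simp
    ultimately show ?thesis using linear_diff[OF lin, of "(u, 0)" "(0, u)"] by simp
  qed
  ultimately have "((\<lambda>x. D \<mu> (x, \<iota> x) (L x w, 0)) has_derivative (\<lambda>u. br u w)) (at y0)"
    by (simp add: \<iota>0 D\<mu>_y0 bracket_eq)
  then show ?thesis using key by (rule has_derivative_transform_nhds)
qed

lemma eventually_inv_chart: "\<forall>\<^sub>F x in nhds y0. \<psi> x \<in> fst c \<and> ginv (\<psi> x) \<in> fst c"
proof -
  have "open (ginv -` fst c)"
    using chart by (intro open_vimage continuous_inv) (simp add: is_chart_def)
  from eventually_chart_y0[OF this] show ?thesis using e_in by (auto elim!: eventually_mono)
qed

lemma Ad_e: "Ad e w = w"
proof -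
  have "\<forall>\<^sub>F y in nhds y0. cnjg e y = y"
    using eventually_U by eventually_elim (simp add: cnjg_def chart_chart_inv[OF chart])
  then show ?thesis unfolding Ad_def by (subst D_cong) auto
qed

text \<open>The derivative at the unit of \<open>Ad_bracket\<close>, the statement that
  \<open>Ad\<close> preserves brackets.\<close>

lemma jacobi: "br u (br v w) = br (br u v) w + br v (br u w)"
proof -
  have bb: "bounded_bilinear br" using bilinear_bracket bilinear_conv_bounded_bilinear by blast
  have "((\<lambda>x. br (Ad (\<psi> x) v) (Ad (\<psi> x) w)) has_derivative
      (\<lambda>u. br (Ad (\<psi> y0) v) (br u w) + br (br u v) (Ad (\<psi> y0) w))) (at y0)"
    by (rule bounded_bilinear.FDERIV[OF bb has_derivative_Ad has_derivative_Ad])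
  moreover have "\<forall>\<^sub>F x in nhds y0. br (Ad (\<psi> x) v) (Ad (\<psi> x) w) = Ad (\<psi> x) (br v w)"
    using eventually_inv_chart by eventually_elim (simp add: Ad_bracket)
  ultimately have "((\<lambda>x. Ad (\<psi> x) (br v w)) has_derivative
      (\<lambda>u. br v (br u w) + br (br u v) w)) (at y0)"
    unfolding \<psi>_y0 Ad_e by (rule has_derivative_transform_nhds)
  from has_derivative_unique[OF this has_derivative_Ad] show ?thesis
    by (metis add.commute)
qed

end

section \<open>The isotropy representation\<close>

context lie_group_chart
begin

text \<open>Since k fixes x, moving x by y and then by k is the same as moving it by the conjugate
  of y by k. The derivative in y at the unit is the claim: the orbit map intertwines
  \<open>Ad k\<close> with the isotropy action on the tangent space.\<close>

lemma isotropy_equivariant: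
  fixes AM :: "('m::{t2_space, second_countable_topology}, 'e::euclidean_space) chart set"
  assumes action: "smooth_action A gmul e AM act"
    and d: "d \<in> AM" "is_chart d" and x: "x \<in> fst d"
    and k: "k \<in> fst c" "ginv k \<in> fst c" "act k x = x"
  shows "tangent_map d d (act k) x (tangent_map c d (\<lambda>k. act k x) e w) =
    tangent_map c d (\<lambda>k. act k x) e (Ad k w)"
proof -
  have act: "act e y = y" "act (gmul a b) y = act a (act b y)" for a b y
    using action by (auto simp: smooth_action_def)
  have sm: "smooth_map (prod_atlas A AM) AM (\<lambda>(a, x). act a x)"
    using action by (simp add: smooth_action_def)
  define F where "F z = snd d (act (\<psi> (fst z)) (chart_inv d (snd z)))" for z
  have F: "F differentiable (at (\<phi> a, snd d x))" if "a \<in> fst c" "act a x \<in> fst d" for a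
    using smooth_map_prod_twice_differentiable_at[OF sm c_in chart d d that(1) x] that
    unfolding F_def[abs_def] by (intro twice_differentiable_atD1) simp
  define orb where "orb y = snd d (act (\<psi> y) x)" for y
  define ak where "ak m = snd d (act k (chart_inv d m))" for m
  have dinv: "chart_inv d (snd d x) = x" by (rule chart_inv_chart[OF d(2) x])
  have orb: "orb differentiable (at y0)"
  proof -
    have "(\<lambda>y. F (y, snd d x)) differentiable (at (\<phi> e))"
      by (rule differentiableI[OF D_compose[of "\<lambda>y. (y, snd d x)" "\<phi> e" F]])
        (use F[OF e_in] act(1) x in \<open>simp_all add: twice_differentiable_atD1[OF twice_differentiable_at_Pair2]\<close>)
    then show ?thesis by (simp add: F_def orb_def[abs_def] dinv y0_def)
  qed
  have ak: "ak differentiable (at (snd d x))"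
  proof -
    have "(\<lambda>m. F (\<phi> k, m)) differentiable (at (snd d x))"
      by (rule differentiableI[OF D_compose[of "\<lambda>m. (\<phi> k, m)" "snd d x" F]])
        (use F[OF k(1)] k(3) x in \<open>simp_all only: twice_differentiable_atD1[OF twice_differentiable_at_Pair1]\<close>)
    then show ?thesis using k by (simp add: F_def ak_def[abs_def])
  qed
  have orb0: "orb y0 = snd d x" by (simp add: orb_def act)
  have inv_fix: "act (ginv k) x = x" by (metis act inv_left k(3))
  have cont: "continuous_on UNIV (\<lambda>a. act a x)"
    using sm continuous_on_compose2[of UNIV "\<lambda>(a, x). act a x" UNIV "\<lambda>a. (a, x)"]
    by (simp add: smooth_map_def continuous_on_Pair)
  have "open ((\<lambda>a. act a x) -` fst d)"
    using d cont by (intro open_vimage) (simp_all add: is_chart_def)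
  from eventually_chart_y0[OF this]
  have "\<forall>\<^sub>F y in nhds y0. act (\<psi> y) x \<in> fst d" by (auto simp: act x elim!: eventually_mono)
  with eventually_cnjg_in[of k] have ev: "\<forall>\<^sub>F y in nhds y0. ak (orb y) = orb (cnjg k y)"
    by eventually_elim (simp add: ak_def orb_def chart_inv_chart[OF d(2)] act inv_fix)
  have c': "cnjg k differentiable (at y0)" by (rule twice_differentiable_atD1[OF cnjg_twice[OF k(1,2)]])
  have "((\<lambda>y. ak (orb y)) has_derivative (\<lambda>w. D ak (snd d x) (D orb y0 w))) (at y0)"
    using D_compose[OF orb, of ak] ak by (simp add: orb0)
  then have "((\<lambda>y. orb (cnjg k y)) has_derivative (\<lambda>w. D ak (snd d x) (D orb y0 w))) (at y0)"
    using ev by (rule has_derivative_transform_nhds)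
  moreover have "((\<lambda>y. orb (cnjg k y)) has_derivative (\<lambda>w. D orb y0 (Ad k w))) (at y0)"
    using D_compose[OF c', of orb] orb by (simp add: cnjg_y0 Ad_def)
  ultimately have "(\<lambda>w. D ak (snd d x) (D orb y0 w)) = (\<lambda>w. D orb y0 (Ad k w))"
    by (rule has_derivative_unique)
  then have "D ak (snd d x) (D orb y0 w) = D orb y0 (Ad k w)" by (simp only: fun_eq_iff)
  then show ?thesis
    by (simp add: tangent_map_def comp_def ak_def[abs_def] orb_def[abs_def] y0_def)
qed

text \<open>The conformal factor is given for each k separately, with no regularity along the curve
  \<gamma>. Comparison with a pair \<open>u0\<close>, \<open>v0\<close> on which Q is nonzero
  eliminates it, and what remains can be differentiated at t = 0. If Q is zero any factor
  works.\<close>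

lemma isotropy_infinitesimal:
  fixes Q :: "'l \<Rightarrow> 'l \<Rightarrow> real"
  assumes Q: "bilinear Q" and Y: "Y \<in> subgroup_lie_algebra A gmul e c H"
    and inv: "\<And>k. k \<in> H \<Longrightarrow> k \<in> fst c \<Longrightarrow> ginv k \<in> fst c \<Longrightarrow>
      \<exists>s. \<forall>u v. Q (Ad k u) (Ad k v) = s * Q u v"
  shows "\<exists>s. \<forall>u v. Q (br Y u) v + Q u (br Y v) = s * Q u v"
proof (cases "\<exists>u0 v0. Q u0 v0 \<noteq> 0")
  case True
  then obtain u0 v0 where 0: "Q u0 v0 \<noteq> 0" by blast
  obtain \<gamma> :: "real \<Rightarrow> 'k" where \<gamma>: "smooth_map euclidean_atlas A \<gamma>" "\<gamma> 0 = e" "\<And>t. \<gamma> t \<in> H"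
    "((\<phi> \<circ> \<gamma>) has_vector_derivative Y) (at 0)"
    using Y unfolding subgroup_lie_algebra_def by blast
  have c\<gamma>: "continuous_on UNIV \<gamma>" using \<gamma>(1) by (simp add: smooth_map_def)
  define f where "f u v t = Q (Ad (\<gamma> t) u) (Ad (\<gamma> t) v)" for u v t
  have op: "open (\<gamma> -` (fst c \<inter> ginv -` fst c))"
    using chart by (intro open_vimage open_Int continuous_inv c\<gamma>) (simp_all add: is_chart_def)
  have ev: "\<forall>\<^sub>F t in nhds 0. \<gamma> t \<in> fst c \<and> ginv (\<gamma> t) \<in> fst c"
    unfolding eventually_nhds using e_in \<gamma>(2)
    by (intro exI[of _ "\<gamma> -` (fst c \<inter> ginv -` fst c)"] conjI op) auto
  have ad: "((\<lambda>t. Ad (\<gamma> t) w) has_derivative (\<lambda>t. t *\<^sub>R br Y w)) (at 0)" for w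
  proof -
    have "(\<phi> \<circ> \<gamma> has_derivative (\<lambda>t. t *\<^sub>R Y)) (at 0)"
      using \<gamma>(4) by (simp add: has_vector_derivative_def)
    then have "((\<lambda>t. Ad (\<psi> ((\<phi> \<circ> \<gamma>) t)) w) has_derivative (\<lambda>t. br (t *\<^sub>R Y) w)) (at 0)"
      by (rule has_derivative_compose) (simp add: \<gamma>(2) y0_def[symmetric] has_derivative_Ad)
    moreover have "br (t *\<^sub>R Y) w = t *\<^sub>R br Y w" for t
      by (rule bilinear_lmul[OF bilinear_bracket])
    moreover have "\<forall>\<^sub>F t in nhds 0. Ad (\<psi> ((\<phi> \<circ> \<gamma>) t)) w = Ad (\<gamma> t) w"
      using ev by eventually_elim simp
    ultimately show ?thesis using has_derivative_transform_nhds by fastforce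
  qed
  have bb: "bounded_bilinear Q" using Q bilinear_conv_bounded_bilinear by blast
  have der: "(f u v has_derivative (\<lambda>t. t * (Q (br Y u) v + Q u (br Y v)))) (at 0)" for u v
    using bounded_bilinear.FDERIV[OF bb ad ad, of u v]
    by (simp add: f_def[abs_def] \<gamma>(2) Ad_e bilinear_lmul[OF Q] bilinear_rmul[OF Q] algebra_simps)
  show ?thesis
  proof (intro exI allI)
    fix u v
    have "\<forall>\<^sub>F t in nhds 0. f u v t * Q u0 v0 = f u0 v0 t * Q u v"
      using ev
    proof eventually_elim
      case (elim t)
      then obtain s where "\<forall>u v. Q (Ad (\<gamma> t) u) (Ad (\<gamma> t) v) = s * Q u v" using inv \<gamma>(3) by blast
      then show ?case by (simp add: f_def)
    qed
    with has_derivative_mult_left[OF der[of u v], of "Q u0 v0"]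
    have "((\<lambda>t. f u0 v0 t * Q u v) has_derivative (\<lambda>t. t * (Q (br Y u) v + Q u (br Y v)) * Q u0 v0)) (at 0)"
      by (rule has_derivative_transform_nhds)
    moreover have "((\<lambda>t. f u0 v0 t * Q u v) has_derivative
        (\<lambda>t. t * (Q (br Y u0) v0 + Q u0 (br Y v0)) * Q u v)) (at 0)"
      by (rule has_derivative_mult_left[OF der])
    ultimately have "(\<lambda>t. t * (Q (br Y u) v + Q u (br Y v)) * Q u0 v0) =
        (\<lambda>t. t * (Q (br Y u0) v0 + Q u0 (br Y v0)) * Q u v)" by (rule has_derivative_unique)
    from fun_cong[OF this, of 1]
    show "Q (br Y u) v + Q u (br Y v) = (Q (br Y u0) v0 + Q u0 (br Y v0)) / Q u0 v0 * Q u v"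
      using 0 by (simp add: field_simps)
  qed
qed (intro exI[of _ 0], simp)

end

section \<open>Conformal linear algebra\<close>

lemma sum_Basis_inner_linear:
  fixes f :: "'v::euclidean_space \<Rightarrow> real"
  assumes "linear f"
  shows "(\<Sum>i\<in>Basis. f i *\<^sub>R i) \<bullet> w = f w"
proof -
  have "f w = f (\<Sum>i\<in>Basis. (w \<bullet> i) *\<^sub>R i)" by (simp add: euclidean_representation)
  also have "\<dots> = (\<Sum>i\<in>Basis. (w \<bullet> i) * f i)"
    by (simp add: linear_sum[OF assms] linear_cmul[OF assms])
  finally show ?thesis by (simp add: inner_sum_left inner_commute[of w] mult.commute)
qed

lemma trace_commute_Basis:
  fixes f g :: "'v::euclidean_space \<Rightarrow> 'v"
  assumes "linear f" "linear g"
  shows "(\<Sum>i\<in>Basis. f (g i) \<bullet> i) = (\<Sum>i\<in>Basis. g (f i) \<bullet> i)"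
proof -
  have *: "(\<Sum>i\<in>Basis. f (g i) \<bullet> i) = (\<Sum>i\<in>Basis. \<Sum>j\<in>Basis. (g i \<bullet> j) * (f j \<bullet> i))"
    if "linear f" for f g :: "'v \<Rightarrow> 'v"
  proof (rule sum.cong[OF refl])
    fix i :: 'v
    have "f (g i) = f (\<Sum>j\<in>Basis. (g i \<bullet> j) *\<^sub>R j)" by (simp add: euclidean_representation)
    also have "\<dots> = (\<Sum>j\<in>Basis. (g i \<bullet> j) *\<^sub>R f j)" by (simp add: linear_sum[OF that] linear_cmul[OF that])
    finally show "f (g i) \<bullet> i = (\<Sum>j\<in>Basis. (g i \<bullet> j) * (f j \<bullet> i))" by (simp add: inner_sum_left)
  qed
  show ?thesis
    unfolding *[OF assms(1)] *[OF assms(2)]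
    by (subst sum.swap) (simp add: mult.commute)
qed

text \<open>These are the properties of \<nu> on which the linear algebra rests. As N is its own
  inverse, it serves both as the form (lowering an index) and as its inverse (raising one).\<close>

locale involutive_form =
  fixes N :: "'v::euclidean_space \<Rightarrow> 'v"
  assumes linear_N: "linear N" and N_N [simp]: "N (N x) = x" and N_sym: "N x \<bullet> y = x \<bullet> N y"
begin

definition "b x y = x \<bullet> N y"

text \<open>The action on y of the co(p, q)-part of the bracket of x with the covector
  \<open>b z\<close>. Each \<open>S z\<close> is symmetric in x, y and conformal in y, so z
  parametrizes the first prolongation of co(p, q).\<close>

definition "S z x y = b z y *\<^sub>R x + b z x *\<^sub>R y - b x y *\<^sub>R z"

lemma b_commute: "b x y = b y x"
  by (metis N_sym b_def inner_commute)

lemma b_simps [simp]: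
  "b (x + x') y = b x y + b x' y" "b x (y + y') = b x y + b x y'"
  "b (x - x') y = b x y - b x' y" "b x (y - y') = b x y - b x y'"
  "b (r *\<^sub>R x) y = r * b x y" "b x (r *\<^sub>R y) = r * b x y"
  "b 0 y = 0" "b x 0 = 0" "b (- x) y = - b x y" "b x (- y) = - b x y"
  using linear_N
  by (simp_all add: b_def linear_add linear_diff linear_cmul linear_0 linear_neg inner_simps)

lemma S_simps [simp]:
  "S (z + z') x y = S z x y + S z' x y" "S z (x + x') y = S z x y + S z x' y"
  "S (z - z') x y = S z x y - S z' x y" "S z (x - x') y = S z x y - S z x' y"
  "S (r *\<^sub>R z) x y = r *\<^sub>R S z x y" "S z (r *\<^sub>R x) y = r *\<^sub>R S z x y"
  "S 0 x y = 0" "S z 0 y = 0" "S z x 0 = 0" "S (- z) x y = - S z x y" "S z (- x) y = - S z x y"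
  "S z x (y + y') = S z x y + S z x y'" "S z x (y - y') = S z x y - S z x y'"
  "S z x (r *\<^sub>R y) = r *\<^sub>R S z x y"
  by (simp_all add: S_def algebra_simps)

lemma S_commute: "S z x y = S z y x"
  by (simp add: S_def b_commute algebra_simps)

lemma S_conformal: "b (S z x y) w + b y (S z x w) = 2 * b z x * b y w"
  by (simp add: S_def b_commute algebra_simps)

lemma b_N: "b x (N y) = x \<bullet> y"
  by (simp add: b_def)

lemma b_eq_0: "(\<And>y. b x y = 0) \<Longrightarrow> x = 0"
  by (metis b_N inner_eq_zero_iff)

lemma b_eqI: "(\<And>y. b x y = b x' y) \<Longrightarrow> x = x'"
  using b_eq_0[of "x - x'"] by simp

lemma b_nonzero: obtains x0 y0 where "b x0 y0 = 1"
proof -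
  obtain i :: 'v where "i \<in> Basis" using nonempty_Basis by blast
  then have "b i (N i) = 1" by (simp add: b_N)
  then show ?thesis by (rule that)
qed

lemma S_eq_0:
  assumes "\<And>x y. S z x y = 0"
  shows "z = 0"
proof (rule b_eq_0)
  fix x
  obtain y w where "b y w = 1" by (rule b_nonzero)
  then show "b z x = 0" using S_conformal[of z x y w] by (simp add: assms)
qed

definition "dual f = N (\<Sum>i\<in>Basis. f i *\<^sub>R i)"

lemma b_dual: "linear f \<Longrightarrow> b (dual f) x = f x"
  by (simp add: b_def dual_def N_sym sum_Basis_inner_linear)

lemma linear_dual:
  fixes F :: "'c::real_vector \<Rightarrow> 'v \<Rightarrow> real"
  assumes "\<And>i. linear (\<lambda>Y. F Y i)"
  shows "linear (\<lambda>Y. dual (F Y))"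
proof (rule linearI)
  fix Y Z :: 'c and r :: real
  have "(\<Sum>i\<in>Basis. F (Y + Z) i *\<^sub>R i) = (\<Sum>i\<in>Basis. F Y i *\<^sub>R i) + (\<Sum>i\<in>Basis. F Z i *\<^sub>R i)"
    by (simp add: linear_add[OF assms] scaleR_add_left sum.distrib)
  then show "dual (F (Y + Z)) = dual (F Y) + dual (F Z)"
    by (simp only: dual_def linear_add[OF linear_N])
  have "(\<Sum>i\<in>Basis. F (r *\<^sub>R Y) i *\<^sub>R i) = r *\<^sub>R (\<Sum>i\<in>Basis. F Y i *\<^sub>R i)"
    by (simp add: linear_cmul[OF assms] scaleR_sum_right)
  then show "dual (F (r *\<^sub>R Y)) = r *\<^sub>R dual (F Y)"
    by (simp only: dual_def linear_cmul[OF linear_N])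
qed

text \<open>The first prolongation of the orthogonal Lie algebra vanishes.\<close>

lemma skew_symmetric_eq_0:
  assumes sym: "\<And>x y. C x y = C y x" and skew: "\<And>x y w. b (C x y) w = - b y (C x w)"
  shows "C x y = 0"
proof (rule b_eq_0)
  fix w
  show "b (C x y) w = 0"
    \<comment> \<open>Alternating the symmetry in x, y with the skewness in y, w runs through all
      six orders of the arguments and returns to the first with the opposite sign.\<close>
    by (smt (verit) sym skew b_commute)
qed

text \<open>With the factor 2, f minus t times the identity is skew for \<open>b\<close>; this is
  the splitting of f into its scalar and its orthogonal part.\<close>

definition "conformal_with t f \<longleftrightarrow> (\<forall>x y. b (f x) y + b x (f y) = 2 * t * b x y)"

lemma conformal_withD: "conformal_with t f \<Longrightarrow> b (f x) y + b x (f y) = 2 * t * b x y"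
  by (simp add: conformal_with_def)

lemma conformal_with_commutator:
  assumes "conformal_with s f" "conformal_with t g"
  shows "b (f (g x) - g (f x)) y + b x (f (g y) - g (f y)) = 0"
proof -
  have "b (f (g x)) y = 2 * s * b (g x) y - b (g x) (f y)"
    "b x (f (g y)) = 2 * s * b x (g y) - b (f x) (g y)"
    "b (g (f x)) y = 2 * t * b (f x) y - b (f x) (g y)"
    "b x (g (f y)) = 2 * t * b x (f y) - b (g x) (f y)"
    using conformal_withD[OF assms(1), of "g x" y] conformal_withD[OF assms(1), of x "g y"]
      conformal_withD[OF assms(2), of "f x" y] conformal_withD[OF assms(2), of x "f y"] by linarith+
  moreover have "2 * s * b (g x) y + 2 * s * b x (g y) = 2 * s * (2 * t * b x y)"
    "2 * t * b (f x) y + 2 * t * b x (f y) = 2 * t * (2 * s * b x y)"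
    by (simp_all only: distrib_left[symmetric] conformal_withD[OF assms(1)] conformal_withD[OF assms(2)])
  ultimately show ?thesis by (simp only: b_simps) (simp add: algebra_simps)
qed

text \<open>Equivariance of \<open>S\<close> under co(p, q): the vector f z - 2 t z represents the
  covector on which f acts by duality, because \<open>b\<close> of it and u is -
  \<open>b z (f u)\<close>.\<close>

lemma conformal_S:
  assumes f: "conformal_with t f" and lin: "linear f"
  shows "f (S z x y) = S (f z - (2 * t) *\<^sub>R z) x y + S z (f x) y + S z x (f y)"
proof -
  have *: "b (f z) u = 2 * t * b z u - b z (f u)" for z u
    using conformal_withD[OF f, of z u] by simp
  show ?thesis
    unfolding S_def by (simp add: * linear_add[OF lin] linear_diff[OF lin] linear_cmul[OF lin] algebra_simps)
qed

text \<open>The change of the Ricci contraction when \<open>P\<close> is added to the positive part.\<close>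

lemma Ricci_of_S:
  assumes P: "linear P"
  shows "(\<Sum>i\<in>Basis. (S (P i) y w - S (P y) i w) \<bullet> i) =
    b (P w) y - (real DIM('v) - 1) * b (P y) w - b y w * (\<Sum>i\<in>Basis. P i \<bullet> i)"
proof -
  have e: "(\<Sum>i\<in>Basis. f i * (x \<bullet> i)) = f x" if "linear f" for f :: "'v \<Rightarrow> real" and x
    using sum_Basis_inner_linear[OF that, of x] by (simp add: inner_sum_left inner_commute[of x])
  have lb: "linear (\<lambda>i. b (P i) w)" for w by (rule linearI) (simp_all add: linear_add[OF P] linear_cmul[OF P])
  have lb': "linear (\<lambda>i. b i w)" "linear (\<lambda>i. b w i)" for w by (rule linearI; simp)+
  have 1: "(\<Sum>i\<in>Basis. (S (P i) y w - S (P y) i w) \<bullet> i) =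
     (\<Sum>i\<in>Basis. b (P i) w * (y \<bullet> i)) + (\<Sum>i\<in>Basis. b (P i) y * (w \<bullet> i)) - b y w * (\<Sum>i\<in>Basis. P i \<bullet> i)
     - (\<Sum>i\<in>(Basis::'v set). b (P y) w * (i \<bullet> i)) - (\<Sum>i\<in>Basis. b (P y) i * (w \<bullet> i)) + (\<Sum>i\<in>Basis. b i w * (P y \<bullet> i))"
    by (simp add: S_def inner_simps sum.distrib sum_subtractf sum_distrib_left)
  have 2: "(\<Sum>i\<in>(Basis::'v set). b (P y) w * (i \<bullet> i)) = real DIM('v) * b (P y) w"
    by (simp add: inner_same_Basis)
  show ?thesis unfolding 1 2 e[OF lb] e[OF lb'(1)] e[OF lb'(2)] by (simp add: algebra_simps)
qed

lemma trace_form_transpose: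
  fixes q :: "'v \<Rightarrow> 'v \<Rightarrow> real"
  assumes "bilinear q"
  shows "(\<Sum>i\<in>Basis. q (N i) i) = (\<Sum>i\<in>Basis. q i (N i))"
proof -
  have rep: "N i = (\<Sum>j\<in>Basis. (N i \<bullet> j) *\<^sub>R j)" for i by (simp add: euclidean_representation)
  have l: "linear (\<lambda>x. q x y)" "linear (q x)" for x y using assms by (auto simp: bilinear_def)
  have "(\<Sum>i\<in>Basis. q (N i) i) = (\<Sum>i\<in>Basis. \<Sum>j\<in>Basis. (N i \<bullet> j) * q j i)"
    by (subst rep) (simp add: linear_sum[OF l(1)] linear_cmul[OF l(1)])
  also have "\<dots> = (\<Sum>j\<in>Basis. \<Sum>i\<in>Basis. (N i \<bullet> j) * q j i)" by (rule sum.swap)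
  also have "\<dots> = (\<Sum>j\<in>Basis. \<Sum>i\<in>Basis. (N j \<bullet> i) * q j i)"
    by (intro sum.cong refl) (metis N_sym inner_commute)
  also have "\<dots> = (\<Sum>i\<in>Basis. q i (N i))"
    by (subst (2) rep) (simp add: linear_sum[OF l(2)] linear_cmul[OF l(2)])
  finally show ?thesis .
qed

lemma sum_b_N: "(\<Sum>i\<in>Basis. b i (N i)) = real DIM('v)"
  by (simp add: b_N inner_same_Basis)

lemma sum_trace_b: "linear P \<Longrightarrow> (\<Sum>i\<in>Basis. b (P i) (N i)) = (\<Sum>i\<in>Basis. P i \<bullet> i)"
  by (simp add: b_N)

text \<open>With m the dimension, the contraction multiplies the trace-free symmetric part of P by 2
  - m, the skew part by - m and the multiples of the identity by 2 - 2 m. The first factor vanishes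
  for m = 2, the last for m = 1.\<close>

lemma Ricci_of_S_inj:
  assumes P: "linear P" and n: "DIM('v) \<ge> 3"
    and 0: "\<And>y w. (\<Sum>i\<in>Basis. (S (P i) y w - S (P y) i w) \<bullet> i) = 0"
  shows "P x = 0"
proof -
  define m where "m = real DIM('v)"
  have m: "m \<ge> 3" using n by (simp add: m_def)
  define t where "t = (\<Sum>i\<in>Basis. P i \<bullet> i)"
  have eq: "b (P w) y - (m - 1) * b (P y) w - b y w * t = 0" for y w
    using 0[of y w] unfolding Ricci_of_S[OF P] m_def t_def .
  have bil: "bilinear (\<lambda>x y. b (P x) y)"
    unfolding bilinear_def by (auto intro!: linearI simp: linear_add[OF P] linear_cmul[OF P])
  have "0 = (\<Sum>i\<in>Basis. b (P (N i)) i - (m - 1) * b (P i) (N i) - b i (N i) * t)"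
    by (rule sum.neutral[symmetric]) (use eq in blast)
  \<comment> \<open>Contracting \<open>eq\<close> with \<open>N\<close> isolates the trace; after
    that \<open>eq\<close> and its transpose give the factor m (m - 2).\<close>
  also have "\<dots> = t - (m - 1) * t - m * t"
    by (simp add: sum_subtractf sum_distrib_left[symmetric] sum_distrib_right[symmetric]
        trace_form_transpose[OF bil] sum_trace_b[OF P] t_def[symmetric] sum_b_N m_def)
  finally have "t * (2 * m - 2) = 0" by (simp add: algebra_simps)
  then have t: "t = 0" using m by simp
  have "b (P x) y = 0" for y
  proof -
    have "b (P x) y = (m - 1) * b (P y) x" "b (P y) x = (m - 1) * b (P x) y"
      using eq[of x y] eq[of y x] t by auto
    then have "(m * (m - 2)) * b (P x) y = 0" by (simp add: algebra_simps)
    then show ?thesis using m by simp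
  qed
  then show ?thesis by (rule b_eq_0)
qed

lemma Ricci_of_S_surj:
  fixes s :: "'v \<Rightarrow> 'v \<Rightarrow> real"
  assumes s: "bilinear s" and n: "DIM('v) \<ge> 3"
  obtains P where "linear P" "\<And>y w. (\<Sum>i\<in>Basis. (S (P i) y w - S (P y) i w) \<bullet> i) = s y w"
proof -
  define m where "m = real DIM('v)"
  have m: "m \<ge> 3" using n by (simp add: m_def)
  \<comment> \<open>Solving for P: contracting with \<open>N\<close> gives trace \<open>ts\<close> =
    (2 - 2 m) t, so t is the trace that P must have. Then q, the bilinear form of P, satisfies q w y
    - (m - 1) q y w = s y w + t b y w; eliminating the transpose divides by 1 - (m - 1) (m - 1) = m
    (2 - m), whence \<beta>.\<close>
  define ts where "ts = (\<Sum>i\<in>Basis. s i (N i))"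
  define t where "t = ts / (2 - 2 * m)"
  define \<beta> where "\<beta> = 1 / (m * (2 - m))"
  define q where "q y w = \<beta> * ((m - 1) * (s y w + t * b y w) + (s w y + t * b y w))" for y w
  define P where "P y = dual (q y)" for y
  note sl = bilinear_ladd[OF s] bilinear_radd[OF s] bilinear_lmul[OF s] bilinear_rmul[OF s]
  have q: "linear (q y)" "linear (\<lambda>y. q y w)" for y w
    by (auto intro!: linearI simp: q_def sl algebra_simps)
  have P: "linear P" unfolding P_def[abs_def] by (rule linear_dual) (rule q)
  have bP: "b (P y) w = q y w" for y w unfolding P_def by (rule b_dual[OF q(1)])
  have "(\<Sum>i\<in>Basis. P i \<bullet> i) = (\<Sum>i\<in>Basis. q i (N i))" by (simp add: sum_trace_b[OF P, symmetric] bP)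
  also have "\<dots> = \<beta> * ((m - 1) * (ts + t * m) + (ts + t * m))"
    by (simp add: q_def sum.distrib sum_distrib_left[symmetric] trace_form_transpose[OF s] ts_def[symmetric] sum_b_N m_def[symmetric])
  also have "\<dots> = t"
  proof -
    have ts: "ts = t * (2 - 2 * m)" using m by (simp add: t_def)
    have "(m - 1) * (ts + t * m) + (ts + t * m) = t * (m * (2 - m))"
      unfolding ts by (simp add: algebra_simps)
    then show ?thesis using m by (simp add: \<beta>_def)
  qed
  finally have tr: "(\<Sum>i\<in>Basis. P i \<bullet> i) = t" .
  have "(\<Sum>i\<in>Basis. (S (P i) y w - S (P y) i w) \<bullet> i) = s y w" for y w
  proof -
    have "q w y - (m - 1) * q y w = (\<beta> * (m * (2 - m))) * (s y w + t * b y w)"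
      unfolding q_def b_commute[of w y] by (simp add: algebra_simps)
    also have "\<beta> * (m * (2 - m)) = 1" using m by (simp add: \<beta>_def)
    finally show ?thesis unfolding Ricci_of_S[OF P] tr bP m_def[symmetric] by (simp add: algebra_simps)
  qed
  with P that show ?thesis by blast
qed

end

section \<open>Homogeneous conformal data\<close>

text \<open>The algebraic data of a homogeneous conformal geometry: \<open>lam\<close> is the projection to
  the tangent space, its kernel is the isotropy algebra, which acts conformally.\<close>

locale homogeneous_conformal = involutive_form N
  for N :: "'v::euclidean_space \<Rightarrow> 'v" +
  fixes br :: "'l::euclidean_space \<Rightarrow> 'l \<Rightarrow> 'l" and lam :: "'l \<Rightarrow> 'v"
  assumes bilinear_br: "bilinear br" and br_skew: "br u v = - br v u"
    and jacobi: "br u (br v w) = br (br u v) w + br v (br u w)"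
    and linear_lam: "linear lam" and surj_lam: "surj lam"
    and isotropy: "lam Y = 0 \<Longrightarrow> \<exists>s. \<forall>u v. b (lam (br Y u)) (lam v) + b (lam u) (lam (br Y v)) = s * b (lam u) (lam v)"
begin

lemmas br_simps = bilinear_ladd[OF bilinear_br] bilinear_radd[OF bilinear_br]
  bilinear_lsub[OF bilinear_br] bilinear_rsub[OF bilinear_br]
  bilinear_lmul[OF bilinear_br] bilinear_rmul[OF bilinear_br]
  bilinear_lzero[OF bilinear_br] bilinear_rzero[OF bilinear_br]

lemmas lam_simps = linear_add[OF linear_lam] linear_diff[OF linear_lam] linear_cmul[OF linear_lam]
  linear_0[OF linear_lam] linear_neg[OF linear_lam]

text \<open>A linear complement of the isotropy algebra. It is in general not invariant under that
  algebra, so everything defined through \<open>sec\<close> has to be checked for invariance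
  separately.\<close>

definition "sec = (SOME s. linear s \<and> lam \<circ> s = id)"

lemma sec: "linear sec" "lam (sec x) = x"
proof -
  have "linear sec \<and> lam \<circ> sec = id"
    unfolding sec_def using linear_surjective_right_inverse[OF linear_lam surj_lam] by (rule someI_ex)
  then show "linear sec" "lam (sec x) = x" by (simp_all add: fun_eq_iff)
qed

lemmas sec_simps = linear_add[OF sec(1)] linear_diff[OF sec(1)] linear_cmul[OF sec(1)]
  linear_0[OF sec(1)] linear_neg[OF sec(1)] sec(2)

text \<open>In the conformality condition for Y, an argument u in the kernel kills the right-hand
  side and the second summand; nondegeneracy of \<open>b\<close> does the rest. So the kernel of
  \<open>lam\<close> is a subalgebra.\<close>

lemma lam_br_isotropy:
  assumes Y: "lam Y = 0" and u: "lam u = 0"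
  shows "lam (br Y u) = 0"
proof (rule b_eq_0)
  fix y
  obtain v where v: "lam v = y" using surj_lam by (metis surjD)
  show "b (lam (br Y u)) y = 0"
    using isotropy[OF Y] u v by (metis add.right_neutral b_simps(7) mult_zero_right)
qed

text \<open>The correction term \<open>\<Gamma>\<close> is given by the Koszul formula.\<close>

lemma torsion_free_connection:
  obtains \<omega> :: "'l \<Rightarrow> 'v \<Rightarrow> 'v" and \<tau> :: "'l \<Rightarrow> real"
  where "\<And>Y. linear (\<omega> Y)" "\<And>x. linear (\<lambda>Y. \<omega> Y x)" "linear \<tau>"
    "\<And>Y. conformal_with (\<tau> Y) (\<omega> Y)"
    "\<And>Y1 Y2. lam (br Y1 Y2) = \<omega> Y1 (lam Y2) - \<omega> Y2 (lam Y1)"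
proof -
  \<comment> \<open>The isotropy component of Y acts by the isotropy representation
    (\<open>hor\<close> shows that the representative of x is irrelevant), the component in the
    complement by zero. The resulting torsion is measured by \<open>t\<close>, which a skew \<Gamma>
    absorbs.\<close>
  define \<omega>0 where "\<omega>0 Y x = lam (br (Y - sec (lam Y)) (sec x))" for Y x
  define t where "t x y = lam (br (sec x) (sec y))" for x y
  define k where "k x y w = (b (t x y) w - b (t y w) x + b (t w x) y) / 2" for x y w
  define \<Gamma> where "\<Gamma> x y = dual (k x y)" for x y
  define \<omega> where "\<omega> Y x = \<omega>0 Y x + \<Gamma> (lam Y) x" for Y x
  have tsk: "t x y = - t y x" for x y
    unfolding t_def using br_skew[of "sec x" "sec y"] by (simp add: lam_simps)
  have tl: "t (x + x') y = t x y + t x' y" "t y (x + x') = t y x + t y x'"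
    "t (r *\<^sub>R x) y = r *\<^sub>R t x y" "t y (r *\<^sub>R x) = r *\<^sub>R t y x" for x x' y r
    by (simp_all add: t_def sec_simps br_simps lam_simps)
  have kl: "linear (\<lambda>x. k x y w)" "linear (\<lambda>y. k x y w)" "linear (k x y)" for x y w
    by (intro linearI; simp add: k_def tl; simp add: field_simps)+
  have b\<Gamma>: "b (\<Gamma> x y) w = k x y w" for x y w unfolding \<Gamma>_def by (rule b_dual[OF kl(3)])
  have \<Gamma>l: "linear (\<lambda>x. \<Gamma> x y)" "linear (\<Gamma> x)" for x y
    unfolding \<Gamma>_def by (intro linear_dual kl)+
  have \<Gamma>skew: "b (\<Gamma> x y) w = - b (\<Gamma> x w) y" for x y w
    unfolding b\<Gamma> k_def using tsk[of x y] tsk[of y w] tsk[of w x] by (simp add: field_simps)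
  have \<Gamma>t: "\<Gamma> x y - \<Gamma> y x = t x y" for x y
  proof (rule b_eqI)
    fix w
    show "b (\<Gamma> x y - \<Gamma> y x) w = b (t x y) w"
      using tsk[of x y] tsk[of y w] tsk[of w x] by (simp add: b\<Gamma> k_def field_simps)
  qed
  have \<omega>0l: "linear (\<omega>0 Y)" "linear (\<lambda>Y. \<omega>0 Y x)" for Y x
    by (intro linearI; simp add: \<omega>0_def sec_simps br_simps lam_simps algebra_simps)+
  have l: "linear (\<omega> Y)" "linear (\<lambda>Y. \<omega> Y x)" for Y x
    unfolding \<omega>_def[abs_def]
    using \<omega>0l \<Gamma>l linear_compose[OF linear_lam \<Gamma>l(1)]
    by (auto intro!: linear_compose_add simp: comp_def)
  have hor: "\<omega>0 Y (lam u) = lam (br (Y - sec (lam Y)) u)" for Y u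
  proof -
    have "lam (br (Y - sec (lam Y)) (u - sec (lam u))) = 0"
      by (rule lam_br_isotropy) (simp_all add: lam_simps sec_simps)
    then show ?thesis by (simp add: \<omega>0_def br_simps lam_simps)
  qed
  have ex: "\<exists>t. conformal_with t (\<omega> Y)" for Y
  proof -
    have "lam (Y - sec (lam Y)) = 0" by (simp add: lam_simps sec_simps)
    from isotropy[OF this] obtain s where s: "b (\<omega>0 Y (lam u)) (lam v) + b (lam u) (\<omega>0 Y (lam v)) = s * b (lam u) (lam v)" for u v
      unfolding hor by blast
    have "b (\<omega>0 Y x) y + b x (\<omega>0 Y y) = s * b x y" for x y
      using s[of "sec x" "sec y"] by (simp add: sec_simps)
    moreover have "b (\<Gamma> (lam Y) x) y + b x (\<Gamma> (lam Y) y) = 0" for x y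
      using \<Gamma>skew[of "lam Y" x y] by (simp add: b_commute)
    ultimately have "b (\<omega> Y x) y + b x (\<omega> Y y) = 2 * (s / 2) * b x y" for x y
      by (simp add: \<omega>_def) (smt (verit))
    then show ?thesis unfolding conformal_with_def by blast
  qed
  obtain x0 y0 where x0: "b x0 y0 = 1" by (rule b_nonzero)
  \<comment> \<open>Reading the factor off at one fixed pair with \<open>b x0 y0\<close> = 1 makes
    it linear in Y.\<close>
  define \<tau> where "\<tau> Y = (b (\<omega> Y x0) y0 + b x0 (\<omega> Y y0)) / 2" for Y
  have "conformal_with (\<tau> Y) (\<omega> Y)" for Y
    using ex[of Y] x0 unfolding \<tau>_def by (metis conformal_withD mult.right_neutral nonzero_mult_div_cancel_left zero_neq_numeral)
  moreover have "linear \<tau>"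
    by (intro linearI; simp add: \<tau>_def linear_add[OF l(2)] linear_cmul[OF l(2)]; simp add: field_simps)
  moreover have "lam (br Y1 Y2) = \<omega> Y1 (lam Y2) - \<omega> Y2 (lam Y1)" for Y1 Y2
  proof -
    have "\<omega> Y1 (lam Y2) - \<omega> Y2 (lam Y1) = lam (br (Y1 - sec (lam Y1)) Y2)
        - \<omega>0 Y2 (lam Y1) + t (lam Y1) (lam Y2)"
      by (simp add: \<omega>_def hor \<Gamma>t[symmetric])
    also have "\<dots> = lam (br (Y1 - sec (lam Y1)) Y2) - lam (br (Y2 - sec (lam Y2)) (sec (lam Y1))) + t (lam Y1) (lam Y2)"
      by (simp add: \<omega>0_def)
    also have "\<dots> = lam (br Y1 Y2)"
      using br_skew[of "Y2 - sec (lam Y2)" "sec (lam Y1)"] by (simp add: t_def br_simps lam_simps)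
    finally show ?thesis by simp
  qed
  ultimately show ?thesis using that l by blast
qed

end

locale torsion_free = homogeneous_conformal N br lam
  for N :: "'v::euclidean_space \<Rightarrow> 'v" and br :: "'l::euclidean_space \<Rightarrow> 'l \<Rightarrow> 'l" and lam +
  fixes \<omega> :: "'l \<Rightarrow> 'v \<Rightarrow> 'v" and \<tau> :: "'l \<Rightarrow> real"
  assumes linear_\<omega>: "linear (\<omega> Y)" and linear_\<omega>': "linear (\<lambda>Y. \<omega> Y x)" and linear_\<tau>: "linear \<tau>"
    and conformal_\<omega>: "conformal_with (\<tau> Y) (\<omega> Y)"
    and torsion_free: "lam (br Y1 Y2) = \<omega> Y1 (lam Y2) - \<omega> Y2 (lam Y1)"
begin

lemmas \<omega>_simps = linear_add[OF linear_\<omega>] linear_diff[OF linear_\<omega>] linear_cmul[OF linear_\<omega>]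
  linear_0[OF linear_\<omega>] linear_neg[OF linear_\<omega>]
  linear_add[OF linear_\<omega>'] linear_diff[OF linear_\<omega>'] linear_cmul[OF linear_\<omega>']
  linear_0[OF linear_\<omega>'] linear_neg[OF linear_\<omega>']

lemmas \<tau>_simps = linear_add[OF linear_\<tau>] linear_diff[OF linear_\<tau>] linear_cmul[OF linear_\<tau>]
  linear_0[OF linear_\<tau>] linear_neg[OF linear_\<tau>]

text \<open>\<open>K0\<close> and \<open>K1\<close> are the components of the curvature in \<open>co(p, q)\<close> and in the dual of the
  tangent space, the latter identified with the tangent space by the form \<open>b\<close>.\<close>

definition "F Y1 Y2 x = \<omega> Y1 (\<omega> Y2 x) - \<omega> Y2 (\<omega> Y1 x) - \<omega> (br Y1 Y2) x"
definition "K0 \<zeta> Y1 Y2 x = F Y1 Y2 x + S (\<zeta> Y2) (lam Y1) x - S (\<zeta> Y1) (lam Y2) x"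
definition "K1 \<zeta> Y1 Y2 = (2 * \<tau> Y2) *\<^sub>R \<zeta> Y1 - \<omega> Y2 (\<zeta> Y1) - (2 * \<tau> Y1) *\<^sub>R \<zeta> Y2 + \<omega> Y1 (\<zeta> Y2) - \<zeta> (br Y1 Y2)"

lemma jacobi_cyclic: "br (br Y1 Y2) Y3 + br (br Y2 Y3) Y1 + br (br Y3 Y1) Y2 = 0"
proof -
  have "br (br Y2 Y3) Y1 = - br Y1 (br Y2 Y3)" "br (br Y3 Y1) Y2 = - br Y2 (br Y3 Y1)"
    by (rule br_skew)+
  moreover have "br Y3 Y1 = - br Y1 Y3" by (rule br_skew)
  ultimately show ?thesis
    using jacobi[of Y1 Y2 Y3] by (simp add: bilinear_rneg[OF bilinear_br])
qed

lemma F_skew: "F Y1 Y2 x = - F Y2 Y1 x"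
  using br_skew[of Y1 Y2] by (simp add: F_def \<omega>_simps)

lemma F_conformal: "conformal_with (- \<tau> (br Y1 Y2)) (F Y1 Y2)"
  using conformal_with_commutator[OF conformal_\<omega>[of Y1] conformal_\<omega>[of Y2]] conformal_withD[OF conformal_\<omega>[of "br Y1 Y2"]]
  unfolding conformal_with_def F_def b_simps by (simp add: algebra_simps)

lemma F_linear: "linear (F Y1 Y2)" "linear (\<lambda>Y. F Y Y2 x)" "linear (\<lambda>Y. F Y1 Y x)"
  by (intro linearI; simp add: F_def \<omega>_simps br_simps algebra_simps)+

text \<open>The first Bianchi identity: \<open>lam\<close> applied to the Jacobi identity, with
  brackets eliminated by vanishing torsion.\<close>

lemma F_bianchi: "F Y1 Y2 (lam Y3) + F Y2 Y3 (lam Y1) + F Y3 Y1 (lam Y2) = 0"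
proof -
  have "lam (br (br Y1 Y2) Y3 + br (br Y2 Y3) Y1 + br (br Y3 Y1) Y2) = 0"
    by (simp only: jacobi_cyclic lam_simps)
  then have "- (\<omega> (br Y1 Y2) (lam Y3) - \<omega> Y3 (\<omega> Y1 (lam Y2) - \<omega> Y2 (lam Y1))
     + (\<omega> (br Y2 Y3) (lam Y1) - \<omega> Y1 (\<omega> Y2 (lam Y3) - \<omega> Y3 (lam Y2)))
     + (\<omega> (br Y3 Y1) (lam Y2) - \<omega> Y2 (\<omega> Y3 (lam Y1) - \<omega> Y1 (lam Y3)))) = 0"
    by (simp only: lam_simps torsion_free neg_equal_0_iff_equal)
  then show ?thesis by (simp add: F_def \<omega>_simps algebra_simps)
qed

text \<open>The second Bianchi identity: the cubic terms in \<omega> cancel as in any associative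
  algebra, and the terms with nested brackets are \<omega> of the Jacobi identity.\<close>

lemma F_bianchi2:
  "\<omega> Y1 (F Y2 Y3 x) - F Y2 Y3 (\<omega> Y1 x) + (\<omega> Y2 (F Y3 Y1 x) - F Y3 Y1 (\<omega> Y2 x))
   + (\<omega> Y3 (F Y1 Y2 x) - F Y1 Y2 (\<omega> Y3 x)) = F (br Y1 Y2) Y3 x + F (br Y2 Y3) Y1 x + F (br Y3 Y1) Y2 x"
proof -
  have "\<omega> (br (br Y1 Y2) Y3 + br (br Y2 Y3) Y1 + br (br Y3 Y1) Y2) x = 0"
    by (simp only: jacobi_cyclic \<omega>_simps)
  then have *: "\<omega> (br (br Y1 Y2) Y3) x = - \<omega> (br (br Y2 Y3) Y1) x - \<omega> (br (br Y3 Y1) Y2) x"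
    by (simp add: \<omega>_simps algebra_simps eq_neg_iff_add_eq_0)
  show ?thesis by (simp add: F_def \<omega>_simps * algebra_simps)
qed

text \<open>The second Bianchi identity with one argument in the isotropy algebra, where
  \<open>K0\<close> = 0 replaces \<open>F\<close> by a value of \<open>S\<close>. The left side is
  the failure of \<open>K0\<close> to be invariant under \<open>Yh\<close>; it is thus governed by
  the single defect \<open>K1 \<zeta> _ Yh\<close>.\<close>

lemma K0_bianchi2:
  fixes \<zeta> :: "'l \<Rightarrow> 'v"
  assumes \<zeta>: "linear \<zeta>" and h: "lam Yh = 0" and 0: "\<And>Y x. K0 \<zeta> Y Yh x = 0"
  shows "K0 \<zeta> Y1 Y2 (\<omega> Yh x) - \<omega> Yh (K0 \<zeta> Y1 Y2 x) + K0 \<zeta> (br Y2 Yh) Y1 x + K0 \<zeta> (br Yh Y1) Y2 x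
    = S (K1 \<zeta> Y2 Yh) (lam Y1) x - S (K1 \<zeta> Y1 Yh) (lam Y2) x"
proof -
  have e: "\<omega> Y (S z x y) = S (\<omega> Y z - (2 * \<tau> Y) *\<^sub>R z) x y + S z (\<omega> Y x) y + S z x (\<omega> Y y)" for Y x y z
    by (rule conformal_S[OF conformal_\<omega> linear_\<omega>])
  have Fh: "F Y Yh x = - S (\<zeta> Yh) (lam Y) x" for Y x
    using 0[of Y x] h by (simp add: K0_def eq_neg_iff_add_eq_0)
  have hF: "F Yh Y x = S (\<zeta> Yh) (lam Y) x" for Y x
    using Fh[of Y x] F_skew[of Yh Y x] by simp
  have "F (br Y2 Yh) Y1 x + F (br Yh Y1) Y2 x + F Y1 Y2 (\<omega> Yh x) - \<omega> Yh (F Y1 Y2 x)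
      = \<omega> Y1 (F Y2 Yh x) - F Y2 Yh (\<omega> Y1 x) + (\<omega> Y2 (F Yh Y1 x) - F Yh Y1 (\<omega> Y2 x)) - F (br Y1 Y2) Yh x"
    using F_bianchi2[of Y1 Y2 Yh x] by (simp add: algebra_simps)
  also have "\<dots> = - S (\<omega> Y1 (\<zeta> Yh) - (2 * \<tau> Y1) *\<^sub>R \<zeta> Yh) (lam Y2) x + S (\<omega> Y2 (\<zeta> Yh) - (2 * \<tau> Y2) *\<^sub>R \<zeta> Yh) (lam Y1) x"
    unfolding Fh hF torsion_free by (simp add: \<omega>_simps e)
  finally have *: "F Y1 Y2 (\<omega> Yh x) - \<omega> Yh (F Y1 Y2 x) = - F (br Y2 Yh) Y1 x - F (br Yh Y1) Y2 x
     - S (\<omega> Y1 (\<zeta> Yh) - (2 * \<tau> Y1) *\<^sub>R \<zeta> Yh) (lam Y2) x + S (\<omega> Y2 (\<zeta> Yh) - (2 * \<tau> Y2) *\<^sub>R \<zeta> Yh) (lam Y1) x"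
    by (simp add: algebra_simps)
  have br: "\<zeta> (br Yh Y1) = - \<zeta> (br Y1 Yh)"
    using br_skew[of Yh Y1] linear_neg[OF \<zeta>] by metis
  have "K0 \<zeta> Y1 Y2 (\<omega> Yh x) - \<omega> Yh (K0 \<zeta> Y1 Y2 x) = (F Y1 Y2 (\<omega> Yh x) - \<omega> Yh (F Y1 Y2 x))
    + S (\<zeta> Y2) (lam Y1) (\<omega> Yh x) - S (\<zeta> Y1) (lam Y2) (\<omega> Yh x)
    - \<omega> Yh (S (\<zeta> Y2) (lam Y1) x) + \<omega> Yh (S (\<zeta> Y1) (lam Y2) x)"
    by (simp add: K0_def \<omega>_simps)
  then show ?thesis
    unfolding * e by (simp add: K0_def K1_def torsion_free h \<omega>_simps S_simps)
      (simp add: br algebra_simps)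
qed

end

section \<open>The Ricci normalization and its equivariance in dimension at least three\<close>

context torsion_free
begin

lemma K0_linear:
  assumes "linear \<zeta>"
  shows "linear (K0 \<zeta> Y1 Y2)" "linear (\<lambda>Y. K0 \<zeta> Y Y2 x)" "linear (\<lambda>Y. K0 \<zeta> Y1 Y x)"
  by (intro linearI; simp add: K0_def linear_add[OF F_linear(1)] linear_add[OF F_linear(2)] linear_add[OF F_linear(3)]
      linear_cmul[OF F_linear(1)] linear_cmul[OF F_linear(2)] linear_cmul[OF F_linear(3)]
      linear_add[OF assms] linear_cmul[OF assms] lam_simps algebra_simps)+

lemma K0_skew: "K0 \<zeta> Y1 Y2 x = - K0 \<zeta> Y2 Y1 x"
  using F_skew[of Y1 Y2 x] by (simp add: K0_def)

lemma K1_linear: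
  assumes "linear \<zeta>"
  shows "linear (\<lambda>Y. K1 \<zeta> Y Y2)"
  by (intro linearI; simp add: K1_def linear_add[OF assms] linear_cmul[OF assms] \<omega>_simps \<tau>_simps br_simps algebra_simps)

text \<open>Forced on the isotropy algebra by comparing conformal factors in
  \<open>K0 \<zeta> Y Yh\<close> = 0: \<open>F Y Yh\<close> has factor - \<tau> of the bracket, and
  \<open>S (\<zeta> Yh) (lam Y)\<close> has factor \<open>b (\<zeta> Yh) (lam Y)\<close>. On the
  complement the value is zero for the time being.\<close>

definition "zeta0 Y = dual (\<lambda>x. \<tau> (br (sec x) (Y - sec (lam Y))))"

lemma zeta0: "linear zeta0" "b (zeta0 Y) x = \<tau> (br (sec x) (Y - sec (lam Y)))"
proof -
  have l: "linear (\<lambda>x. \<tau> (br (sec x) (Y - sec (lam Y))))" "linear (\<lambda>Y. \<tau> (br (sec x) (Y - sec (lam Y))))" for x Y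
    by (intro linearI; simp add: sec_simps lam_simps br_simps \<tau>_simps algebra_simps)+
  show "b (zeta0 Y) x = \<tau> (br (sec x) (Y - sec (lam Y)))"
    unfolding zeta0_def by (rule b_dual[OF l(1)])
  show "linear zeta0"
    unfolding zeta0_def[abs_def] by (rule linear_dual[OF l(2)])
qed

text \<open>By the first Bianchi identity \<open>F Y Yh\<close> depends on Y and x symmetrically,
  and it is conformal. Adding \<open>S (zeta0 Yh)\<close> cancels the conformal factor, so the sum
  \<open>C\<close> lies in the first prolongation of the orthogonal algebra, which is zero.\<close>

lemma F_isotropy:
  assumes h: "lam Yh = 0"
  shows "F Y Yh x = - S (zeta0 Yh) (lam Y) x"
proof -
  have sym: "F Y1 Yh (lam Y2) = F Y2 Yh (lam Y1)" for Y1 Y2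
    using F_bianchi[of Y1 Y2 Yh] F_skew[of Yh Y1 "lam Y2"] h
    by (simp add: linear_0[OF F_linear(1)])
  define C where "C x y = F (sec x) Yh y + S (zeta0 Yh) x y" for x y
  have "C x y = 0" for x y
  proof (rule skew_symmetric_eq_0[of C])
    show "C x y = C y x" for x y
      using sym[of "sec x" "sec y"] by (simp add: C_def sec_simps S_commute[of _ x])
    show "b (C x y) w = - b y (C x w)" for x y w
      using conformal_withD[OF F_conformal[of "sec x" Yh], of y w] S_conformal[of "zeta0 Yh" x y w]
      by (simp add: C_def zeta0(2) h sec_simps)
  qed
  then have "F (sec (lam Y)) Yh (lam (sec x)) = - S (zeta0 Yh) (lam Y) x" "F (sec x) Yh (lam Y) = - S (zeta0 Yh) x (lam Y)"
    by (simp_all add: C_def sec_simps eq_neg_iff_add_eq_0)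
  then show ?thesis
    using sym[of "sec x" Y] by (simp add: sec_simps S_commute[of _ x])
qed

lemma K0_isotropy:
  assumes "lam Yh = 0" "\<zeta> Yh = zeta0 Yh"
  shows "K0 \<zeta> Y Yh x = 0"
  using F_isotropy[OF assms(1), of Y x] assms by (simp add: K0_def)

lemma normal_connection_exists:
  assumes n: "DIM('v) \<ge> 3"
  obtains \<zeta> :: "'l \<Rightarrow> 'v" where "linear \<zeta>"
    "\<And>Y Yh x. lam Yh = 0 \<Longrightarrow> K0 \<zeta> Y Yh x = 0"
    "\<And>Y Yh. lam Yh = 0 \<Longrightarrow> K1 \<zeta> Y Yh = 0"
    "\<And>Y w. (\<Sum>i\<in>Basis. K0 \<zeta> Y (sec i) w \<bullet> i) = 0"
proof -
  \<comment> \<open>Minus the Ricci contraction obtained with \<open>zeta0\<close>; P is chosen to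
    compensate it. As P is composed with \<open>lam\<close>, the values on the isotropy algebra do
    not change.\<close>
  define s where "s y w = - (\<Sum>i\<in>Basis. K0 zeta0 (sec y) (sec i) w \<bullet> i)" for y w
  have bil: "bilinear s"
    unfolding bilinear_def
    by (auto intro!: linearI simp: s_def sec_simps linear_add[OF K0_linear(1)[OF zeta0(1)]]
        linear_add[OF K0_linear(2)[OF zeta0(1)]] linear_cmul[OF K0_linear(1)[OF zeta0(1)]]
        linear_cmul[OF K0_linear(2)[OF zeta0(1)]] inner_simps sum.distrib sum_distrib_left sum_negf)
  obtain P where P: "linear P" "\<And>y w. (\<Sum>i\<in>Basis. (S (P i) y w - S (P y) i w) \<bullet> i) = s y w"
    by (rule Ricci_of_S_surj[OF bil n]) blast
  define \<zeta> where "\<zeta> Y = zeta0 Y + P (lam Y)" for Y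
  have lin: "linear \<zeta>"
    by (intro linearI; simp add: \<zeta>_def linear_add[OF zeta0(1)] linear_cmul[OF zeta0(1)] linear_add[OF P(1)]
        linear_cmul[OF P(1)] lam_simps algebra_simps)
  have h0: "K0 \<zeta> Y Yh x = 0" if "lam Yh = 0" for Y Yh x
    by (rule K0_isotropy[OF that]) (simp add: \<zeta>_def that linear_0[OF P(1)])
  note K0l = K0_linear[OF lin]
  \<comment> \<open>Vanishing on the isotropy algebra makes \<open>K0\<close> a function on the
    tangent space in both slots.\<close>
  have K0sec: "K0 \<zeta> Y X x = K0 \<zeta> Y (sec (lam X)) x" "K0 \<zeta> X Y x = K0 \<zeta> (sec (lam X)) Y x" for X Y x
  proof -
    have "K0 \<zeta> Y (X - sec (lam X)) x = 0" for Y by (rule h0) (simp add: lam_simps sec_simps)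
    then have *: "K0 \<zeta> Y X x = K0 \<zeta> Y (sec (lam X)) x" for Y by (simp add: linear_diff[OF K0l(3)])
    then show "K0 \<zeta> Y X x = K0 \<zeta> Y (sec (lam X)) x" .
    show "K0 \<zeta> X Y x = K0 \<zeta> (sec (lam X)) Y x"
      using *[of Y] K0_skew[of \<zeta> X Y x] K0_skew[of \<zeta> "sec (lam X)" Y x] by simp
  qed
  have Ric: "(\<Sum>i\<in>Basis. K0 \<zeta> Y (sec i) w \<bullet> i) = 0" for Y w
  proof -
    have "K0 \<zeta> (sec y) (sec i) w = K0 zeta0 (sec y) (sec i) w + (S (P i) y w - S (P y) i w)" for i y
      by (simp add: K0_def \<zeta>_def sec_simps)
    then have "(\<Sum>i\<in>Basis. K0 \<zeta> (sec y) (sec i) w \<bullet> i) = 0" for y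
      using P(2)[of y w] by (simp add: s_def inner_add_left sum.distrib)
    then show ?thesis using K0sec(2)[of Y] by simp
  qed
  have "K1 \<zeta> Y Yh = 0" if h: "lam Yh = 0" for Y Yh
  proof -
    define E where "E Y = K1 \<zeta> Y Yh" for Y
    have El: "linear E" unfolding E_def[abs_def] by (rule K1_linear[OF lin])
    have id: "K0 \<zeta> Y1 Y2 (\<omega> Yh x) - \<omega> Yh (K0 \<zeta> Y1 Y2 x) + K0 \<zeta> (br Y2 Yh) Y1 x + K0 \<zeta> (br Yh Y1) Y2 x
      = S (E Y2) (lam Y1) x - S (E Y1) (lam Y2) x" for Y1 Y2 x
      unfolding E_def by (rule K0_bianchi2[OF lin h h0[OF h]])
    \<comment> \<open>With a second argument in the isotropy algebra every \<open>K0\<close> in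
      \<open>id\<close> vanishes, which leaves \<open>S (E Y1)\<close> = 0. Hence \<open>E\<close>
      descends to a map \<open>P'\<close> of the tangent space.\<close>
    have Eh: "E Y1 = 0" if Y1: "lam Y1 = 0" for Y1
    proof (rule S_eq_0)
      fix x y
      have 0: "K0 \<zeta> Z Y x = 0" if "lam Y = 0 \<or> lam Z = 0" for Y Z x
        using that h0[of Y Z x] h0[of Z Y x] K0_skew[of \<zeta> Z Y x] by auto
      have "lam (br Yh Y1) = 0" by (rule lam_br_isotropy[OF h Y1])
      then show "S (E Y1) x y = 0"
        using id[of Y1 "sec x" y] Y1 by (simp add: 0 sec_simps \<omega>_simps)
    qed
    define P' where "P' x = E (sec x)" for x
    have P'l: "linear P'" unfolding P'_def[abs_def] using linear_compose[OF sec(1) El] by (simp add: comp_def)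
    have EP: "E Y = P' (lam Y)" for Y
      using Eh[of "Y - sec (lam Y)"] by (simp add: P'_def linear_diff[OF El] lam_simps sec_simps)
    have "P' x = 0" for x
    proof (rule Ricci_of_S_inj[OF P'l n])
      fix y w
      let ?f = "\<lambda>x. K0 \<zeta> (sec y) (sec x) w"
      have f: "linear ?f"
        using linear_compose[OF sec(1) K0l(3)] by (simp add: comp_def)
      \<comment> \<open>Modulo the isotropy algebra, the bracket of \<open>sec i\<close> with
        \<open>Yh\<close> is \<open>sec\<close> of - \<omega> \<open>Yh\<close> i.\<close>
      have turn: "K0 \<zeta> (br (sec i) Yh) (sec y) w = ?f (\<omega> Yh i)" for i
      proof -
        have "K0 \<zeta> (br (sec i) Yh) (sec y) w = K0 \<zeta> (sec (- \<omega> Yh i)) (sec y) w"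
          using K0sec(2)[of "br (sec i) Yh"] by (simp add: torsion_free h \<omega>_simps sec_simps)
        then show ?thesis
          using K0_skew[of \<zeta> "sec (\<omega> Yh i)" "sec y" w] by (simp add: sec_simps linear_neg[OF K0l(2)])
      qed
      have "(\<Sum>i\<in>Basis. (S (P' i) y w - S (P' y) i w) \<bullet> i) =
          (\<Sum>i\<in>Basis. (K0 \<zeta> (sec y) (sec i) (\<omega> Yh w) - \<omega> Yh (?f i) + ?f (\<omega> Yh i)
             + K0 \<zeta> (br Yh (sec y)) (sec i) w) \<bullet> i)"
        using id[of "sec y" "sec _" w] by (simp add: EP sec_simps turn)
      \<comment> \<open>Two of the terms are normalized Ricci contractions, hence zero; the other
        two are traces of the same two maps composed in either order.\<close>
      also have "\<dots> = (\<Sum>i\<in>Basis. ?f (\<omega> Yh i) \<bullet> i) - (\<Sum>i\<in>Basis. \<omega> Yh (?f i) \<bullet> i)"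
        by (simp add: inner_simps sum.distrib sum_subtractf Ric)
      also have "\<dots> = 0" using trace_commute_Basis[OF f linear_\<omega>] by simp
      finally show "(\<Sum>i\<in>Basis. (S (P' i) y w - S (P' y) i w) \<bullet> i) = 0" .
    qed
    then show ?thesis using EP[of Y] by (simp add: E_def)
  qed
  with lin h0 Ric that show ?thesis by blast
qed

end

section \<open>Lie algebras acting on a line\<close>

text \<open>If \<open>a\<close> and \<open>b\<close> list the derivatives of two functions at a point, then \<open>leibniz n a b\<close> is the
  \<open>n\<close>-th derivative of their product there.\<close>

primrec leibniz :: "nat \<Rightarrow> (nat \<Rightarrow> 'a::comm_ring_1) \<Rightarrow> (nat \<Rightarrow> 'a) \<Rightarrow> 'a" where
  "leibniz 0 a b = a 0 * b 0"
| "leibniz (Suc n) a b = leibniz n (\<lambda>i. a (Suc i)) b + leibniz n a (\<lambda>i. b (Suc i))"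

lemma leibniz_linear:
  "leibniz n (\<lambda>i. a i + a' i) b = leibniz n a b + leibniz n a' b"
  "leibniz n a (\<lambda>i. b i + b' i) = leibniz n a b + leibniz n a b'"
  "leibniz n (\<lambda>i. r * a i) b = r * leibniz n a b"
  "leibniz n a (\<lambda>i. r * b i) = r * leibniz n a b"
  by (induction n arbitrary: a a' b b') (simp_all add: algebra_simps)

lemma leibniz_eq_0:
  assumes "\<And>i. i < p \<Longrightarrow> a i = 0" "\<And>i. i < r \<Longrightarrow> b i = 0" "n < p + r"
  shows "leibniz n a b = 0"
  using assms
proof (induction n arbitrary: a b p r)
  case 0
  then show ?case by (cases p; cases r) auto
next
  case (Suc n)
  have "leibniz n (\<lambda>i. a (Suc i)) b = 0"
    using Suc.prems by (intro Suc.IH[of "p - 1" _ r]) auto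
  moreover have "leibniz n a (\<lambda>i. b (Suc i)) = 0"
    using Suc.prems by (intro Suc.IH[of p _ "r - 1"]) auto
  ultimately show ?case by simp
qed

text \<open>Pascal's rule drives the induction. If p = 0 or r = 0, one of the two summands is below
  its leading order and vanishes.\<close>

lemma leibniz_leading:
  assumes "\<And>i. i < p \<Longrightarrow> a i = 0" "\<And>i. i < r \<Longrightarrow> b i = 0"
  shows "leibniz (p + r) a b = of_nat (p + r choose p) * a p * b r"
  using assms
proof (induction "p + r" arbitrary: a b p r)
  case 0
  then show ?case by simp
next
  case (Suc n)
  have n: "p + r = Suc n" using Suc.hyps(2) by simp
  have 1: "leibniz n (\<lambda>i. a (Suc i)) b = (if p = 0 then 0 else of_nat (n choose (p - 1)) * a p * b r)"
  proof (cases p)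
    case 0
    then show ?thesis using leibniz_eq_0[of 0 "\<lambda>i. a (Suc i)" r b n] Suc.prems n by simp
  next
    case (Suc p')
    then show ?thesis using Suc.hyps(1)[of p' r "\<lambda>i. a (Suc i)" b] Suc.prems n by simp
  qed
  have 2: "leibniz n a (\<lambda>i. b (Suc i)) = (if r = 0 then 0 else of_nat (n choose p) * a p * b r)"
  proof (cases r)
    case 0
    then show ?thesis using leibniz_eq_0[of p a 0 "\<lambda>i. b (Suc i)" n] Suc.prems n by simp
  next
    case (Suc r')
    then show ?thesis using Suc.hyps(1)[of p r' a "\<lambda>i. b (Suc i)"] Suc.prems n by simp
  qed
  show ?case unfolding n leibniz.simps 1 2
    using n by (cases p; cases r) (auto simp: algebra_simps)
qed

text \<open>A functional \<open>l\<close> whose kernel is a subalgebra, with a vector \<open>v\<close> that plays the role of the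
  coordinate field \<open>d/dx\<close> on the homogeneous space: \<open>l \<circ> (ad v) ^^ n\<close> is then the \<open>n\<close>-th derivative
  at the base point of a vector field on the line.\<close>

locale line_fields =
  fixes br :: "'l::euclidean_space \<Rightarrow> 'l \<Rightarrow> 'l" and l :: "'l \<Rightarrow> complex" and v :: 'l
  assumes bilinear_br: "bilinear br" and br_skew: "br x y = - br y x"
    and jacobi: "br x (br y z) = br (br x y) z + br y (br x z)"
    and linear_l: "linear l" and l_v: "l v = 1"
    and l_br: "l (br x y) = l x * l (br v y) - l (br v x) * l y"
begin

lemmas br_simps = bilinear_ladd[OF bilinear_br] bilinear_radd[OF bilinear_br]
  bilinear_lsub[OF bilinear_br] bilinear_rsub[OF bilinear_br]
  bilinear_lmul[OF bilinear_br] bilinear_rmul[OF bilinear_br]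
  bilinear_lzero[OF bilinear_br] bilinear_rzero[OF bilinear_br]

definition "tc n x = l ((br v ^^ n) x)"

lemma tc_Suc: "tc (Suc n) x = tc n (br v x)"
  by (simp add: tc_def funpow_Suc_right del: funpow.simps)

lemma linear_tc: "linear (tc n)"
proof (induction n)
  case 0
  then show ?case using linear_l by (simp add: tc_def[abs_def])
next
  case (Suc n)
  then show ?case
    by (intro linearI; simp add: tc_Suc br_simps linear_add linear_cmul)
qed

text \<open>The bracket of the fields f d/dx and g d/dx is f g' - f' g, here differentiated n times:
  \<open>l_br\<close> is the value at the base point, and \<open>br v\<close> is a
  derivation.\<close>

lemma tc_br: "tc n (br x y) = leibniz n (\<lambda>i. tc i x) (\<lambda>i. tc (Suc i) y) - leibniz n (\<lambda>i. tc (Suc i) x) (\<lambda>i. tc i y)"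
proof (induction n arbitrary: x y)
  case 0
  then show ?case using l_br[of x y] by (simp add: tc_def)
next
  case (Suc n)
  have "tc (Suc n) (br x y) = tc n (br (br v x) y) + tc n (br x (br v y))"
    unfolding tc_Suc jacobi[of v] by (rule linear_add[OF linear_tc])
  then show ?case by (simp add: Suc.IH tc_Suc)
qed

text \<open>Pairs \<open>p\<close> stand for the elements \<open>fst p + \<i> * snd p\<close> of the complexified algebra.\<close>

definition "tcc n p = tc n (fst p) + \<i> * tc n (snd p)"
definition "brc p q = (br (fst p) (fst q) - br (snd p) (snd q), br (fst p) (snd q) + br (snd p) (fst q))"
definition "shift p = (br v (fst p), br v (snd p))"
definition "smul z p = (Re z *\<^sub>R fst p - Im z *\<^sub>R snd p, Re z *\<^sub>R snd p + Im z *\<^sub>R fst p)"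

lemma tcc_shift: "tcc n (shift p) = tcc (Suc n) p"
  by (simp add: tcc_def shift_def tc_Suc)

lemma tcc_add: "tcc n (p + q) = tcc n p + tcc n q"
  and tcc_diff: "tcc n (p - q) = tcc n p - tcc n q"
  by (simp_all add: tcc_def linear_add[OF linear_tc] linear_diff[OF linear_tc] algebra_simps)

lemma tcc_scaleR: "tcc n (r *\<^sub>R p) = of_real r * tcc n p"
  by (simp add: tcc_def linear_cmul[OF linear_tc] scaleR_conv_of_real algebra_simps)

lemma tcc_smul: "tcc n (smul z p) = z * tcc n p"
  by (simp add: tcc_def smul_def linear_add[OF linear_tc] linear_diff[OF linear_tc] linear_cmul[OF linear_tc] scaleR_conv_of_real)
    (simp add: complex_eq_iff algebra_simps)

lemma tcc_brc:
  "tcc n (brc p q) = leibniz n (\<lambda>i. tcc i p) (\<lambda>i. tcc (Suc i) q) - leibniz n (\<lambda>i. tcc (Suc i) p) (\<lambda>i. tcc i q)"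
  by (simp add: tcc_def brc_def linear_add[OF linear_tc] linear_diff[OF linear_tc] tc_br leibniz_linear)
    (simp add: algebra_simps)

lemma tcc_v: "tcc 0 (v, 0) = 1" "tcc (Suc n) (v, 0) = 0"
proof -
  have "br v v + br v v = 0" by (metis br_skew eq_neg_iff_add_eq_0)
  then have "2 *\<^sub>R br v v = 0" by (simp only: scaleR_2)
  then have "br v v = 0" by simp
  then show "tcc 0 (v, 0) = 1" "tcc (Suc n) (v, 0) = 0"
    using l_v by (simp_all add: tcc_def tc_Suc linear_0[OF linear_tc] br_simps) (simp add: tc_def linear_0[OF linear_l])
qed

text \<open>The only place where the finite dimension of the algebra enters. The spaces
  \<open>J d\<close> decrease, so two consecutive ones agree; since \<open>shift\<close> maps
  \<open>J (Suc d)\<close> into \<open>J d\<close>, all later ones agree with them.\<close>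

lemma jets_determined: "\<exists>d. \<forall>p. (\<forall>i<d. tcc i p = 0) \<longrightarrow> (\<forall>i. tcc i p = 0)"
proof -
  define J where "J d = {p. \<forall>i<d. tcc i p = 0}" for d
  have sub: "subspace (J d)" for d
    by (simp add: J_def subspace_def tcc_add tcc_scaleR) (simp add: tcc_def linear_0[OF linear_tc])
  have anti: "J (Suc d) \<subseteq> J d" for d by (auto simp: J_def)
  have "\<exists>d. J (Suc d) = J d"
  proof (rule ccontr)
    assume "\<not> ?thesis"
    then have lt: "dim (J (Suc d)) < dim (J d)" for d
      using anti[of d] sub dim_subset[OF anti[of d]] subspace_dim_equal[OF sub sub anti[of d]] by force
    have "dim (J d) + d \<le> dim (J 0)" for d
    proof (induction d)
      case (Suc d)
      then show ?case using lt[of d] by linarith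
    qed simp
    from this[of "Suc (dim (J 0))"] show False by simp
  qed
  then obtain d where d: "J (Suc d) = J d" by blast
  have "tcc i p = 0" if "\<forall>i<d. tcc i p = 0" for i p
    using that
  proof (induction i arbitrary: p)
    case 0
    then have "p \<in> J (Suc d)" unfolding d by (simp add: J_def)
    then show ?case by (simp add: J_def)
  next
    case (Suc i)
    then have "p \<in> J (Suc d)" unfolding d by (simp add: J_def)
    then have "\<forall>i<d. tcc i (shift p) = 0" by (simp add: J_def tcc_shift)
    then show ?case using Suc.IH[of "shift p"] by (simp add: tcc_shift)
  qed
  then show ?thesis by blast
qed

definition "has_order m p \<longleftrightarrow> (\<forall>i<m. tcc i p = 0) \<and> tcc m p \<noteq> 0"

text \<open>For a field f with a zero of order m, f f'' - f' f' vanishes to order 2 m - 2, and its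
  leading coefficient is a difference of two neighbouring binomial coefficients times the square of
  that of f.\<close>

lemma order_increases:
  assumes p: "has_order m p" and m: "m \<ge> 2"
  shows "has_order (2 * m - 2) (brc p (shift p))"
proof -
  obtain k where k: "m = Suc (Suc k)" using m by (metis add_2_eq_Suc le_Suc_ex)
  define a where "a i = tcc i p" for i
  have a: "a i = 0" if "i < m" for i using p that by (simp add: has_order_def a_def)
  have am: "a m \<noteq> 0" using p by (simp add: has_order_def a_def)
  have eq: "tcc n (brc p (shift p)) = leibniz n a (\<lambda>i. a (Suc (Suc i))) - leibniz n (\<lambda>i. a (Suc i)) (\<lambda>i. a (Suc i))" for n
    by (simp add: tcc_brc tcc_shift a_def[abs_def])
  have n: "2 * m - 2 = m + k" "2 * m - 2 = Suc k + Suc k" using k by auto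
  have "tcc i (brc p (shift p)) = 0" if "i < 2 * m - 2" for i
    unfolding eq using that a n k
      leibniz_eq_0[of m a k "\<lambda>i. a (Suc (Suc i))" i]
      leibniz_eq_0[of "Suc k" "\<lambda>i. a (Suc i)" "Suc k" "\<lambda>i. a (Suc i)" i] by simp
  moreover have "tcc (2 * m - 2) (brc p (shift p)) \<noteq> 0"
  proof
    assume "tcc (2 * m - 2) (brc p (shift p)) = 0"
    moreover have "leibniz (m + k) a (\<lambda>i. a (Suc (Suc i))) = of_nat (m + k choose m) * a m * a m"
      using leibniz_leading[of m a k "\<lambda>i. a (Suc (Suc i))"] a k by simp
    moreover have "leibniz (Suc k + Suc k) (\<lambda>i. a (Suc i)) (\<lambda>i. a (Suc i)) = of_nat (Suc k + Suc k choose Suc k) * a m * a m"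
      using leibniz_leading[of "Suc k" "\<lambda>i. a (Suc i)" "Suc k" "\<lambda>i. a (Suc i)"] a k by simp
    ultimately have "(of_nat (2 * m - 2 choose m) - of_nat (2 * m - 2 choose Suc k)) * a m * a m = (0 :: complex)"
      unfolding eq n(1)[symmetric] n(2)[symmetric] by (simp add: algebra_simps)
    then have "of_nat (2 * m - 2 choose m) = (of_nat (2 * m - 2 choose Suc k) :: complex)" using am by simp
    then have *: "2 * m - 2 choose m = 2 * m - 2 choose Suc k" by (simp only: of_nat_eq_iff)
    define C where "C = 2 * m - 2 choose Suc k"
    \<comment> \<open>The central coefficient and its neighbour have ratio (k + 2) : (k + 1), so
      equality would force both to be zero.\<close>
    have "Suc (Suc k) * (2 * m - 2 choose Suc (Suc k)) = (2 * m - 2 - Suc k) * (2 * m - 2 choose Suc k)"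
      by (simp only: binomial_absorption binomial_absorb_comp)
    then have "Suc (Suc k) * C = (2 * m - 2 - Suc k) * C"
      using * by (simp only: C_def k)
    moreover have "2 * m - 2 - Suc k = Suc k" using k by simp
    ultimately have "C = 0" by simp
    then show False using k by (simp add: C_def binomial_eq_0_iff)
  qed
  ultimately show ?thesis by (simp add: has_order_def)
qed

text \<open>For m \<ge> 3 the order 2 m - 2 exceeds m, so iteration yields zeros of arbitrarily high
  finite order, against \<open>jets_determined\<close>.\<close>

lemma order_less_3:
  assumes "has_order m p"
  shows "m < 3"
proof (rule ccontr)
  assume "\<not> m < 3"
  have "\<exists>m p. m \<ge> k + 3 \<and> has_order m p" for k
  proof (induction k)
    case 0
    then show ?case using assms \<open>\<not> m < 3\<close> by (intro exI[of _ m] exI[of _ p]) auto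
  next
    case (Suc k)
    then obtain m p where m: "m \<ge> k + 3" "has_order m p" by blast
    then show ?case using order_increases[OF m(2)]
      by (intro exI[of _ "2 * m - 2"] exI[of _ "brc p (shift p)"]) auto
  qed
  moreover obtain d where d: "\<And>p i. (\<forall>i<d. tcc i p = 0) \<Longrightarrow> tcc i p = 0"
    using jets_determined by blast
  ultimately obtain m p where "m \<ge> d + 3" "has_order m p" by blast
  then show False using d[of p m] by (simp add: has_order_def)
qed

lemma jet2_eq_0:
  assumes "tcc 0 p = 0" "tcc 1 p = 0" "tcc 2 p = 0"
  shows "tcc i p = 0"
proof (rule ccontr)
  assume "tcc i p \<noteq> 0"
  then have "has_order (LEAST i. tcc i p \<noteq> 0) p"
    unfolding has_order_def by (metis (mono_tags, lifting) LeastI not_less_Least)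
  moreover from this have "(LEAST i. tcc i p \<noteq> 0) < 3" by (rule order_less_3)
  then have "(LEAST i. tcc i p \<noteq> 0) \<in> {0, 1, 2}" by auto
  ultimately show False using assms unfolding has_order_def by (metis insertE singletonD)
qed

text \<open>The equation f''' = K f' of the fields in the coordinate where v is d/dx. The cases are
  those of an isotropy algebra containing a zero of order two, of order one but not two, or no zero
  of order one or two.\<close>

lemma tcc3_proportional: "\<exists>K. \<forall>p. tcc 3 p = K * tcc 1 p"
proof (cases "\<exists>p. tcc 0 p = 0 \<and> tcc 1 p = 0 \<and> tcc 2 p \<noteq> 0")
  case True
  then obtain p' where p': "tcc 0 p' = 0" "tcc 1 p' = 0" "tcc 2 p' \<noteq> 0" by blast
  \<comment> \<open>Normalizing the leading coefficient takes a complex scalar, which is why the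
    real algebra was complexified.\<close>
  define p where "p = smul (1 / tcc 2 p') p'"
  have p: "tcc 0 p = 0" "tcc 1 p = 0" "tcc 2 p = 1" using p' by (simp_all add: p_def tcc_smul)
  define c where "c = tcc 3 p"
  have 3: "tcc 3 r = c * tcc 2 r" if "tcc 0 r = 0" "tcc 1 r = 0" for r
    using jet2_eq_0[of "r - smul (tcc 2 r) p" 3] that p by (simp add: tcc_diff tcc_smul c_def)
  define q where "q = shift p"
  have q: "tcc n q = tcc (Suc n) p" for n by (simp add: q_def tcc_shift)
  have s: "tcc (Suc 0) p = 0" "tcc (Suc (Suc 0)) p = 1" "tcc (Suc (Suc (Suc 0))) p = c"
    using p by (simp_all add: c_def numeral_2_eq_2 numeral_3_eq_3)
  \<comment> \<open>The bracket of p with its derivative has second derivative - 1 and third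
    derivative - 2 c, while the previous step predicts - c for the latter.\<close>
  have "c = 0"
    using 3[of "brc p q"] p(1)
    by (simp add: tcc_brc q s numeral_2_eq_2 numeral_3_eq_3)
  have "tcc 3 r = tcc 3 q * tcc 1 r" for r
  proof -
    \<comment> \<open>Removing the value with v and the slope with q leaves a zero of order at least
      two, whose third derivative is now zero.\<close>
    define r' where "r' = r - smul (tcc 0 r) (v, 0) - smul (tcc 1 r) q"
    have "tcc 0 r' = 0" "tcc 1 r' = 0"
      using tcc_v(1) tcc_v(2)[of 0] p(2) s by (simp_all add: r'_def tcc_diff tcc_smul q)
    from 3[OF this] have "tcc 3 r' = 0" using \<open>c = 0\<close> by simp
    then show ?thesis
      using tcc_v(2)[of 2] by (simp add: r'_def tcc_diff tcc_smul)
  qed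
  then show ?thesis by blast
next
  case B: False
  show ?thesis
  proof (cases "\<exists>q. tcc 0 q = 0 \<and> tcc 1 q \<noteq> 0")
    case True
    then obtain q where q: "tcc 0 q = 0" "tcc 1 q \<noteq> 0" by blast
    define \<beta> where "\<beta> = tcc 2 q / tcc 1 q"
    have 2: "tcc 2 r = \<beta> * tcc 1 r" for r
    proof -
      define r' where "r' = r - smul (tcc 0 r) (v, 0) - smul (tcc 1 r / tcc 1 q) q"
      have "tcc 0 r' = 0" "tcc 1 r' = 0"
        using tcc_v(1) tcc_v(2)[of 0] q by (simp_all add: r'_def tcc_diff tcc_smul)
      with B have "tcc 2 r' = 0" by blast
      then show ?thesis
        using tcc_v(2)[of 1] by (simp add: r'_def tcc_diff tcc_smul \<beta>_def numeral_2_eq_2)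
    qed
    \<comment> \<open>The relation f'' = \<beta> f' holds for all fields of the algebra, so it may
      be applied to the derivative of f as well.\<close>
    have "tcc 3 r = \<beta> * \<beta> * tcc 1 r" for r
      using 2[of "shift r"] 2[of r] by (simp add: tcc_shift numeral_2_eq_2 numeral_3_eq_3)
    then show ?thesis by blast
  next
    case False
    have 1: "tcc 1 r = 0" for r
    proof -
      define r' where "r' = r - smul (tcc 0 r) (v, 0)"
      have "tcc 0 r' = 0" using tcc_v(1) by (simp add: r'_def tcc_diff tcc_smul)
      with False have "tcc 1 r' = 0" by blast
      then show ?thesis using tcc_v(2)[of 0] by (simp add: r'_def tcc_diff tcc_smul)
    qed
    have "tcc 3 r = 0 * tcc 1 r" for r
      using 1[of "shift (shift r)"] by (simp add: tcc_shift numeral_3_eq_3)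
    then show ?thesis by blast
  qed
qed

lemma third_derivative: "\<exists>K. \<forall>x. l (br v (br v (br v x))) = K * l (br v x)"
proof -
  obtain K where K: "\<And>p. tcc 3 p = K * tcc 1 p" using tcc3_proportional by blast
  have "l (br v (br v (br v x))) = K * l (br v x)" for x
  proof -
    have "tc 3 x = K * tc 1 x" using K[of "(x, 0)"] by (simp add: tcc_def linear_0[OF linear_tc])
    then show ?thesis by (simp add: tc_def numeral_3_eq_3)
  qed
  then show ?thesis by blast
qed

end

section \<open>From third derivatives to homomorphisms into sl(2)\<close>

lemma linear_mult_const:
  fixes f :: "'l::real_vector \<Rightarrow> 'f::real_algebra"
  shows "linear f \<Longrightarrow> linear (\<lambda>x. f x * c)"
  by (intro linearI) (simp_all add: linear_add linear_cmul distrib_right)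

text \<open>\<open>Z\<close> corrects the second derivative by the Schwarzian \<open>K\<close>.\<close>

lemma projective_structure_of_third_derivative:
  fixes br :: "'l::real_vector \<Rightarrow> 'l \<Rightarrow> 'l" and l w :: "'l \<Rightarrow> 'f::real_normed_field"
  assumes bilinear_br: "bilinear br"
    and jacobi: "\<And>x y z. br x (br y z) = br (br x y) z + br y (br x z)"
    and l: "linear l" and v: "l v \<noteq> 0"
    and w: "\<And>x y. l (br x y) = (l x * l (br v y) - l (br v x) * l y) / l v"
    and K: "\<And>x. l (br v (br v (br v x))) = K * l (br v x)"
  obtains w' Z where "linear w'" "linear Z" "\<And>x y. l (br x y) = w' x * l y - w' y * l x"
    "\<And>x y. w' (br x y) = l x * Z y - l y * Z x" "\<And>x y. Z (br x y) = Z x * w' y - Z y * w' x"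
proof -
  note br_simps = bilinear_ladd[OF bilinear_br] bilinear_radd[OF bilinear_br]
    bilinear_lmul[OF bilinear_br] bilinear_rmul[OF bilinear_br]
  define \<mu> where "\<mu> = l v"
  have \<mu>: "\<mu> \<noteq> 0" using v by (simp add: \<mu>_def)
  \<comment> \<open>Of the weights, determined only up to multiples of \<open>l\<close>, this is the
    one that vanishes at v.\<close>
  define w' where "w' x = - l (br v x) / \<mu>" for x
  define Z where "Z x = (- l (br v (br v x)) + K / 2 * l x) / \<mu>\<^sup>2" for x
  have lw: "l (br x y) = w' x * l y - w' y * l x" for x y
    unfolding w[of x y] w'_def \<mu>_def using v by (simp add: field_simps)
  have l1: "l (br v x) = - \<mu> * w' x" for x using \<mu> by (simp add: w'_def)
  have w'v: "w' (br v x) = - l (br v (br v x)) / \<mu>" for x by (simp add: w'_def)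
  have l2: "l (br v (br v x)) = - \<mu>\<^sup>2 * Z x + K / 2 * l x" for x
    using \<mu> by (simp add: Z_def field_simps)
  have lin: "linear w'" "linear Z"
  proof -
    have L: "linear (\<lambda>x. l (br v x))" "linear (\<lambda>x. l (br v (br v x)))"
      by (intro linearI; simp add: br_simps linear_add[OF l] linear_cmul[OF l])+
    have eq: "w' = (\<lambda>x. l (br v x) * (- 1 / \<mu>))"
        "Z = (\<lambda>x. l (br v (br v x)) * (- 1 / \<mu>\<^sup>2) + l x * (K / 2 / \<mu>\<^sup>2))"
      using \<mu> by (auto simp: w'_def Z_def fun_eq_iff field_simps)
    show "linear w'" "linear Z"
      unfolding eq by (intro linear_compose_add linear_mult_const L l)+
  qed
  \<comment> \<open>\<open>l\<close> of the Jacobi identity for \<open>br v\<close>; the K-terms of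
    \<open>Z\<close> cancel between the two products.\<close>
  have wbr: "w' (br x y) = l x * Z y - l y * Z x" for x y
  proof -
    have "- \<mu> * w' (br x y) = l (br v (br x y))" by (simp add: l1)
    also have "\<dots> = l (br (br v x) y) + l (br x (br v y))"
      unfolding jacobi[of v] by (rule linear_add[OF l])
    also have "\<dots> = (- l (br v (br v x)) / \<mu>) * l y - w' y * (- \<mu> * w' x) + (w' x * (- \<mu> * w' y) - (- l (br v (br v y)) / \<mu>) * l x)"
      unfolding lw[of "br v x" y] lw[of x "br v y"] l1[of x] l1[of y] w'v ..
    also have "\<dots> = - \<mu> * (l x * Z y - l y * Z x)"
      unfolding l2 using \<mu> by (simp add: field_simps power2_eq_square)
    finally show ?thesis using \<mu> by simp
  qed
  \<comment> \<open>The third-derivative identity enters here. The share K / 2 in \<open>Z\<close>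
    is what balances the K-terms in the last bracket formula.\<close>
  have Zv: "Z (br v x) = K / 2 * w' x / \<mu>" for x
  proof -
    have "Z (br v x) = (- (K * l (br v x)) + K / 2 * l (br v x)) / \<mu>\<^sup>2" by (simp add: Z_def K)
    then show ?thesis unfolding l1 using \<mu> by (simp add: field_simps power2_eq_square)
  qed
  have w'v': "w' (br v x) = \<mu> * Z x - K / 2 * l x / \<mu>" for x
    unfolding w'v l2 using \<mu> by (simp add: field_simps power2_eq_square)
  have "Z (br x y) = Z x * w' y - Z y * w' x" for x y
  proof -
    have "\<mu> * Z (br x y) - K / 2 * l (br x y) / \<mu> = w' (br v (br x y))" by (rule w'v'[symmetric])
    also have "\<dots> = w' (br (br v x) y) + w' (br x (br v y))"
      unfolding jacobi[of v] by (rule linear_add[OF lin(1)])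
    also have "\<dots> = l (br v x) * Z y - l y * Z (br v x) + (l x * Z (br v y) - l (br v y) * Z x)"
      by (simp add: wbr)
    also have "\<dots> = - \<mu> * w' x * Z y - K / 2 * w' x / \<mu> * l y + K / 2 * w' y / \<mu> * l x + \<mu> * w' y * Z x"
      unfolding l1 Zv by (simp add: field_simps)
    finally have eq: "\<mu> * Z (br x y) - K / 2 * l (br x y) / \<mu> =
        - \<mu> * w' x * Z y - K / 2 * w' x / \<mu> * l y + K / 2 * w' y / \<mu> * l x + \<mu> * w' y * Z x" .
    have split: "K / 2 * (w' x * l y - w' y * l x) / \<mu> = K / 2 * w' x / \<mu> * l y - K / 2 * w' y / \<mu> * l x"
      using \<mu> by (simp add: field_simps)
    from eq have "\<mu> * Z (br x y) = \<mu> * (Z x * w' y - Z y * w' x)"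
      unfolding lw split by (simp add: algebra_simps)
    then show ?thesis using \<mu> by simp
  qed
  with lin lw wbr that show ?thesis by blast
qed

text \<open>Adding a multiple of \<open>l\<close> to w does not change the right-hand side of the
  hypothesis, so w may be traded for the derivative along v.\<close>

lemma normalized_functional:
  fixes l w :: "'l::real_vector \<Rightarrow> 'f::real_normed_field"
  assumes w: "\<And>x y. l (br x y) = w x * l y - w y * l x" and v: "l v \<noteq> 0"
  shows "l (br x y) = (l x * l (br v y) - l (br v x) * l y) / l v"
  using v unfolding w[of v] w[of x y] by (simp add: field_simps)

text \<open>The conclusion says that (\<open>l\<close>, \<open>w'\<close>, \<open>Z\<close>) is a
  homomorphism into sl(2) in its grading by weights 1, 0, - 1: the action on the line is
  projective.\<close>

lemma complex_projective_structure:
  fixes br :: "'l::euclidean_space \<Rightarrow> 'l \<Rightarrow> 'l" and l w :: "'l \<Rightarrow> complex"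
  assumes bilinear_br: "bilinear br" and br_skew: "\<And>x y. br x y = - br y x"
    and jacobi: "\<And>x y z. br x (br y z) = br (br x y) z + br y (br x z)"
    and l: "linear l" and v: "l v \<noteq> 0"
    and w: "\<And>x y. l (br x y) = w x * l y - w y * l x"
  obtains w' Z where "linear w'" "linear Z" "\<And>x y. l (br x y) = w' x * l y - w' y * l x"
    "\<And>x y. w' (br x y) = l x * Z y - l y * Z x" "\<And>x y. Z (br x y) = Z x * w' y - Z y * w' x"
proof -
  note n = normalized_functional[of l br w, OF w v]
  interpret line_fields br "\<lambda>x. l x / l v" v
  proof (rule line_fields.intro)
    show "linear (\<lambda>x. l x / l v)"
      unfolding divide_inverse by (rule linear_mult_const[OF l])
    show "l (br x y) / l v = l x / l v * (l (br v y) / l v) - l (br v x) / l v * (l y / l v)" for x y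
      unfolding n[of x y] using v by (simp add: field_simps)
  qed (use v in \<open>simp_all add: bilinear_br jacobi[symmetric] br_skew[symmetric]\<close>)
  obtain K where K: "\<And>x. l (br v (br v (br v x))) = K * l (br v x)"
    using third_derivative v by auto
  show ?thesis
    by (rule projective_structure_of_third_derivative[where br = br and l = l and v = v and K = K])
      (fact bilinear_br jacobi l v n K that)+
qed

text \<open>Obtained from the complex argument: the derivatives are real, so K may be replaced by
  its real part.\<close>

lemma real_projective_structure:
  fixes br :: "'l::euclidean_space \<Rightarrow> 'l \<Rightarrow> 'l" and l w :: "'l \<Rightarrow> real"
  assumes bilinear_br: "bilinear br" and br_skew: "\<And>x y. br x y = - br y x"
    and jacobi: "\<And>x y z. br x (br y z) = br (br x y) z + br y (br x z)"
    and l: "linear l" and v: "l v \<noteq> 0"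
    and w: "\<And>x y. l (br x y) = w x * l y - w y * l x"
  obtains w' Z where "linear w'" "linear Z" "\<And>x y. l (br x y) = w' x * l y - w' y * l x"
    "\<And>x y. w' (br x y) = l x * Z y - l y * Z x" "\<And>x y. Z (br x y) = Z x * w' y - Z y * w' x"
proof -
  note n = normalized_functional[of l br w, OF w v]
  interpret line_fields br "\<lambda>x. complex_of_real (l x / l v)" v
  proof (rule line_fields.intro)
    show "linear (\<lambda>x. complex_of_real (l x / l v))"
      by (intro linearI) (simp_all add: linear_add[OF l] linear_cmul[OF l] add_divide_distrib scaleR_conv_of_real)
    fix x y
    have eq: "l (br x y) / l v = l x / l v * (l (br v y) / l v) - l (br v x) / l v * (l y / l v)"
      unfolding n[of x y] using v by (simp add: field_simps)
    show "complex_of_real (l (br x y) / l v) = complex_of_real (l x / l v) * complex_of_real (l (br v y) / l v)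
        - complex_of_real (l (br v x) / l v) * complex_of_real (l y / l v)"
      unfolding eq by (simp only: of_real_mult of_real_diff)
  qed (use v in \<open>simp_all add: bilinear_br jacobi[symmetric] br_skew[symmetric]\<close>)
  obtain K where K: "\<And>x. complex_of_real (l (br v (br v (br v x))) / l v) = K * complex_of_real (l (br v x) / l v)"
    using third_derivative by auto
  have Re: "l (br v (br v (br v x))) = Re K * l (br v x)" for x
  proof -
    have "l (br v (br v (br v x))) / l v = Re K * (l (br v x) / l v)"
      using arg_cong[OF K[of x], of Re] by simp
    then show ?thesis using v by (simp add: field_simps)
  qed
  show ?thesis
    by (rule projective_structure_of_third_derivative[where br = br and l = l and v = v and K = "Re K"])
      (fact bilinear_br jacobi l v n Re that)+
qed

section \<open>Normal lifts\<close>

context homogeneous_conformal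
begin

text \<open>The interface between the two constructions and the matrices: zero torsion, a curvature
  vanishing on the isotropy algebra in degrees zero and one, and the traced normalization in the
  basis \<open>sec i\<close>.\<close>

definition normal_lift :: "('l \<Rightarrow> 'v \<Rightarrow> 'v) \<Rightarrow> ('l \<Rightarrow> real) \<Rightarrow> ('l \<Rightarrow> 'v) \<Rightarrow> bool" where
  "normal_lift \<omega> \<tau> \<zeta> \<longleftrightarrow>
     (\<forall>Y. linear (\<omega> Y)) \<and> (\<forall>x. linear (\<lambda>Y. \<omega> Y x)) \<and> linear \<tau> \<and> linear \<zeta> \<and>
     (\<forall>Y. conformal_with (\<tau> Y) (\<omega> Y)) \<and>
     (\<forall>Y1 Y2. lam (br Y1 Y2) = \<omega> Y1 (lam Y2) - \<omega> Y2 (lam Y1)) \<and>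
     (\<forall>Y Yh x. lam Yh = 0 \<longrightarrow>
        \<omega> (br Y Yh) x = \<omega> Y (\<omega> Yh x) - \<omega> Yh (\<omega> Y x) + S (\<zeta> Yh) (lam Y) x) \<and>
     (\<forall>Y Yh. lam Yh = 0 \<longrightarrow>
        \<zeta> (br Y Yh) = (2 * \<tau> Yh) *\<^sub>R \<zeta> Y - \<omega> Yh (\<zeta> Y) - (2 * \<tau> Y) *\<^sub>R \<zeta> Yh + \<omega> Y (\<zeta> Yh)) \<and>
     (\<forall>Y w. (\<Sum>i\<in>Basis. (\<omega> Y (\<omega> (sec i) w) - \<omega> (sec i) (\<omega> Y w) - \<omega> (br Y (sec i)) w
        + S (\<zeta> (sec i)) (lam Y) w - S (\<zeta> Y) i w) \<bullet> i) = 0)"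

lemma normal_lift_ge3:
  assumes "DIM('v) \<ge> 3"
  shows "\<exists>\<omega> \<tau> \<zeta>. normal_lift \<omega> \<tau> \<zeta>"
proof -
  obtain \<omega> :: "'l \<Rightarrow> 'v \<Rightarrow> 'v" and \<tau> :: "'l \<Rightarrow> real"
    where c: "\<And>Y. linear (\<omega> Y)" "\<And>x. linear (\<lambda>Y. \<omega> Y x)" "linear \<tau>"
      "\<And>Y. conformal_with (\<tau> Y) (\<omega> Y)"
      "\<And>Y1 Y2. lam (br Y1 Y2) = \<omega> Y1 (lam Y2) - \<omega> Y2 (lam Y1)"
    using torsion_free_connection by blast
  interpret torsion_free N br lam \<omega> \<tau>
    by (intro torsion_free.intro torsion_free_axioms.intro homogeneous_conformal_axioms c)
  obtain \<zeta> :: "'l \<Rightarrow> 'v" where z: "linear \<zeta>"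
    "\<And>Y Yh x. lam Yh = 0 \<Longrightarrow> K0 \<zeta> Y Yh x = 0"
    "\<And>Y Yh. lam Yh = 0 \<Longrightarrow> K1 \<zeta> Y Yh = 0"
    "\<And>Y w. (\<Sum>i\<in>Basis. K0 \<zeta> Y (sec i) w \<bullet> i) = 0"
    by (rule normal_connection_exists[OF assms]) blast
  have "\<omega> (br Y Yh) x = \<omega> Y (\<omega> Yh x) - \<omega> Yh (\<omega> Y x) + S (\<zeta> Yh) (lam Y) x" if "lam Yh = 0" for Y Yh x
    using z(2)[OF that, of Y x] that by (simp add: K0_def F_def algebra_simps)
  moreover have "\<zeta> (br Y Yh) = (2 * \<tau> Yh) *\<^sub>R \<zeta> Y - \<omega> Yh (\<zeta> Y) - (2 * \<tau> Y) *\<^sub>R \<zeta> Yh + \<omega> Y (\<zeta> Yh)"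
    if "lam Yh = 0" for Y Yh
    using z(3)[OF that, of Y] by (simp add: K1_def)
  moreover have "(\<Sum>i\<in>Basis. (\<omega> Y (\<omega> (sec i) w) - \<omega> (sec i) (\<omega> Y w) - \<omega> (br Y (sec i)) w
        + S (\<zeta> (sec i)) (lam Y) w - S (\<zeta> Y) i w) \<bullet> i) = 0" for Y w
    using z(4)[of Y w] by (simp add: K0_def F_def sec(2))
  ultimately show ?thesis
    unfolding normal_lift_def using c z(1) by blast
qed

text \<open>For a homomorphism the curvature is zero, so each summand of the trace condition
  vanishes.\<close>

lemma flat_normal_lift:
  assumes "\<And>Y. linear (\<omega> Y)" "\<And>x. linear (\<lambda>Y. \<omega> Y x)" "linear \<tau>" "linear \<zeta>"
    "\<And>Y. conformal_with (\<tau> Y) (\<omega> Y)"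
    "\<And>Y1 Y2. lam (br Y1 Y2) = \<omega> Y1 (lam Y2) - \<omega> Y2 (lam Y1)"
    and flat: "\<And>Y1 Y2 x. \<omega> (br Y1 Y2) x =
      \<omega> Y1 (\<omega> Y2 x) - \<omega> Y2 (\<omega> Y1 x) + S (\<zeta> Y2) (lam Y1) x - S (\<zeta> Y1) (lam Y2) x"
    "\<And>Y1 Y2. \<zeta> (br Y1 Y2) = (2 * \<tau> Y2) *\<^sub>R \<zeta> Y1 - \<omega> Y2 (\<zeta> Y1) - (2 * \<tau> Y1) *\<^sub>R \<zeta> Y2 + \<omega> Y1 (\<zeta> Y2)"
  shows "normal_lift \<omega> \<tau> \<zeta>"
  unfolding normal_lift_def flat using assms by (simp add: sec(2))

lemma normal_lift_1:
  assumes B: "Basis = {i}" and N: "N i = i"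
  shows "\<exists>\<omega> \<tau> \<zeta>. normal_lift \<omega> \<tau> \<zeta>"
proof -
  obtain \<omega> :: "'l \<Rightarrow> 'v \<Rightarrow> 'v" and \<tau> :: "'l \<Rightarrow> real"
    where c: "\<And>Y. linear (\<omega> Y)" "\<And>x. linear (\<lambda>Y. \<omega> Y x)"
      "\<And>Y1 Y2. lam (br Y1 Y2) = \<omega> Y1 (lam Y2) - \<omega> Y2 (lam Y1)"
    using torsion_free_connection by metis
  have eqI: "x = y" if "x \<bullet> i = y \<bullet> i" for x y
  proof (rule euclidean_eqI)
    fix k :: 'v assume "k \<in> Basis"
    then have "k = i" unfolding B by simp
    then show "x \<bullet> k = y \<bullet> k" using that by simp
  qed
  have i: "i \<bullet> i = 1" using inner_same_Basis[of i] unfolding B by simp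
  have x: "x = (x \<bullet> i) *\<^sub>R i" for x by (rule eqI) (simp add: i)
  have b: "b x y = (x \<bullet> i) * (y \<bullet> i)" for x y
  proof -
    have "b x y = b ((x \<bullet> i) *\<^sub>R i) ((y \<bullet> i) *\<^sub>R i)" using x by metis
    then show ?thesis by (simp add: b_simps) (simp add: b_def N i)
  qed
  define l where "l Y = lam Y \<bullet> i" for Y
  define w where "w Y = \<omega> Y i \<bullet> i" for Y
  have \<omega>x: "\<omega> Y x \<bullet> i = w Y * (x \<bullet> i)" for Y x
    by (subst x) (simp add: linear_cmul[OF c(1)] w_def)
  have l: "linear l" unfolding l_def by (intro linearI) (simp_all add: lam_simps inner_simps)
  obtain v where "lam v = i" using surj_lam by (metis surjD)
  then have v: "l v \<noteq> 0" using i by (simp add: l_def)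
  have lw: "l (br x y) = w x * l y - w y * l x" for x y
    by (simp add: l_def c(3) inner_simps \<omega>x)
  obtain w' Z where w': "linear w'" "linear Z" "\<And>x y. l (br x y) = w' x * l y - w' y * l x"
    "\<And>x y. w' (br x y) = l x * Z y - l y * Z x" "\<And>x y. Z (br x y) = Z x * w' y - Z y * w' x"
    using real_projective_structure[OF bilinear_br br_skew jacobi l v lw] by blast
  have li: "lam Y \<bullet> i = l Y" for Y by (simp add: l_def)
  \<comment> \<open>In dimension one \<open>S z x y\<close> is the product of the three coordinates
    and every endomorphism is conformal, so the sl(2) data are the lift without any
    rescaling.\<close>
  have "normal_lift (\<lambda>Y x. w' Y *\<^sub>R x) w' (\<lambda>Y. Z Y *\<^sub>R i)"
  proof (rule flat_normal_lift)
    show "lam (br Y1 Y2) = w' Y1 *\<^sub>R lam Y2 - w' Y2 *\<^sub>R lam Y1" for Y1 Y2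
      by (rule eqI) (simp add: inner_simps li w')
    show "w' (br Y1 Y2) *\<^sub>R x = w' Y1 *\<^sub>R w' Y2 *\<^sub>R x - w' Y2 *\<^sub>R w' Y1 *\<^sub>R x +
      S (Z Y2 *\<^sub>R i) (lam Y1) x - S (Z Y1 *\<^sub>R i) (lam Y2) x" for Y1 Y2 x
      by (rule eqI) (simp add: S_def b inner_simps li w' i algebra_simps)
    show "Z (br Y1 Y2) *\<^sub>R i = (2 * w' Y2) *\<^sub>R Z Y1 *\<^sub>R i - w' Y2 *\<^sub>R Z Y1 *\<^sub>R i -
      (2 * w' Y1) *\<^sub>R Z Y2 *\<^sub>R i + w' Y1 *\<^sub>R Z Y2 *\<^sub>R i" for Y1 Y2
      by (rule eqI) (simp add: inner_simps w' i algebra_simps)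
    show "conformal_with (w' Y) ((*\<^sub>R) (w' Y))" for Y
      by (simp add: conformal_with_def)
  qed (auto intro!: linearI simp: linear_add[OF w'(1)] linear_cmul[OF w'(1)] linear_add[OF w'(2)] linear_cmul[OF w'(2)] algebra_simps)
  then show ?thesis by blast
qed

section \<open>Two dimensions: complex lines and pairs of null lines\<close>

context
  fixes i j :: 'v
  assumes B: "Basis = {i, j}" and ij: "i \<noteq> j"
begin

lemma basis2: "i \<bullet> i = 1" "j \<bullet> j = 1" "i \<bullet> j = 0" "j \<bullet> i = 0"
  using inner_not_same_Basis[of i j] inner_not_same_Basis[of j i]
    inner_same_Basis[of i] inner_same_Basis[of j] ij unfolding B by auto

lemma eqI2: "x \<bullet> i = y \<bullet> i \<Longrightarrow> x \<bullet> j = y \<bullet> j \<Longrightarrow> x = y"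
  by (rule euclidean_eqI) (use B in auto)

lemma rep2: "x = (x \<bullet> i) *\<^sub>R i + (x \<bullet> j) *\<^sub>R j"
  by (rule eqI2) (simp_all add: inner_simps basis2)

lemma apply2: "linear f \<Longrightarrow> f x = (x \<bullet> i) *\<^sub>R f i + (x \<bullet> j) *\<^sub>R f j"
  by (metis rep2 linear_add linear_cmul)

lemma normal_lift_2_definite:
  assumes N: "N i = i" "N j = j"
  shows "\<exists>\<omega> \<tau> \<zeta>. normal_lift \<omega> \<tau> \<zeta>"
proof -
  obtain \<omega> :: "'l \<Rightarrow> 'v \<Rightarrow> 'v" and \<tau> :: "'l \<Rightarrow> real"
    where c: "\<And>Y. linear (\<omega> Y)" "\<And>x. linear (\<lambda>Y. \<omega> Y x)"
      "\<And>Y1 Y2. lam (br Y1 Y2) = \<omega> Y1 (lam Y2) - \<omega> Y2 (lam Y1)"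
      "\<And>Y. conformal_with (\<tau> Y) (\<omega> Y)"
    using torsion_free_connection by metis
  have Nx: "N x = x" for x using apply2[OF linear_N, of x] rep2[of x] N by simp
  have b: "b x y = (x \<bullet> i) * (y \<bullet> i) + (x \<bullet> j) * (y \<bullet> j)" for x y
    unfolding b_def Nx by (subst rep2[of x]) (simp add: inner_simps inner_commute)
  define l where "l Y = Complex (lam Y \<bullet> i) (lam Y \<bullet> j)" for Y
  define w where "w Y = Complex (\<omega> Y i \<bullet> i) (\<omega> Y i \<bullet> j)" for Y
  \<comment> \<open>Conformality for the Euclidean form makes \<omega> Y multiplication by the
    complex number \<open>w Y\<close>; so \<open>l\<close> is a complex functional of the kind
    treated above.\<close>
  have \<omega>j: "\<omega> Y j \<bullet> j = \<omega> Y i \<bullet> i" "\<omega> Y j \<bullet> i = - (\<omega> Y i \<bullet> j)" for Y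
    using conformal_withD[OF c(4), of Y i i] conformal_withD[OF c(4), of Y j j] conformal_withD[OF c(4), of Y i j]
    by (simp_all add: b basis2)
  have \<omega>x: "\<omega> Y x \<bullet> i = Re (w Y) * (x \<bullet> i) - Im (w Y) * (x \<bullet> j)"
    "\<omega> Y x \<bullet> j = Im (w Y) * (x \<bullet> i) + Re (w Y) * (x \<bullet> j)" for Y x
    by (subst apply2[OF c(1)]; simp add: inner_simps w_def \<omega>j)+
  have l: "linear l" unfolding l_def by (intro linearI) (simp_all add: lam_simps inner_simps complex_eq_iff)
  obtain v where "lam v = i" using surj_lam by (metis surjD)
  then have v: "l v \<noteq> 0" using basis2 by (simp add: l_def complex_eq_iff)
  have lw: "l (br x y) = w x * l y - w y * l x" for x y
    by (simp add: l_def c(3) inner_simps \<omega>x complex_eq_iff)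
  obtain w' Z where w': "linear w'" "linear Z" "\<And>x y. l (br x y) = w' x * l y - w' y * l x"
    "\<And>x y. w' (br x y) = l x * Z y - l y * Z x" "\<And>x y. Z (br x y) = Z x * w' y - Z y * w' x"
    using complex_projective_structure[OF bilinear_br br_skew jacobi l v lw] by blast
  have li: "lam Y \<bullet> i = Re (l Y)" "lam Y \<bullet> j = Im (l Y)" for Y by (simp_all add: l_def)
  define \<omega>' where "\<omega>' Y x = (Re (w' Y) * (x \<bullet> i) - Im (w' Y) * (x \<bullet> j)) *\<^sub>R i
    + (Im (w' Y) * (x \<bullet> i) + Re (w' Y) * (x \<bullet> j)) *\<^sub>R j" for Y x
  \<comment> \<open>The complex conjugate of \<open>Z\<close>: in the Euclidean plane
    \<open>S z x y\<close> is the product of x, y and the conjugate of z.\<close>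
  define \<zeta> where "\<zeta> Y = Re (Z Y) *\<^sub>R i - Im (Z Y) *\<^sub>R j" for Y
  have comp: "\<omega>' Y x \<bullet> i = Re (w' Y) * (x \<bullet> i) - Im (w' Y) * (x \<bullet> j)"
    "\<omega>' Y x \<bullet> j = Im (w' Y) * (x \<bullet> i) + Re (w' Y) * (x \<bullet> j)"
    "\<zeta> Y \<bullet> i = Re (Z Y)" "\<zeta> Y \<bullet> j = - Im (Z Y)" for Y x
    by (simp_all add: \<omega>'_def \<zeta>_def inner_simps basis2)
  note w'l = linear_add[OF w'(1)] linear_cmul[OF w'(1)] linear_add[OF w'(2)] linear_cmul[OF w'(2)]
  have "normal_lift \<omega>' (\<lambda>Y. Re (w' Y)) \<zeta>"
  proof (rule flat_normal_lift)
    show "linear (\<omega>' Y)" "linear (\<lambda>Y. \<omega>' Y x)" "linear \<zeta>" "linear (\<lambda>Y. Re (w' Y))" for Y x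
      by (intro linearI eqI2; simp add: comp inner_simps w'l algebra_simps)+
    show "conformal_with (Re (w' Y)) (\<omega>' Y)" for Y
      by (simp add: conformal_with_def b comp algebra_simps)
    show "lam (br Y1 Y2) = \<omega>' Y1 (lam Y2) - \<omega>' Y2 (lam Y1)" for Y1 Y2
      by (rule eqI2; simp add: inner_simps comp li w')
    show "\<omega>' (br Y1 Y2) x = \<omega>' Y1 (\<omega>' Y2 x) - \<omega>' Y2 (\<omega>' Y1 x) +
      S (\<zeta> Y2) (lam Y1) x - S (\<zeta> Y1) (lam Y2) x" for Y1 Y2 x
      by (rule eqI2; simp add: S_def b inner_simps comp li w'; simp add: algebra_simps)
    show "\<zeta> (br Y1 Y2) = (2 * Re (w' Y2)) *\<^sub>R \<zeta> Y1 - \<omega>' Y2 (\<zeta> Y1) - (2 * Re (w' Y1)) *\<^sub>R \<zeta> Y2 + \<omega>' Y1 (\<zeta> Y2)" for Y1 Y2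
      by (rule eqI2; simp add: inner_simps comp w'; simp add: algebra_simps)
  qed
  then show ?thesis by blast
qed

lemma normal_lift_2_split:
  assumes N: "N i = j" "N j = i"
  shows "\<exists>\<omega> \<tau> \<zeta>. normal_lift \<omega> \<tau> \<zeta>"
proof -
  obtain \<omega> :: "'l \<Rightarrow> 'v \<Rightarrow> 'v" and \<tau> :: "'l \<Rightarrow> real"
    where c: "\<And>Y. linear (\<omega> Y)" "\<And>x. linear (\<lambda>Y. \<omega> Y x)"
      "\<And>Y1 Y2. lam (br Y1 Y2) = \<omega> Y1 (lam Y2) - \<omega> Y2 (lam Y1)"
      "\<And>Y. conformal_with (\<tau> Y) (\<omega> Y)"
    using torsion_free_connection by metis
  have b: "b x y = (x \<bullet> i) * (y \<bullet> j) + (x \<bullet> j) * (y \<bullet> i)" for x y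
    unfolding b_def by (subst apply2[OF linear_N, of y], subst rep2[of x]) (simp add: inner_simps basis2 N)
  \<comment> \<open>i and j are null, and a conformal map preserves both null lines. Hence each
    coordinate of \<open>lam\<close> is the functional of an action on a real line.\<close>
  have \<omega>0: "\<omega> Y i \<bullet> j = 0" "\<omega> Y j \<bullet> i = 0" for Y
    using conformal_withD[OF c(4), of Y i i] conformal_withD[OF c(4), of Y j j]
    by (simp_all add: b basis2)
  define w0 where "w0 Y = \<omega> Y i \<bullet> i" for Y
  define w1 where "w1 Y = \<omega> Y j \<bullet> j" for Y
  define l0 where "l0 Y = lam Y \<bullet> i" for Y
  define l1 where "l1 Y = lam Y \<bullet> j" for Y
  have \<omega>x: "\<omega> Y x \<bullet> i = w0 Y * (x \<bullet> i)" "\<omega> Y x \<bullet> j = w1 Y * (x \<bullet> j)" for Y x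
    by (subst apply2[OF c(1)]; simp add: inner_simps w0_def w1_def \<omega>0)+
  have l: "linear l0" "linear l1"
    unfolding l0_def l1_def by (intro linearI; simp add: lam_simps inner_simps)+
  obtain v0 v1 where "lam v0 = i" "lam v1 = j" using surj_lam by (metis surjD)
  then have v: "l0 v0 \<noteq> 0" "l1 v1 \<noteq> 0" using basis2 by (simp_all add: l0_def l1_def)
  have lw: "l0 (br x y) = w0 x * l0 y - w0 y * l0 x" "l1 (br x y) = w1 x * l1 y - w1 y * l1 x" for x y
    by (simp_all add: l0_def l1_def c(3) inner_simps \<omega>x)
  obtain w0' Z0 where w0': "linear w0'" "linear Z0" "\<And>x y. l0 (br x y) = w0' x * l0 y - w0' y * l0 x"
    "\<And>x y. w0' (br x y) = l0 x * Z0 y - l0 y * Z0 x" "\<And>x y. Z0 (br x y) = Z0 x * w0' y - Z0 y * w0' x"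
    using real_projective_structure[OF bilinear_br br_skew jacobi l(1) v(1) lw(1)] by blast
  obtain w1' Z1 where w1': "linear w1'" "linear Z1" "\<And>x y. l1 (br x y) = w1' x * l1 y - w1' y * l1 x"
    "\<And>x y. w1' (br x y) = l1 x * Z1 y - l1 y * Z1 x" "\<And>x y. Z1 (br x y) = Z1 x * w1' y - Z1 y * w1' x"
    using real_projective_structure[OF bilinear_br br_skew jacobi l(2) v(2) lw(2)] by blast
  have li: "lam Y \<bullet> i = l0 Y" "lam Y \<bullet> j = l1 Y" for Y by (simp_all add: l0_def l1_def)
  define \<omega>' where "\<omega>' Y x = (w0' Y * (x \<bullet> i)) *\<^sub>R i + (w1' Y * (x \<bullet> j)) *\<^sub>R j" for Y x
  \<comment> \<open>As \<open>b\<close> pairs i with j, \<open>S z i i\<close> is twice the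
    j-coordinate of z times i: this explains both the exchange of \<open>Z0\<close> and
    \<open>Z1\<close> and the halves.\<close>
  define \<zeta> where "\<zeta> Y = (Z1 Y / 2) *\<^sub>R i + (Z0 Y / 2) *\<^sub>R j" for Y
  define \<tau>' where "\<tau>' Y = (w0' Y + w1' Y) / 2" for Y
  have comp: "\<omega>' Y x \<bullet> i = w0' Y * (x \<bullet> i)" "\<omega>' Y x \<bullet> j = w1' Y * (x \<bullet> j)"
    "\<zeta> Y \<bullet> i = Z1 Y / 2" "\<zeta> Y \<bullet> j = Z0 Y / 2" for Y x
    by (simp_all add: \<omega>'_def \<zeta>_def inner_simps basis2)
  note w'l = linear_add[OF w0'(1)] linear_cmul[OF w0'(1)] linear_add[OF w0'(2)] linear_cmul[OF w0'(2)]
    linear_add[OF w1'(1)] linear_cmul[OF w1'(1)] linear_add[OF w1'(2)] linear_cmul[OF w1'(2)]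
  have "normal_lift \<omega>' \<tau>' \<zeta>"
  proof (rule flat_normal_lift)
    show "linear (\<omega>' Y)" "linear (\<lambda>Y. \<omega>' Y x)" "linear \<zeta>" for Y x
      by (intro linearI eqI2; simp add: comp inner_simps w'l algebra_simps add_divide_distrib)+
    show "linear \<tau>'" by (intro linearI; simp add: \<tau>'_def w'l; simp add: field_simps)
    show "conformal_with (\<tau>' Y) (\<omega>' Y)" for Y
      by (simp add: conformal_with_def b comp \<tau>'_def algebra_simps)
    show "lam (br Y1 Y2) = \<omega>' Y1 (lam Y2) - \<omega>' Y2 (lam Y1)" for Y1 Y2
      by (rule eqI2; simp add: inner_simps comp li w0' w1')
    show "\<omega>' (br Y1 Y2) x = \<omega>' Y1 (\<omega>' Y2 x) - \<omega>' Y2 (\<omega>' Y1 x) +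
      S (\<zeta> Y2) (lam Y1) x - S (\<zeta> Y1) (lam Y2) x" for Y1 Y2 x
      by (rule eqI2; simp add: S_def b inner_simps comp li w0' w1'; simp add: field_simps)
    show "\<zeta> (br Y1 Y2) = (2 * \<tau>' Y2) *\<^sub>R \<zeta> Y1 - \<omega>' Y2 (\<zeta> Y1) - (2 * \<tau>' Y1) *\<^sub>R \<zeta> Y2 + \<omega>' Y1 (\<zeta> Y2)" for Y1 Y2
      by (rule eqI2; simp add: inner_simps comp w0' w1' \<tau>'_def; simp add: field_simps)
  qed
  then show ?thesis by blast
qed

end

end

section \<open>The matrices of so(p+1, q+1)\<close>

lemma pos_less: "i < j \<Longrightarrow> pos i < pos (j :: 'n::{finite, linorder})"
  unfolding pos_def by (rule psubset_card_mono) (auto intro: order.strict_trans)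

lemma inj_pos: "inj (pos :: 'n::{finite, linorder} \<Rightarrow> nat)"
  by (metis injI less_irrefl linorder_neqE pos_less)

lemma pos_less_card:
  fixes i :: "'n::{finite, linorder}"
  shows "pos i < CARD('n)"
  unfolding pos_def by (rule psubset_card_mono) auto

lemma pos_surj:
  assumes "k < card (UNIV :: 'n::{finite, linorder} set)"
  obtains i :: "'n::{finite, linorder}" where "pos i = k"
proof -
  have "pos ` (UNIV :: 'n set) = {..<CARD('n)}"
    by (rule card_subset_eq) (auto simp: pos_less_card card_image[OF inj_pos])
  then have "k \<in> pos ` (UNIV :: 'n set)" using assms by simp
  with that show ?thesis by blast
qed

text \<open>The involution exchanges the two outer blocks of indices and fixes the middle one.
  Identities with \<nu> thereby become reindexings of sums by \<sigma>.\<close>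

lemma nu_permutation:
  assumes dims: "p \<le> q" "card (UNIV :: 'n::{finite, linorder} set) = p + q"
  obtains \<sigma> :: "'n::{finite, linorder} \<Rightarrow> 'n::{finite, linorder}" where "\<And>i. \<sigma> (\<sigma> i) = i"
    "\<And>i j. (nu p q :: ((real, 'n::{finite, linorder}) vec, 'n::{finite, linorder}) vec) $ i $ j = (if j = \<sigma> i then 1 else 0)"
proof -
  define f where "f k = (if k < p then k + q else if k < q then k else k - q)" for k :: nat
  have f: "f k < p + q" "f (f k) = k" if "k < p + q" for k using that dims by (auto simp: f_def)
  have "\<exists>j :: 'n. pos j = f (pos (i :: 'n))" for i
    using pos_surj[of "f (pos i)"] f(1)[of "pos i"] pos_less_card[of i] dims by metis
  then obtain \<sigma> where \<sigma>: "\<And>i. pos (\<sigma> i :: 'n) = f (pos (i :: 'n))" by metis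
  have eq: "j = i \<longleftrightarrow> pos j = pos i" for i j :: 'n using inj_pos by (metis injD)
  have b: "pos i < p + q" for i :: 'n using pos_less_card[of i] dims by simp
  show ?thesis
  proof (rule that[of \<sigma>])
    show "\<sigma> (\<sigma> i) = i" for i using f(2)[OF b] by (simp add: eq \<sigma>)
    show "(nu p q :: ((real, 'n) vec, 'n) vec) $ i $ j = (if j = \<sigma> i then 1 else 0)" for i j
      using b[of i] b[of j] dims by (auto simp: nu_def eq \<sigma> f_def)
  qed
qed

lemma sum_block:
  fixes f :: "unit + 'n::finite + unit \<Rightarrow> 'b::comm_monoid_add"
  shows "(\<Sum>a\<in>UNIV. f a) = f (Inl ()) + ((\<Sum>k\<in>UNIV. f (Inr (Inl k))) + f (Inr (Inr ())))"
  by (simp add: UNIV_Plus_UNIV[symmetric] sum.Plus comp_def UNIV_unit)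

lemma sum_delta_if:
  "(\<Sum>j\<in>UNIV. (if j = i then 1 else 0) * f j) = (f i :: real)"
  "(\<Sum>j\<in>UNIV. f j * (if j = i then 1 else 0)) = f i" for i :: "'n::finite"
proof -
  have "(\<Sum>j\<in>UNIV. (if j = i then 1 else 0) * f j) = (\<Sum>j\<in>UNIV. if j = i then f j else 0)"
    by (rule sum.cong) auto
  then show "(\<Sum>j\<in>UNIV. (if j = i then 1 else 0) * f j) = f i" by simp
  have "(\<Sum>j\<in>UNIV. f j * (if j = i then 1 else 0)) = (\<Sum>j\<in>UNIV. if j = i then f j else 0)"
    by (rule sum.cong) auto
  then show "(\<Sum>j\<in>UNIV. f j * (if j = i then 1 else 0)) = f i" by simp
qed

text \<open>The basis inside \<open>trace_on\<close> is an arbitrary choice; composing with a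
  projection onto L replaces it by a trace over the standard basis of the ambient space.\<close>

lemma trace_on_projection:
  fixes f P :: "'v::euclidean_space \<Rightarrow> 'v"
  assumes L: "subspace L" and P: "linear P" "\<And>x. P x \<in> L" "\<And>x. x \<in> L \<Longrightarrow> P x = x"
    and f: "linear f" "\<And>x. x \<in> L \<Longrightarrow> f x \<in> L"
  shows "trace_on L f = (\<Sum>b\<in>Basis. f (P b) \<bullet> b)"
proof -
  define B where "B = (SOME B. independent B \<and> span B = L)"
  have "\<exists>B. independent B \<and> span B = L"
    using basis_exists[of L] span_subspace[OF _ _ L] by metis
  then have B: "independent B" "span B = L"
    unfolding B_def by (metis (mono_tags, lifting) someI_ex)+
  have fin: "finite B" using B(1) by (rule independent_imp_finite)
  have lin: "linear (\<lambda>x. representation B (P x) c)" for c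
    using P(2) by (intro linearI)
      (simp_all add: linear_add[OF P(1)] linear_cmul[OF P(1)] representation_add[OF B(1)] representation_scale[OF B(1)] B(2))
  have "(\<Sum>b\<in>Basis. f (P b) \<bullet> b) = (\<Sum>b\<in>Basis. \<Sum>c\<in>B. representation B (P b) c * (f c \<bullet> b))"
  proof (rule sum.cong[OF refl])
    fix b
    have "P b = (\<Sum>c\<in>B. representation B (P b) c *\<^sub>R c)"
      using sum_representation_eq[OF B(1) _ fin order_refl, of "P b"] P(2) B(2) by simp
    then have "f (P b) = (\<Sum>c\<in>B. representation B (P b) c *\<^sub>R f c)"
      using linear_sum[OF f(1)] linear_cmul[OF f(1)] by (metis (mono_tags, lifting) sum.cong)
    then show "f (P b) \<bullet> b = (\<Sum>c\<in>B. representation B (P b) c * (f c \<bullet> b))"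
      by (simp add: inner_sum_left)
  qed
  also have "\<dots> = (\<Sum>c\<in>B. \<Sum>b\<in>Basis. representation B (P b) c * (f c \<bullet> b))" by (rule sum.swap)
  also have "\<dots> = (\<Sum>c\<in>B. representation B (f c) c)"
  proof (rule sum.cong[OF refl])
    fix c assume "c \<in> B"
    then have fc: "P (f c) = f c" using f(2) P(3) B(2) span_base by blast
    have "representation B (P (\<Sum>b\<in>Basis. (f c \<bullet> b) *\<^sub>R b)) c = (\<Sum>b\<in>Basis. (f c \<bullet> b) * representation B (P b) c)"
      by (simp add: linear_sum[OF lin] linear_cmul[OF lin])
    then show "(\<Sum>b\<in>Basis. representation B (P b) c * (f c \<bullet> b)) = representation B (f c) c"
      by (simp add: euclidean_representation fc mult.commute)
  qed
  finally show ?thesis by (simp add: trace_on_def B_def Let_def)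
qed

lemma sum_Basis_matrix:
  fixes f :: "real ^ 'i ^ 'i \<Rightarrow> real ^ 'i ^ 'i"
  shows "(\<Sum>b\<in>Basis. f b \<bullet> b) = (\<Sum>a\<in>UNIV. \<Sum>b\<in>UNIV. f (axis a (axis b 1)) $ a $ (b :: 'i::finite))"
proof -
  have inj: "inj (\<lambda>(a, b). axis a (axis b (1::real)) :: real ^ 'i ^ 'i)"
  proof (rule injI, clarify)
    fix a b a' b' :: 'i assume "axis a (axis b (1::real)) = (axis a' (axis b' 1) :: real ^ 'i ^ 'i)"
    then show "a = a' \<and> b = b'" by (simp add: axis_eq_axis)
  qed
  have BE: "(Basis :: (real ^ 'i ^ 'i) set) = (\<lambda>(a, b). axis a (axis b 1)) ` UNIV"
    unfolding Basis_vec_def by auto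
  have "(\<Sum>b\<in>Basis. f b \<bullet> b) = (\<Sum>(a, b)\<in>UNIV. f (axis a (axis b 1)) \<bullet> axis a (axis b 1))"
    unfolding BE sum.reindex[OF inj] by (simp add: case_prod_beta comp_def)
  also have "\<dots> = (\<Sum>a\<in>UNIV. \<Sum>b\<in>UNIV. f (axis a (axis b 1)) \<bullet> axis a (axis b 1))"
    by (simp add: sum.cartesian_product UNIV_Times_UNIV[symmetric] del: UNIV_Times_UNIV)
  finally show ?thesis by (simp add: inner_axis)
qed

lemma bilinear_matrix_mult: "bilinear (\<lambda>(X :: real ^ 'i ^ 'i) Y. X ** (Y :: real ^ 'i ^ ('i::finite)))"
  unfolding bilinear_def
  by (auto intro!: linearI simp: vec_eq_iff matrix_matrix_mult_def algebra_simps sum.distrib sum_distrib_left)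

lemmas matrix_mult_simps = bilinear_ladd[OF bilinear_matrix_mult] bilinear_radd[OF bilinear_matrix_mult]
  bilinear_lsub[OF bilinear_matrix_mult] bilinear_rsub[OF bilinear_matrix_mult]
  bilinear_lmul[OF bilinear_matrix_mult] bilinear_rmul[OF bilinear_matrix_mult]

lemma bilinear_mat_bracket: "bilinear (mat_bracket :: real ^ 'i ^ 'i \<Rightarrow> _)"
  unfolding bilinear_def mat_bracket_def[abs_def]
  by (auto intro!: linearI simp: matrix_mult_simps algebra_simps)

lemma conf_mat_nth:
  "conf_mat p q a x z A $ Inl u $ Inl u' = a"
  "conf_mat p q a x z A $ Inl u $ Inr (Inl l) = z $ l"
  "conf_mat p q a x z A $ Inl u $ Inr (Inr u') = 0"
  "conf_mat p q a x z A $ Inr (Inl k) $ Inl u = x $ k"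
  "conf_mat p q a x z A $ Inr (Inl k) $ Inr (Inl l) = A $ k $ l"
  "conf_mat p q a x z A $ Inr (Inl k) $ Inr (Inr u) = - (nu p q *v z) $ k"
  "conf_mat p q a x z A $ Inr (Inr u) $ Inl u' = 0"
  "conf_mat p q a x z A $ Inr (Inr u) $ Inr (Inl l) = - (x v* nu p q) $ l"
  "conf_mat p q a x z A $ Inr (Inr u) $ Inr (Inr u') = - a"
  by (simp_all add: conf_mat_def block_mat_def)

locale nu_involution =
  fixes p q :: nat and \<sigma> :: "'n::{finite, linorder} \<Rightarrow> 'n::{finite, linorder}"
  assumes \<sigma>_\<sigma> [simp]: "\<sigma> (\<sigma> i) = i"
    and nu_nth: "(nu p q :: ((real, 'n) vec, 'n) vec) $ i $ j = (if j = \<sigma> i then 1 else 0)"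
begin

lemma \<sigma>_eq: "j = \<sigma> i \<longleftrightarrow> i = \<sigma> j"
  by (metis \<sigma>_\<sigma>)

lemma bij_\<sigma>: "bij \<sigma>"
  by (metis \<sigma>_\<sigma> bijI')

lemma sum_\<sigma>: "(\<Sum>i\<in>UNIV. f (\<sigma> i)) = (\<Sum>i\<in>UNIV. f i)"
  using sum.reindex_bij_betw[OF bij_\<sigma>] .

lemma nu_mult: "(nu p q *v (x :: (real, 'n) vec)) $ i = x $ \<sigma> i"
  by (simp add: matrix_vector_mult_def nu_nth sum_delta_if)

lemma mult_nu: "((x :: (real, 'n) vec) v* nu p q) $ i = x $ \<sigma> i"
  by (simp add: vector_matrix_mult_def nu_nth \<sigma>_eq[of i] sum_delta_if)

lemma nu_nu: "nu p q *v (nu p q *v (x :: (real, 'n) vec)) = x"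
  by (simp add: vec_eq_iff nu_mult)

lemma nu_sym: "(nu p q *v (x :: (real, 'n) vec)) \<bullet> y = x \<bullet> (nu p q *v y)"
  using sum_\<sigma>[of "\<lambda>i. x $ i * y $ \<sigma> i"] by (simp add: inner_vec_def nu_mult)

lemma nu_axis: "nu p q *v axis i (1::real) = axis (\<sigma> i) 1"
  by (auto simp: vec_eq_iff nu_mult axis_def \<sigma>_eq)

lemma so_nu_iff: "A \<in> so_nu p q \<longleftrightarrow> (\<forall>i j. (A :: ((real, 'n) vec, 'n) vec) $ i $ j = - A $ \<sigma> j $ \<sigma> i)"
proof -
  have "(transpose A ** nu p q + nu p q ** A) $ i $ j = A $ \<sigma> j $ i + A $ \<sigma> i $ j" for i j
    by (simp add: matrix_matrix_mult_def transpose_def nu_nth \<sigma>_eq[of j] sum_delta_if)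
  then have "A \<in> so_nu p q \<longleftrightarrow> (\<forall>i j. A $ \<sigma> j $ i + A $ \<sigma> i $ j = 0)"
    by (simp add: so_nu_def vec_eq_iff)
  also have "\<dots> \<longleftrightarrow> (\<forall>i j. A $ i $ j = - A $ \<sigma> j $ \<sigma> i)"
  proof (intro iffI allI)
    fix i j assume "\<forall>i j. A $ \<sigma> j $ i + A $ \<sigma> i $ j = 0"
    from this[rule_format, of "\<sigma> i" j, unfolded \<sigma>_\<sigma>]
    show "A $ i $ j = - A $ \<sigma> j $ \<sigma> i" by linarith
  next
    fix i j assume "\<forall>i j. A $ i $ j = - A $ \<sigma> j $ \<sigma> i"
    then have "A $ \<sigma> i $ j = - A $ \<sigma> j $ \<sigma> (\<sigma> i)" by blast
    then show "A $ \<sigma> j $ i + A $ \<sigma> i $ j = 0" unfolding \<sigma>_\<sigma> by linarith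
  qed
  finally show ?thesis .
qed

text \<open>The permutation whose matrix is the form of signature (p + 1, q + 1) on the larger
  space; so(p + 1, q + 1) consists of the matrices equal to minus their adjoint for it.\<close>

definition flip :: "unit + 'n + unit \<Rightarrow> unit + 'n + unit" where
  "flip a = (case a of Inl _ \<Rightarrow> Inr (Inr ()) | Inr (Inl k) \<Rightarrow> Inr (Inl (\<sigma> k)) | Inr (Inr _) \<Rightarrow> Inl ())"

lemma flip_simps [simp]:
  "flip (Inl u) = Inr (Inr ())" "flip (Inr (Inl k)) = Inr (Inl (\<sigma> k))" "flip (Inr (Inr u)) = Inl ()"
  by (simp_all add: flip_def)

lemma flip_flip [simp]: "flip (flip a) = a"
  by (cases a rule: sum.exhaust; simp) (metis flip_simps \<sigma>_\<sigma> old.unit.exhaust sum.exhaust)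

lemma flip_eq: "a = flip b \<longleftrightarrow> b = flip a"
  by (metis flip_flip)

lemma sum_flip: "(\<Sum>a\<in>UNIV. f (flip a)) = (\<Sum>a\<in>UNIV. f a)"
  by (rule sum.reindex_bij_betw) (metis flip_flip bijI')

lemma all_block: "(\<forall>a. Q a) \<longleftrightarrow> Q (Inl ()) \<and> (\<forall>k. Q (Inr (Inl k))) \<and> Q (Inr (Inr ()))"
  by (metis old.unit.exhaust sum.exhaust)

lemma so_conf_iff: "W \<in> so_conf p q \<longleftrightarrow> (\<forall>a b. (W :: 'n bmat) $ a $ b = - W $ flip b $ flip a)"
proof
  assume "W \<in> so_conf p q"
  then obtain a x z A where W: "W = conf_mat p q a x z A" "A \<in> so_nu p q" unfolding so_conf_def by blast
  have "\<forall>k l. A $ k $ l = - A $ \<sigma> l $ \<sigma> k" using W(2)[unfolded so_nu_iff] .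
  then show "\<forall>a b. W $ a $ b = - W $ flip b $ flip a"
    unfolding W(1) all_block flip_simps conf_mat_nth vector_uminus_component nu_mult mult_nu \<sigma>_\<sigma>
      minus_minus minus_zero by blast
next
  assume W: "\<forall>a b. W $ a $ b = - W $ flip b $ flip a"
  define A where "A = (\<chi> k l. W $ Inr (Inl k) $ Inr (Inl l))"
  have e: "W $ Inr (Inr ()) $ Inr (Inr ()) = - W $ Inl () $ Inl ()"
    "W $ Inl () $ Inr (Inr ()) = 0" "W $ Inr (Inr ()) $ Inl () = 0"
    "W $ Inr (Inl k) $ Inr (Inr ()) = - W $ Inl () $ Inr (Inl (\<sigma> k))"
    "W $ Inr (Inr ()) $ Inr (Inl k) = - W $ Inr (Inl (\<sigma> k)) $ Inl ()" for k
    using W[rule_format, of "Inr (Inr ())" "Inr (Inr ())"] W[rule_format, of "Inl ()" "Inr (Inr ())"]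
      W[rule_format, of "Inr (Inr ())" "Inl ()"] W[rule_format, of "Inr (Inl k)" "Inr (Inr ())"]
      W[rule_format, of "Inr (Inr ())" "Inr (Inl k)"] unfolding flip_simps by linarith+
  have "W = conf_mat p q (W $ Inl () $ Inl ()) (\<chi> k. W $ Inr (Inl k) $ Inl ()) (\<chi> k. W $ Inl () $ Inr (Inl k)) A"
    unfolding vec_eq_iff all_block conf_mat_nth by (simp add: A_def nu_mult mult_nu e)
  moreover have "A \<in> so_nu p q"
    unfolding so_nu_iff
  proof (intro allI)
    fix k l
    have "W $ Inr (Inl k) $ Inr (Inl l) = - W $ flip (Inr (Inl l)) $ flip (Inr (Inl k))" using W by blast
    then show "A $ k $ l = - A $ \<sigma> l $ \<sigma> k" unfolding A_def flip_simps by (simp only: vec_lambda_beta)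
  qed
  ultimately show "W \<in> so_conf p q" unfolding so_conf_def by blast
qed

lemma so_conf_eqI:
  fixes W W' :: "'n bmat"
  assumes W: "W \<in> so_conf p q" "W' \<in> so_conf p q"
    and "W $ Inl () $ Inl () = W' $ Inl () $ Inl ()"
    and "\<And>k. W $ Inl () $ Inr (Inl k) = W' $ Inl () $ Inr (Inl k)"
    and "\<And>k. W $ Inr (Inl k) $ Inl () = W' $ Inr (Inl k) $ Inl ()"
    and "\<And>k l. W $ Inr (Inl k) $ Inr (Inl l) = W' $ Inr (Inl k) $ Inr (Inl l)"
  shows "W = W'"
proof -
  obtain a x z A where 1: "W = conf_mat p q a x z A" using W unfolding so_conf_def by blast
  obtain a' x' z' A' where 2: "W' = conf_mat p q a' x' z' A'" using W unfolding so_conf_def by blast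
  have "a = a'" "x = x'" "z = z'" "A = A'"
    using assms(3-) by (simp_all add: 1 2 conf_mat_nth vec_eq_iff)
  then show ?thesis by (simp add: 1 2)
qed

lemma subspace_so_conf: "subspace (so_conf p q :: 'n bmat set)"
proof (rule subspaceI)
  show "0 \<in> (so_conf p q :: 'n bmat set)" by (simp add: so_conf_iff)
next
  fix X Y :: "'n bmat" assume "X \<in> so_conf p q" "Y \<in> so_conf p q"
  then have "X $ a $ b = - X $ flip b $ flip a" "Y $ a $ b = - Y $ flip b $ flip a" for a b
    unfolding so_conf_iff by blast+
  then show "X + Y \<in> so_conf p q"
    unfolding so_conf_iff vector_add_component by (metis minus_add_distrib)
next
  fix r :: real and X :: "'n bmat" assume "X \<in> so_conf p q"
  then have "X $ a $ b = - X $ flip b $ flip a" for a b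
    unfolding so_conf_iff by blast
  then show "r *\<^sub>R X \<in> so_conf p q"
    unfolding so_conf_iff vector_scaleR_component by (metis scaleR_minus_right)
qed

text \<open>The adjoint with respect to \<open>flip\<close> reverses products, so the matrices equal
  to minus their adjoint are closed under commutators.\<close>

lemma mat_bracket_so_conf:
  assumes X: "X \<in> so_conf p q" and Y: "Y \<in> so_conf p q"
  shows "mat_bracket X Y \<in> (so_conf p q :: 'n bmat set)"
proof -
  have *: "(X ** Y) $ flip b $ flip a = (Y ** X) $ a $ b"
    if X: "X \<in> so_conf p q" and Y: "Y \<in> so_conf p q" for X Y :: "'n bmat" and a b
  proof -
    have "(X ** Y) $ flip b $ flip a = (\<Sum>c\<in>UNIV. X $ flip b $ flip c * Y $ flip c $ flip a)"
      unfolding matrix_matrix_mult_def by (simp add: sum_flip[of "\<lambda>c. X $ flip b $ c * Y $ c $ flip a"])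
    also have "\<dots> = (\<Sum>c\<in>UNIV. Y $ a $ c * X $ c $ b)"
    proof (rule sum.cong[OF refl])
      fix c
      have "X $ c $ b = - X $ flip b $ flip c" "Y $ a $ c = - Y $ flip c $ flip a"
        using X Y unfolding so_conf_iff by blast+
      then show "X $ flip b $ flip c * Y $ flip c $ flip a = Y $ a $ c * X $ c $ b" by simp
    qed
    finally show ?thesis by (simp add: matrix_matrix_mult_def)
  qed
  show ?thesis
    unfolding so_conf_iff mat_bracket_def by (simp add: *[OF X Y] *[OF Y X])
qed

section \<open>The Killing form of so(p+1, q+1)\<close>

definition "proj W = (\<chi> a b. ((W :: 'n bmat) $ a $ b - W $ flip b $ flip a) / 2)"

lemma proj: "linear proj" "proj W \<in> so_conf p q" "W \<in> so_conf p q \<Longrightarrow> proj W = W"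
proof -
  show "linear proj"
    by (intro linearI) (simp_all add: proj_def vec_eq_iff field_simps)
  show "proj W \<in> so_conf p q"
    unfolding so_conf_iff by (simp add: proj_def diff_divide_distrib)
  assume "W \<in> so_conf p q"
  then have *: "W $ flip b $ flip a = - W $ a $ b" for a b unfolding so_conf_iff by (metis minus_minus)
  show "proj W = W" unfolding proj_def vec_eq_iff vec_lambda_beta * by simp
qed

text \<open>The trace of \<open>W\<close> \<mapsto> \<open>M ** proj W ** M'\<close>: the identity
  half of \<open>proj\<close> gives the product of the traces, the adjoint half the twisted
  sum.\<close>

lemma trace_mult_proj:
  fixes M M' :: "'n bmat"
  shows "(\<Sum>a\<in>UNIV. \<Sum>b\<in>UNIV. (M ** proj (axis a (axis b 1)) ** M') $ a $ b) =
    ((\<Sum>a\<in>UNIV. M $ a $ a) * (\<Sum>a\<in>UNIV. M' $ a $ a) - (\<Sum>a\<in>UNIV. \<Sum>b\<in>UNIV. M $ a $ flip b * M' $ flip a $ b)) / 2"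
proof -
  have p: "proj (axis a (axis b 1)) $ c $ d = ((if c = a then 1 else 0) * (if d = b then 1 else 0)
      - (if c = flip b then 1 else 0) * (if d = flip a then 1 else 0)) / 2" for a b c d
    by (auto simp: proj_def axis_def flip_eq)
  have d: "(\<Sum>c\<in>UNIV. \<Sum>d\<in>UNIV. x c * ((if c = a then 1 else 0) * (if d = b then 1 else 0)) * y d) = x a * (y b :: real)"
    for a b :: "unit + 'n + unit" and x y
  proof -
    have "(\<Sum>c\<in>UNIV. \<Sum>d\<in>UNIV. x c * ((if c = a then 1 else 0) * (if d = b then 1 else 0)) * y d)
      = (\<Sum>c\<in>UNIV. \<Sum>d\<in>UNIV. (x c * (if c = a then 1 else 0)) * ((if d = b then 1 else 0) * y d))"
      by (simp add: mult_ac)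
    also have "\<dots> = (\<Sum>c\<in>UNIV. x c * (if c = a then 1 else 0)) * (\<Sum>d\<in>UNIV. (if d = b then 1 else 0) * y d)"
      by (simp only: sum_product)
    finally show ?thesis by (simp only: sum_delta_if)
  qed
  have entry: "(M ** proj (axis a (axis b 1)) ** M') $ a $ b = (M $ a $ a * M' $ b $ b - M $ a $ flip b * M' $ flip a $ b) / 2" for a b
  proof -
    have "(M ** proj (axis a (axis b 1)) ** M') $ a $ b
      = (\<Sum>c\<in>UNIV. \<Sum>d\<in>UNIV. M $ a $ c * proj (axis a (axis b 1)) $ c $ d * M' $ d $ b)"
      unfolding matrix_matrix_mult_def by (simp add: sum_distrib_right) (rule sum.swap)
    also have "\<dots> = (\<Sum>c\<in>UNIV. \<Sum>d\<in>UNIV.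
        (M $ a $ c * ((if c = a then 1 else 0) * (if d = b then 1 else 0)) * M' $ d $ b
         - M $ a $ c * ((if c = flip b then 1 else 0) * (if d = flip a then 1 else 0)) * M' $ d $ b) / 2)"
    proof -
      have "x * ((y - z) / 2) * w = (x * y * w - x * z * w) / (2::real)" for x y z w by (simp add: field_simps)
      then show ?thesis unfolding p by (simp only:)
    qed
    finally show ?thesis
      by (simp only: sum_divide_distrib[symmetric] sum_subtractf d)
  qed
  show ?thesis
    unfolding entry by (simp only: sum_divide_distrib[symmetric] sum_subtractf sum_product)
qed

text \<open>Of the four terms of the double commutator, the outer two contribute (n + 1) t together,
  as the unit matrix has trace n + 2. The inner two contribute - t, since elements of the algebra
  have trace zero. The sum is n t.\<close>

lemma killing_form_so_conf:
  fixes X Z :: "'n bmat"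
  assumes X: "X \<in> so_conf p q" and Z: "Z \<in> so_conf p q"
  shows "killing_form (so_conf p q) Z X = real CARD('n) * (\<Sum>a\<in>UNIV. \<Sum>b\<in>UNIV. Z $ a $ b * X $ b $ a)"
proof -
  define t where "t = (\<Sum>a\<in>UNIV. \<Sum>b\<in>UNIV. Z $ a $ b * X $ b $ a)"
  define f where "f W = mat_bracket Z (mat_bracket X W)" for W
  have f_eq: "f W = (Z ** X) ** W ** mat 1 - Z ** W ** X - X ** W ** Z + mat 1 ** W ** (X ** Z)" for W
    by (simp add: f_def mat_bracket_def matrix_mul_assoc matrix_mult_simps)
  have f: "linear f"
    by (intro linearI) (simp_all add: f_def bilinear_radd[OF bilinear_mat_bracket] bilinear_rmul[OF bilinear_mat_bracket])
  have fL: "f W \<in> so_conf p q" if "W \<in> so_conf p q" for W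
    unfolding f_def by (intro mat_bracket_so_conf X Z that)
  have "killing_form (so_conf p q) Z X = trace_on (so_conf p q) f"
    by (simp add: killing_form_def f_def[abs_def])
  also have "\<dots> = (\<Sum>b\<in>Basis. f (proj b) \<bullet> b)"
    by (rule trace_on_projection[OF subspace_so_conf proj f fL])
  also have "\<dots> = (\<Sum>a\<in>UNIV. \<Sum>b\<in>UNIV. f (proj (axis a (axis b 1))) $ a $ b)"
    by (rule sum_Basis_matrix)
  also have "\<dots> = real CARD('n) * t"
  proof -
    have as: "V $ a $ b = - V $ flip b $ flip a" if "V \<in> so_conf p q" for V :: "'n bmat" and a b
      using that unfolding so_conf_iff by blast
    have tr0: "(\<Sum>a\<in>UNIV. X $ a $ a) = 0"
    proof -
      have "(\<Sum>a\<in>UNIV. X $ a $ a) = - (\<Sum>a\<in>UNIV. X $ flip a $ flip a)"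
        unfolding sum_negf[symmetric] by (rule sum.cong[OF refl as[OF X]])
      also have "(\<Sum>a\<in>UNIV. X $ flip a $ flip a) = (\<Sum>a\<in>UNIV. X $ a $ a)"
        by (rule sum_flip)
      finally show ?thesis by simp
    qed
    have t1: "(\<Sum>a\<in>UNIV. (Z ** X) $ a $ a) = t" by (simp add: t_def matrix_matrix_mult_def)
    have t2: "(\<Sum>a\<in>UNIV. (X ** Z) $ a $ a) = t"
      unfolding t_def matrix_matrix_mult_def by (simp add: mult.commute) (rule sum.swap)
    have one: "(\<Sum>a\<in>UNIV. (mat 1 :: 'n bmat) $ a $ a) = real CARD('n) + 2"
      by (simp add: mat_def sum_block)
    have m1: "(\<Sum>a\<in>UNIV. \<Sum>b\<in>UNIV. M $ a $ flip b * (mat 1 :: 'n bmat) $ flip a $ b) = (\<Sum>a\<in>UNIV. M $ a $ a)" for M :: "'n bmat"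
    proof (rule sum.cong[OF refl])
      fix a
      have "(\<Sum>b\<in>UNIV. M $ a $ flip b * (mat 1 :: 'n bmat) $ flip a $ b) = (\<Sum>b\<in>UNIV. M $ a $ flip b * (if b = flip a then 1 else 0))"
        by (rule sum.cong) (auto simp: mat_def)
      then show "(\<Sum>b\<in>UNIV. M $ a $ flip b * (mat 1 :: 'n bmat) $ flip a $ b) = M $ a $ a"
        by (simp only: sum_delta_if flip_flip)
    qed
    have m2: "(\<Sum>a\<in>UNIV. \<Sum>b\<in>UNIV. (mat 1 :: 'n bmat) $ a $ flip b * M $ flip a $ b) = (\<Sum>a\<in>UNIV. M $ a $ a)" for M :: "'n bmat"
    proof -
      have "(\<Sum>b\<in>UNIV. (mat 1 :: 'n bmat) $ a $ flip b * M $ flip a $ b) = M $ flip a $ flip a" for a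
      proof -
        have "(\<Sum>b\<in>UNIV. (mat 1 :: 'n bmat) $ a $ flip b * M $ flip a $ b) = (\<Sum>b\<in>UNIV. (if b = flip a then 1 else 0) * M $ flip a $ b)"
          by (rule sum.cong) (auto simp: mat_def)
        then show ?thesis by (simp only: sum_delta_if)
      qed
      then show ?thesis using sum_flip[of "\<lambda>a. M $ a $ a"] by simp
    qed
    have m3: "(\<Sum>a\<in>UNIV. \<Sum>b\<in>UNIV. V $ a $ flip b * V' $ flip a $ b) = - (\<Sum>a\<in>UNIV. \<Sum>b\<in>UNIV. V $ a $ b * V' $ b $ a)"
      if "V' \<in> so_conf p q" for V V' :: "'n bmat"
    proof -
      have "(\<Sum>b\<in>UNIV. V $ a $ flip b * V' $ flip a $ b) = - (\<Sum>b\<in>UNIV. V $ a $ b * V' $ b $ a)" for a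
      proof -
        have "(\<Sum>b\<in>UNIV. V $ a $ flip b * V' $ flip a $ b) = - (\<Sum>b\<in>UNIV. V $ a $ flip b * V' $ flip b $ a)"
          unfolding sum_negf[symmetric] by (intro sum.cong refl) (simp add: as[OF that, of "flip a"])
        then show ?thesis by (simp only: sum_flip[of "\<lambda>b. V $ a $ b * V' $ b $ a"])
      qed
      then show ?thesis by (simp add: sum_negf)
    qed
    have t': "(\<Sum>a\<in>UNIV. \<Sum>b\<in>UNIV. X $ a $ b * Z $ b $ a) = t"
      unfolding t_def by (simp add: mult.commute) (rule sum.swap)
    show ?thesis
      unfolding f_eq vector_minus_component vector_add_component sum.distrib sum_subtractf trace_mult_proj
        m1 m2 m3[OF X] m3[OF Z] t1 t2 one tr0 t' t_def[symmetric] by (simp add: field_simps)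
  qed
  finally show ?thesis unfolding t_def .
qed

lemma killing_form_pos_neg:
  "killing_form (so_conf p q) (pos_elem p q z) (neg_elem p q x) = 2 * real CARD('n) * (z \<bullet> (x :: (real, 'n) vec))"
proof -
  have 0: "(0 :: ((real, 'n) vec, 'n) vec) \<in> so_nu p q" by (simp add: so_nu_iff)
  have "pos_elem p q z \<in> so_conf p q" "neg_elem p q x \<in> so_conf p q"
    unfolding pos_elem_def neg_elem_def so_conf_def using 0 by blast+
  moreover have "(\<Sum>a\<in>UNIV. \<Sum>b\<in>UNIV. pos_elem p q z $ a $ b * neg_elem p q x $ b $ a) = 2 * (z \<bullet> x)"
    using sum_\<sigma>[of "\<lambda>i. z $ i * x $ i"]
    by (simp add: sum_block pos_elem_def neg_elem_def conf_mat_nth nu_mult mult_nu inner_vec_def)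
  ultimately show ?thesis by (simp add: killing_form_so_conf)
qed

end

section \<open>The normal extension\<close>

locale homogeneous_conformal_coords =
  nu_involution p q \<sigma> + homogeneous_conformal "\<lambda>x. nu p q *v x" br lam
  for p q :: nat and \<sigma> :: "'n::{finite, linorder} \<Rightarrow> 'n::{finite, linorder}"
    and br :: "'l::euclidean_space \<Rightarrow> 'l \<Rightarrow> 'l" and lam :: "'l \<Rightarrow> (real, 'n::{finite, linorder}) vec"
begin

lemma Basis_axis: "Basis = (\<lambda>i. axis i (1::real)) ` (UNIV :: 'n set)"
  by (auto simp: Basis_vec_def)

text \<open>An involution of two indices is the identity or the exchange; these are the definite and
  the split plane.\<close>

lemma normal_lift_exists: "\<exists>\<omega> \<tau> \<zeta>. normal_lift \<omega> \<tau> \<zeta>"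
proof -
  consider "CARD('n) = 1" | "CARD('n) = 2" | "CARD('n) \<ge> 3"
    using zero_less_card_finite[where 'a = 'n] by linarith
  then show ?thesis
  proof cases
    case 1
    then obtain i where i: "(UNIV :: 'n set) = {i}" by (auto simp: card_1_singleton_iff)
    then have "\<sigma> i = i" by (metis UNIV_I singletonD)
    then have "nu p q *v axis i (1::real) = axis i 1" by (simp only: nu_axis)
    moreover have "Basis = {axis i (1::real)}" unfolding Basis_axis i by simp
    ultimately show ?thesis by (intro normal_lift_1)
  next
    case 2
    then obtain i j where ij: "(UNIV :: 'n set) = {i, j}" "i \<noteq> j" by (auto simp: card_2_iff)
    have B: "Basis = {axis i (1::real), axis j 1}" unfolding Basis_axis ij(1) by simp
    have ne: "axis i (1::real) \<noteq> axis j 1" using ij(2) by (simp add: axis_eq_axis)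
    have "\<sigma> i \<in> {i, j}" "\<sigma> j \<in> {i, j}" using ij(1) by blast+
    then consider "\<sigma> i = i" "\<sigma> j = j" | "\<sigma> i = j" "\<sigma> j = i" using ij(2) \<sigma>_\<sigma> by (metis insertE singletonD)
    then show ?thesis
    proof cases
      case 1
      show ?thesis by (rule normal_lift_2_definite[OF B ne]) (simp_all only: nu_axis 1)
    next
      case 2
      show ?thesis by (rule normal_lift_2_split[OF B ne]) (simp_all only: nu_axis 2)
    qed
  next
    case 3
    then show ?thesis by (intro normal_lift_ge3) simp
  qed
qed

section \<open>Translation between normal lifts and block matrices\<close>

lemma conf_bracket_nth:
  fixes x1 x2 z1 z2 :: "(real, 'n) vec"
  shows "mat_bracket (conf_mat p q a1 x1 z1 A1) (conf_mat p q a2 x2 z2 A2) $ Inl () $ Inl () = z1 \<bullet> x2 - z2 \<bullet> x1"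
    "mat_bracket (conf_mat p q a1 x1 z1 A1) (conf_mat p q a2 x2 z2 A2) $ Inl () $ Inr (Inl k)
      = (a1 *\<^sub>R z2 - a2 *\<^sub>R z1 + z1 v* A2 - z2 v* A1) $ k"
    "mat_bracket (conf_mat p q a1 x1 z1 A1) (conf_mat p q a2 x2 z2 A2) $ Inr (Inl k) $ Inl ()
      = (a2 *\<^sub>R x1 - a1 *\<^sub>R x2 + A1 *v x2 - A2 *v x1) $ k"
    "mat_bracket (conf_mat p q a1 x1 z1 A1) (conf_mat p q a2 x2 z2 A2) $ Inr (Inl k) $ Inr (Inl l)
      = (A1 ** A2 - A2 ** A1) $ k $ l + x1 $ k * z2 $ l - x2 $ k * z1 $ l
        + (nu p q *v z1) $ k * (nu p q *v x2) $ l - (nu p q *v z2) $ k * (nu p q *v x1) $ l"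
  unfolding mat_bracket_def
  by (simp_all add: matrix_matrix_mult_def sum_block conf_mat_nth matrix_vector_mult_def[of A1] matrix_vector_mult_def[of A2]
      vector_matrix_mult_def[of _ A1] vector_matrix_mult_def[of _ A2] inner_vec_def nu_mult mult_nu mult.commute)

lemma so_nu_matrix:
  assumes f: "\<And>x y. b (f x) y + b x (f y) = 0"
  shows "matrix f \<in> so_nu p q"
  unfolding so_nu_iff
proof (intro allI)
  fix i j
  have "b (f (axis j 1)) (axis (\<sigma> i) 1) = f (axis j 1) $ i"
    by (simp add: b_def nu_axis inner_axis)
  moreover have "b (axis j 1) (f (axis (\<sigma> i) 1)) = f (axis (\<sigma> i) 1) $ \<sigma> j"
    by (simp add: b_def nu_mult inner_axis')
  ultimately show "matrix f $ i $ j = - matrix f $ \<sigma> j $ \<sigma> i"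
    using f[of "axis j 1" "axis (\<sigma> i) 1"] by (simp add: matrix_def)
qed

lemma vec_mult_so_nu:
  fixes A :: "((real, 'n) vec, 'n) vec"
  assumes "A \<in> so_nu p q"
  shows "(nu p q *v x) v* A = - (nu p q *v (A *v x))"
proof (subst vec_eq_iff, intro allI)
  fix k
  have A: "A $ i $ k = - A $ \<sigma> k $ \<sigma> i" for i using assms unfolding so_nu_iff by blast
  have "((nu p q *v x) v* A) $ k = - (\<Sum>i\<in>UNIV. A $ \<sigma> k $ \<sigma> i * x $ \<sigma> i)"
    unfolding vector_matrix_mult_def vec_lambda_beta nu_mult A sum_negf[symmetric] by (simp add: mult.commute)
  also have "\<dots> = - (\<Sum>i\<in>UNIV. A $ \<sigma> k $ i * x $ i)" by (simp only: sum_\<sigma>[of "\<lambda>i. A $ \<sigma> k $ i * x $ i"])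
  finally have *: "((nu p q *v x) v* A) $ k = - (\<Sum>i\<in>UNIV. A $ \<sigma> k $ i * x $ i)" .
  show "((nu p q *v x) v* A) $ k = (- (nu p q *v (A *v x))) $ k"
    unfolding * vector_uminus_component nu_mult by (simp add: matrix_vector_mult_def)
qed

lemma conf_mat_linear:
  fixes x x' z z' :: "(real, 'n) vec"
  shows "conf_mat p q (a + a') (x + x') (z + z') (A + A') = conf_mat p q a x z A + conf_mat p q a' x' z' A'"
    "conf_mat p q (r * a) (r *\<^sub>R x) (r *\<^sub>R z) (r *\<^sub>R A) = r *\<^sub>R conf_mat p q a x z A"
  unfolding vec_eq_iff all_block vector_add_component vector_scaleR_component conf_mat_nth
  by (simp_all add: nu_mult mult_nu)

lemma x_part_conf_mat: "x_part (conf_mat p q a x z A) = x"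
  by (simp add: x_part_def conf_mat_nth vec_eq_iff)

lemma x_part_diff: "x_part (X - Y) = x_part X - x_part Y"
  by (simp add: x_part_def vec_eq_iff)

lemma par_confI: "W \<in> so_conf p q \<Longrightarrow> x_part W = 0 \<Longrightarrow> W \<in> par_conf p q"
  unfolding so_conf_def par_conf_def mem_Collect_eq using x_part_conf_mat by metis

lemma x_part_par_conf: "W \<in> par_conf p q \<Longrightarrow> x_part W = 0"
  unfolding par_conf_def by (auto simp: x_part_conf_mat)

lemma conformal_with_unique: "conformal_with s f \<Longrightarrow> conformal_with t f \<Longrightarrow> s = t"
  by (metis b_nonzero conformal_with_def mult.right_neutral mult_left_cancel zero_neq_numeral)

text \<open>A trace may be computed in any basis and its dual basis; r takes up the constant by
  which the Killing form differs from the natural pairing.\<close>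

lemma dual_basis_trace:
  fixes f :: "(real, 'n) vec \<Rightarrow> (real, 'n) vec" and x z :: "'n \<Rightarrow> (real, 'n) vec"
  assumes f: "linear f" and span: "span (range x) = UNIV"
    and dual: "\<And>i j. r * (z i \<bullet> x j) = (if i = j then 1 else 0)"
  shows "r * (\<Sum>i\<in>UNIV. z i \<bullet> f (x i)) = (\<Sum>b\<in>Basis. f b \<bullet> b)"
proof -
  have exp: "v = (\<Sum>i\<in>UNIV. (r * (z i \<bullet> v)) *\<^sub>R x i)" for v
  proof (rule linear_eq_on_span[of "\<lambda>v. v" "\<lambda>v. \<Sum>i\<in>UNIV. (r * (z i \<bullet> v)) *\<^sub>R x i" "range x"])
    show "linear (\<lambda>v. \<Sum>i\<in>UNIV. (r * (z i \<bullet> v)) *\<^sub>R x i)"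
      by (intro linearI) (simp_all add: inner_simps algebra_simps sum.distrib scaleR_sum_right)
    show "v = (\<Sum>i\<in>UNIV. (r * (z i \<bullet> v)) *\<^sub>R x i)" if "v \<in> range x" for v
    proof -
      from that obtain j where j: "v = x j" by blast
      have "(\<Sum>i\<in>UNIV. (r * (z i \<bullet> v)) *\<^sub>R x i) = (\<Sum>i\<in>UNIV. if i = j then x i else 0)"
        unfolding j dual by (rule sum.cong) auto
      then show ?thesis by (simp add: j)
    qed
  qed (simp_all add: span linear_id[unfolded id_def])
  have "(\<Sum>b\<in>Basis. f b \<bullet> b) = (\<Sum>b\<in>Basis. \<Sum>i\<in>UNIV. r * ((z i \<bullet> b) * (f (x i) \<bullet> b)))"
  proof (rule sum.cong[OF refl])
    fix b :: "(real, 'n) vec"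
    have "f b = (\<Sum>i\<in>UNIV. (r * (z i \<bullet> b)) *\<^sub>R f (x i))"
      by (subst exp) (simp add: linear_sum[OF f] linear_cmul[OF f])
    then show "f b \<bullet> b = (\<Sum>i\<in>UNIV. r * ((z i \<bullet> b) * (f (x i) \<bullet> b)))"
      by (simp add: inner_sum_left mult.assoc)
  qed
  also have "\<dots> = (\<Sum>i\<in>UNIV. r * (\<Sum>b\<in>Basis. (z i \<bullet> b) * (f (x i) \<bullet> b)))"
    by (subst sum.swap) (simp add: sum_distrib_left)
  finally show ?thesis by (simp add: euclidean_inner[symmetric] sum_distrib_left)
qed

lemma normal_extension:
  obtains \<alpha> :: "'l \<Rightarrow> 'n bmat" and \<kappa> :: "(real, 'n) vec \<Rightarrow> (real, 'n) vec \<Rightarrow> 'n bmat"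
  where "linear \<alpha>" "range \<alpha> \<subseteq> so_conf p q"
    "\<And>Y1 Yh. lam Yh = 0 \<Longrightarrow> mat_bracket (\<alpha> Y1) (\<alpha> Yh) - \<alpha> (br Y1 Yh) = 0"
    "\<And>Y. x_part (\<alpha> Y) = lam Y"
    "bilinear \<kappa>" "\<And>u. \<kappa> u u = 0" "\<And>u v. \<kappa> u v \<in> so_conf p q"
    "\<And>Y1 Y2. \<kappa> (lam Y1) (lam Y2) = mat_bracket (\<alpha> Y1) (\<alpha> Y2) - \<alpha> (br Y1 Y2)"
    "\<And>(X :: 'n \<Rightarrow> 'l) (Z :: 'n \<Rightarrow> 'n bmat) Y. span (range (\<lambda>i. lam (X i))) = UNIV \<Longrightarrow> \<forall>i. Z i \<in> range (pos_elem p q) \<Longrightarrow>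
      \<forall>i j. killing_form (so_conf p q) (Z i) (neg_elem p q (lam (X j))) = (if i = j then 1 else 0) \<Longrightarrow>
      (\<Sum>i\<in>UNIV. mat_bracket (Z i) (\<kappa> (lam Y) (lam (X i)))) = 0"
proof -
  obtain \<omega> \<tau> \<zeta> where nl: "normal_lift \<omega> \<tau> \<zeta>" using normal_lift_exists by blast
  have lin: "linear (\<omega> Y)" "linear (\<lambda>Y. \<omega> Y x)" "linear \<tau>" "linear \<zeta>"
    and conf: "conformal_with (\<tau> Y) (\<omega> Y)"
    and tor: "lam (br Y1 Y2) = \<omega> Y1 (lam Y2) - \<omega> Y2 (lam Y1)"
    and iso0: "lam Yh = 0 \<Longrightarrow> \<omega> (br Y Yh) x = \<omega> Y (\<omega> Yh x) - \<omega> Yh (\<omega> Y x) + S (\<zeta> Yh) (lam Y) x"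
    and iso1: "lam Yh = 0 \<Longrightarrow> \<zeta> (br Y Yh) = (2 * \<tau> Yh) *\<^sub>R \<zeta> Y - \<omega> Yh (\<zeta> Y) - (2 * \<tau> Y) *\<^sub>R \<zeta> Yh + \<omega> Y (\<zeta> Yh)"
    and Ric: "(\<Sum>i\<in>Basis. (\<omega> Y (\<omega> (sec i) w) - \<omega> (sec i) (\<omega> Y w) - \<omega> (br Y (sec i)) w
        + S (\<zeta> (sec i)) (lam Y) w - S (\<zeta> Y) i w) \<bullet> i) = 0" for Y Y1 Y2 Yh x w
    using nl unfolding normal_lift_def by blast+
  note ls = linear_add[OF lin(1)] linear_diff[OF lin(1)] linear_cmul[OF lin(1)]
    linear_add[OF lin(2)] linear_cmul[OF lin(2)] linear_add[OF lin(3)] linear_cmul[OF lin(3)]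
    linear_add[OF lin(4)] linear_cmul[OF lin(4)]
  \<comment> \<open>The orthogonal part of \<omega>. The bracket of (a, A) with x is A x - a x, so
    the scalar part \<tau> enters the matrix as a = - \<tau>; \<nu> turns the vector \<zeta> into
    the row z.\<close>
  define Am where "Am Y = matrix (\<lambda>x. \<omega> Y x - \<tau> Y *\<^sub>R x)" for Y
  define \<alpha> where "\<alpha> Y = conf_mat p q (- \<tau> Y) (lam Y) (nu p q *v \<zeta> Y) (Am Y)" for Y
  have Am: "Am Y *v x = \<omega> Y x - \<tau> Y *\<^sub>R x" for Y x
  proof -
    have "linear (\<lambda>x. \<omega> Y x - \<tau> Y *\<^sub>R x)" by (intro linearI) (simp_all add: ls algebra_simps)
    from matrix_works[OF linear_matrix_vector_mul_eq[THEN iffD2, OF this]]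
    show ?thesis unfolding Am_def .
  qed
  have Am_so: "Am Y \<in> so_nu p q" for Y
    unfolding Am_def by (rule so_nu_matrix) (use conformal_withD[OF conf[of Y]] in \<open>simp add: algebra_simps\<close>)
  have \<alpha>_so: "\<alpha> Y \<in> so_conf p q" for Y unfolding \<alpha>_def so_conf_def using Am_so by blast
  have \<alpha>l: "linear \<alpha>"
  proof (rule linearI)
    fix Y Y' :: 'l and r :: real
    have "Am (Y + Y') = Am Y + Am Y'" "Am (r *\<^sub>R Y) = r *\<^sub>R Am Y"
      by (simp_all add: Am_def matrix_def vec_eq_iff ls algebra_simps)
    then show "\<alpha> (Y + Y') = \<alpha> Y + \<alpha> Y'" "\<alpha> (r *\<^sub>R Y) = r *\<^sub>R \<alpha> Y"
      by (simp_all add: \<alpha>_def ls lam_simps conf_mat_linear[symmetric] matrix_vector_right_distrib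
          matrix_vector_mult_scaleR)
  qed
  define K where "K Y1 Y2 = mat_bracket (\<alpha> Y1) (\<alpha> Y2) - \<alpha> (br Y1 Y2)" for Y1 Y2
  have K_so: "K Y1 Y2 \<in> so_conf p q" for Y1 Y2
    unfolding K_def by (intro subspace_diff subspace_so_conf mat_bracket_so_conf \<alpha>_so)
  have Kl: "linear (\<lambda>Y. K Y Y2)" "linear (K Y1)" for Y1 Y2
    by (intro linearI; simp add: K_def linear_add[OF \<alpha>l] linear_cmul[OF \<alpha>l] br_simps
      bilinear_ladd[OF bilinear_mat_bracket] bilinear_radd[OF bilinear_mat_bracket]
      bilinear_lmul[OF bilinear_mat_bracket] bilinear_rmul[OF bilinear_mat_bracket] algebra_simps)+
  have K_skew: "K Y1 Y2 = - K Y2 Y1" for Y1 Y2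
    unfolding K_def br_skew[of Y1 Y2] linear_neg[OF \<alpha>l] by (simp add: mat_bracket_def)
  have zx: "(nu p q *v \<zeta> Y) \<bullet> x = b (\<zeta> Y) x" for Y x by (simp add: b_def nu_sym)
  have K11: "K Y1 Y2 $ Inl () $ Inl () = b (\<zeta> Y1) (lam Y2) - b (\<zeta> Y2) (lam Y1) + \<tau> (br Y1 Y2)" for Y1 Y2
    by (simp add: K_def \<alpha>_def conf_bracket_nth conf_mat_nth zx)
  have Kk1: "K Y1 Y2 $ Inr (Inl k) $ Inl () = 0" for Y1 Y2 k
    by (simp add: K_def \<alpha>_def conf_bracket_nth conf_mat_nth Am tor)
  have K1k: "K Y1 Y2 $ Inl () $ Inr (Inl k) =
    (nu p q *v ((2 * \<tau> Y2) *\<^sub>R \<zeta> Y1 - \<omega> Y2 (\<zeta> Y1) - (2 * \<tau> Y1) *\<^sub>R \<zeta> Y2 + \<omega> Y1 (\<zeta> Y2) - \<zeta> (br Y1 Y2))) $ k" for Y1 Y2 k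
    by (simp add: K_def \<alpha>_def conf_bracket_nth conf_mat_nth vec_mult_so_nu[OF Am_so] Am nu_mult)
  \<comment> \<open>The bracket action on w of the degree-zero part (a, A) of W; it lets the two
    block entries be compared with \<omega> at once.\<close>
  define co where "co W w = (\<chi> k. \<Sum>l\<in>UNIV. W $ Inr (Inl k) $ Inr (Inl l) * w $ l) - (W $ Inl () $ Inl ()) *\<^sub>R w"
    for W :: "'n bmat" and w
  define K0 where "K0 Y1 Y2 w = \<omega> Y1 (\<omega> Y2 w) - \<omega> Y2 (\<omega> Y1 w) - \<omega> (br Y1 Y2) w
        + S (\<zeta> Y2) (lam Y1) w - S (\<zeta> Y1) (lam Y2) w" for Y1 Y2 w
  have coK: "co (K Y1 Y2) w = K0 Y1 Y2 w" for Y1 Y2 w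
  proof -
    have "(\<chi> k. \<Sum>l\<in>UNIV. K Y1 Y2 $ Inr (Inl k) $ Inr (Inl l) * w $ l) =
      (Am Y1 ** Am Y2) *v w - (Am Y2 ** Am Y1) *v w + ((nu p q *v \<zeta> Y2) \<bullet> w) *\<^sub>R lam Y1 - ((nu p q *v \<zeta> Y1) \<bullet> w) *\<^sub>R lam Y2
      + ((nu p q *v lam Y2) \<bullet> w) *\<^sub>R \<zeta> Y1 - ((nu p q *v lam Y1) \<bullet> w) *\<^sub>R \<zeta> Y2 - Am (br Y1 Y2) *v w"
      by (simp add: K_def \<alpha>_def conf_bracket_nth conf_mat_nth nu_nu vec_eq_iff inner_vec_def
          matrix_vector_mult_def[of "Am Y1 ** Am Y2"] matrix_vector_mult_def[of "Am Y2 ** Am Y1"]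
          matrix_vector_mult_def[of "Am (br Y1 Y2)"]
          algebra_simps sum.distrib sum_subtractf sum_distrib_left)
    then show ?thesis
      unfolding co_def K11 matrix_vector_mul_assoc[symmetric] Am zx nu_sym[of "lam _"] b_def[symmetric] K0_def S_def
      by (simp add: ls algebra_simps)
  qed
  have K_iso: "K Y Yh = 0" if h: "lam Yh = 0" for Y Yh
  proof -
    \<comment> \<open>The lift prescribes \<omega> on brackets but not \<tau>; uniqueness of the
      conformal factor recovers \<tau>, and with it the corner entry of the curvature.\<close>
    have "conformal_with (b (\<zeta> Yh) (lam Y)) (\<omega> (br Y Yh))"
      unfolding conformal_with_def
    proof (intro allI)
      fix x y
      have "b (\<omega> (br Y Yh) x) y + b x (\<omega> (br Y Yh) y) =
        (b (\<omega> Y (\<omega> Yh x) - \<omega> Yh (\<omega> Y x)) y + b x (\<omega> Y (\<omega> Yh y) - \<omega> Yh (\<omega> Y y)))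
        + (b (S (\<zeta> Yh) (lam Y) x) y + b x (S (\<zeta> Yh) (lam Y) y))"
        unfolding iso0[OF h] by simp
      then show "b (\<omega> (br Y Yh) x) y + b x (\<omega> (br Y Yh) y) = 2 * b (\<zeta> Yh) (lam Y) * b x y"
        unfolding conformal_with_commutator[OF conf conf] S_conformal by simp
    qed
    then have \<tau>: "\<tau> (br Y Yh) = b (\<zeta> Yh) (lam Y)" by (rule conformal_with_unique[OF conf])
    have 11: "K Y Yh $ Inl () $ Inl () = 0" by (simp add: K11 h \<tau>)
    have "co (K Y Yh) w = 0" for w unfolding coK K0_def iso0[OF h] by (simp add: h)
    then have "co (K Y Yh) (axis l 1) $ k = 0" for k l by simp
    then have kl: "K Y Yh $ Inr (Inl k) $ Inr (Inl l) = 0" for k l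
      unfolding co_def 11 by (simp add: axis_def if_distrib[of "(*) _"] cong: if_cong)
    show ?thesis
    proof (rule so_conf_eqI[OF K_so subspace_0[OF subspace_so_conf]])
      show "K Y Yh $ Inl () $ Inr (Inl k) = 0 $ Inl () $ Inr (Inl k)" for k
        unfolding K1k iso1[OF h] by simp
    qed (simp_all add: 11 kl Kk1)
  qed
  have K_iso': "K Yh Y = 0" if "lam Yh = 0" for Y Yh
    using K_iso[OF that, of Y] K_skew[of Yh Y] by simp
  \<comment> \<open>Curvature on the tangent space, well defined because \<open>K\<close> vanishes
    as soon as one argument is in the isotropy algebra.\<close>
  define \<kappa> where "\<kappa> u v = K (sec u) (sec v)" for u v
  have \<kappa>: "\<kappa> (lam Y1) (lam Y2) = K Y1 Y2" for Y1 Y2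
  proof -
    have "K (Y1 - sec (lam Y1)) Y2 = 0" "K (sec (lam Y1)) (Y2 - sec (lam Y2)) = 0"
      by (rule K_iso', simp add: lam_simps sec_simps, rule K_iso, simp add: lam_simps sec_simps)
    then show ?thesis by (simp add: \<kappa>_def linear_diff[OF Kl(1)] linear_diff[OF Kl(2)])
  qed
  have bil: "bilinear \<kappa>"
    unfolding bilinear_def \<kappa>_def[abs_def]
    using linear_compose[OF sec(1) Kl(1)] linear_compose[OF sec(1) Kl(2)] by (simp add: comp_def)
  have alt: "\<kappa> u u = 0" for u
  proof -
    have "\<kappa> u u + \<kappa> u u = 0" using K_skew[of "sec u" "sec u"] unfolding \<kappa>_def eq_neg_iff_add_eq_0 .
    then have "2 *\<^sub>R \<kappa> u u = 0" by (simp only: scaleR_2)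
    then show ?thesis by simp
  qed
  have in_so: "\<kappa> u v \<in> so_conf p q" for u v unfolding \<kappa>_def by (rule K_so)
  have normalized: "(\<Sum>i\<in>UNIV. mat_bracket (Z i) (\<kappa> (lam Y) (lam (X i)))) = 0"
    if span: "span (range (\<lambda>i. lam (X i))) = UNIV" and Z: "\<forall>i. Z i \<in> range (pos_elem p q)"
      and dual: "\<forall>i j. killing_form (so_conf p q) (Z i) (neg_elem p q (lam (X j))) = (if i = j then 1 else 0)"
    for X :: "'n \<Rightarrow> 'l" and Z :: "'n \<Rightarrow> 'n bmat" and Y
  proof -
    have "\<forall>i. \<exists>z. Z i = pos_elem p q z" using Z by blast
    from choice[OF this] obtain z where z: "\<And>i. Z i = pos_elem p q (z i)" by blast
    have d: "(2 * real CARD('n)) * (z i \<bullet> lam (X j)) = (if i = j then 1 else 0)" for i j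
      using dual z by (simp add: killing_form_pos_neg)
    have f: "linear (\<lambda>u. K0 Y (sec u) w)" for w
      by (intro linearI) (simp_all add: K0_def sec_simps lam_simps ls br_simps algebra_simps)
    have tr: "(\<Sum>i\<in>UNIV. z i \<bullet> K0 Y (sec (lam (X i))) w) = 0" for w
      using dual_basis_trace[OF f[of w] span d] Ric[of Y w] by (simp add: K0_def sec(2))
    have K0X: "K0 Y (sec (lam (X i))) w = co (K Y (X i)) w" for i w
      using \<kappa>[of Y "sec (lam (X i))"] \<kappa>[of Y "X i"] unfolding coK[symmetric] sec(2) by simp
    have "\<exists>a \<zeta>' A. \<forall>i. K Y (X i) = conf_mat p q (a i) 0 (\<zeta>' i) (A i)"
    proof -
      have "\<exists>a \<zeta>' A. K Y (X i) = conf_mat p q a 0 \<zeta>' A" for i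
      proof -
        obtain a x \<zeta>' A where e: "K Y (X i) = conf_mat p q a x \<zeta>' A"
          using K_so[of Y "X i"] unfolding so_conf_def by blast
        have "x = 0" using Kk1[of Y "X i"] unfolding e conf_mat_nth by (simp add: vec_eq_iff)
        with e show ?thesis by blast
      qed
      then show ?thesis by metis
    qed
    then obtain a \<zeta>' A where KX: "\<And>i. K Y (X i) = conf_mat p q (a i) 0 (\<zeta>' i) (A i)" by blast
    \<comment> \<open>As the curvature has no x-part, its bracket with \<open>Z i\<close> has only
      the row z A - a z. Paired with w this is \<open>z i\<close> applied to the degree-zero action
      on w, and the sum over i is the vanishing trace.\<close>
    have orth: "(\<Sum>i\<in>UNIV. z i v* A i - a i *\<^sub>R z i) \<bullet> w = 0" for w
    proof -
      have "co (K Y (X i)) w = A i *v w - a i *\<^sub>R w" for i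
        by (simp add: co_def KX conf_mat_nth matrix_vector_mult_def)
      then have "(\<Sum>i\<in>UNIV. z i \<bullet> (A i *v w - a i *\<^sub>R w)) = 0" using tr[of w] by (simp add: K0X)
      then show ?thesis by (simp add: inner_sum_left inner_diff_left inner_diff_right dot_lmul_matrix)
    qed
    have 0: "(\<Sum>i\<in>UNIV. z i v* A i - a i *\<^sub>R z i) = 0"
      by (rule iffD1[OF inner_eq_zero_iff orth])
    have Zso: "Z i \<in> so_conf p q" for i
      unfolding z pos_elem_def so_conf_def using so_nu_iff[of 0] by force
    have "(\<Sum>i\<in>UNIV. mat_bracket (Z i) (K Y (X i))) = 0"
    proof (rule so_conf_eqI)
      show "(\<Sum>i\<in>UNIV. mat_bracket (Z i) (K Y (X i))) \<in> so_conf p q"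
        by (intro subspace_sum subspace_so_conf mat_bracket_so_conf Zso K_so)
      show "0 \<in> (so_conf p q :: 'n bmat set)" by (rule subspace_0[OF subspace_so_conf])
      show "(\<Sum>i\<in>UNIV. mat_bracket (Z i) (K Y (X i))) $ Inl () $ Inr (Inl k) = 0 $ Inl () $ Inr (Inl k)" for k
        using arg_cong[OF 0, of "\<lambda>v. v $ k"]
        by (simp add: z KX pos_elem_def conf_bracket_nth)
    qed (simp_all add: z KX pos_elem_def conf_bracket_nth)
    then show ?thesis by (simp only: \<kappa>)
  qed
  have xp: "x_part (\<alpha> Y) = lam Y" for Y by (simp add: \<alpha>_def x_part_conf_mat)
  have ran: "range \<alpha> \<subseteq> so_conf p q" using \<alpha>_so by blast
  have iso: "mat_bracket (\<alpha> Y1) (\<alpha> Yh) - \<alpha> (br Y1 Yh) = 0" if "lam Yh = 0" for Y1 Yh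
    using K_iso[OF that] by (simp only: K_def)
  have curv: "\<kappa> (lam Y1) (lam Y2) = mat_bracket (\<alpha> Y1) (\<alpha> Y2) - \<alpha> (br Y1 Y2)" for Y1 Y2
    using \<kappa> by (simp only: K_def)
  show ?thesis
    by (rule that[of \<alpha> \<kappa>, OF \<alpha>l ran _ xp bil alt in_so curv])
      (erule iso, rule normalized, assumption+)
qed

end

section \<open>From the homogeneous geometry to its algebraic data\<close>

theorem proposition2p1:
  fixes p q :: nat
    and AM :: "('m::{t2_space, second_countable_topology}, real ^ ('n::{finite, linorder})) chart set"
    and g :: "('m, real ^ ('n::{finite, linorder})) tensor2"
    and AK :: "('k::{t2_space, second_countable_topology}, 'l::euclidean_space) chart set"
    and gmul :: "'k \<Rightarrow> 'k \<Rightarrow> 'k" and e :: 'k and ginv :: "'k \<Rightarrow> 'k"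
    and act :: "'k \<Rightarrow> 'm \<Rightarrow> 'm"
    and o' :: 'm
    and H :: "'k set"
    and c :: "('k, 'l) chart"
    and h :: "'l set"
    and \<alpha>1 :: "'l \<Rightarrow> real ^ ('n::{finite, linorder})"
  assumes dims: "p \<le> q" "CARD('n) = p + q"
    and M: "smooth_atlas AM" "connected (UNIV :: 'm set)"
    and g: "pseudo_riemannian_metric AM p q g"
    and K: "lie_group AK gmul e ginv"
    and action: "smooth_action AK gmul e AM act"
    and transitive: "\<forall>x y. \<exists>k. act k x = y"
    and conformal: "\<forall>k. conformal_map AM g (act k)"
    and H: "H = {k. act k o' = o'}"
    and c: "c \<in> AK" "e \<in> fst c"
    and h: "h = subgroup_lie_algebra AK gmul e c H"
    and \<alpha>1_iso: "linear \<alpha>1" "surj \<alpha>1" "\<forall>Y. \<alpha>1 Y = 0 \<longleftrightarrow> Y \<in> h"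
    and \<alpha>1_metric: "\<exists>g'\<in>conformal_class AM g. \<forall>d\<in>AM. o' \<in> fst d \<longrightarrow>
        (\<forall>Y1 Y2. \<alpha>1 Y1 \<bullet> (nu p q *v \<alpha>1 Y2) =
           g' d o' (tangent_map c d (\<lambda>k. act k o') e Y1) (tangent_map c d (\<lambda>k. act k o') e Y2))"
  shows "\<exists>\<alpha> :: 'l \<Rightarrow> 'n bmat.
      linear \<alpha> \<and> range \<alpha> \<subseteq> so_conf p q \<and>
      (\<forall>Y1. \<forall>Yh\<in>h. mat_bracket (\<alpha> Y1) (\<alpha> Yh) - \<alpha> (lie_bracket gmul e c Y1 Yh) = 0) \<and>
      (\<alpha> ` h \<subseteq> par_conf p q \<and> (\<forall>Y. \<alpha> Y \<in> par_conf p q \<longrightarrow> Y \<in> h) \<and>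
       (\<forall>W\<in>so_conf p q. \<exists>Y. W - \<alpha> Y \<in> par_conf p q) \<and>
       (\<forall>Y. x_part (\<alpha> Y) = \<alpha>1 Y)) \<and>
      (\<exists>\<kappa> :: real ^ ('n::{finite, linorder}) \<Rightarrow> real ^ ('n::{finite, linorder}) \<Rightarrow> 'n bmat.
         bilinear \<kappa> \<and> (\<forall>u. \<kappa> u u = 0) \<and> (\<forall>u v. \<kappa> u v \<in> so_conf p q) \<and>
         (\<forall>Y1 Y2. \<kappa> (x_part (\<alpha> Y1)) (x_part (\<alpha> Y2)) =
            mat_bracket (\<alpha> Y1) (\<alpha> Y2) - \<alpha> (lie_bracket gmul e c Y1 Y2)) \<and>
         (\<forall>(X :: 'n \<Rightarrow> 'l) (Z :: 'n \<Rightarrow> 'n bmat).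
            inj (\<lambda>i. \<alpha>1 (X i)) \<and> independent (range (\<lambda>i. \<alpha>1 (X i))) \<and>
            span (range (\<lambda>i. \<alpha>1 (X i))) = UNIV \<and>
            (\<forall>i. Z i \<in> range (pos_elem p q)) \<and>
            (\<forall>i j. killing_form (so_conf p q) (Z i) (neg_elem p q (\<alpha>1 (X j))) = (if i = j then 1 else 0)) \<longrightarrow>
            (\<forall>Y. (\<Sum>i\<in>UNIV. mat_bracket (Z i) (\<kappa> (x_part (\<alpha> Y)) (x_part (\<alpha> (X i))))) = 0)))"
proof -
  interpret G: lie_group_chart AK gmul e ginv c
    by (rule lie_group_chart.intro[OF K c])
  obtain \<sigma> :: "'n \<Rightarrow> 'n" where \<sigma>: "\<And>i. \<sigma> (\<sigma> i) = i"
    "\<And>i j. (nu p q :: ((real, 'n) vec, 'n) vec) $ i $ j = (if j = \<sigma> i then 1 else 0)"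
    using nu_permutation[OF dims] by metis
  interpret nu_involution p q \<sigma>
    by (rule nu_involution.intro) (rule \<sigma>)+
  define Q where "Q Y1 Y2 = \<alpha>1 Y1 \<bullet> (nu p q *v \<alpha>1 Y2)" for Y1 Y2
  note \<alpha>1_simps = linear_add[OF \<alpha>1_iso(1)] linear_cmul[OF \<alpha>1_iso(1)]
  have Q: "bilinear Q"
    unfolding bilinear_def
    by (auto intro!: linearI simp: Q_def \<alpha>1_simps inner_simps matrix_vector_right_distrib matrix_vector_mult_scaleR)
  have h_iff: "Y \<in> h \<longleftrightarrow> \<alpha>1 Y = 0" for Y using \<alpha>1_iso(3) by blast
  obtain d where d: "d \<in> AM" "o' \<in> fst d" using M(1) unfolding smooth_atlas_def by blast
  have chart_d: "is_chart d" using M(1) d(1) unfolding smooth_atlas_def by blast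
  let ?\<pi> = "tangent_map c d (\<lambda>k. act k o') e"
  \<comment> \<open>\<open>Q\<close> comes from a metric of the conformal class, so at the base
    point it is a multiple of the pullback of \<open>g\<close> by the orbit map.\<close>
  obtain r where r: "\<And>Y1 Y2. Q Y1 Y2 = r * g d o' (?\<pi> Y1) (?\<pi> Y2)"
  proof -
    obtain g' where g': "g' \<in> conformal_class AM g"
      "\<And>Y1 Y2. Q Y1 Y2 = g' d o' (?\<pi> Y1) (?\<pi> Y2)"
      using \<alpha>1_metric d unfolding Q_def by blast
    then obtain s where s: "\<And>u v. g' d o' u v = s o' * g d o' u v"
      unfolding conformal_class_def using d by blast
    show ?thesis by (rule that[of "s o'"]) (simp only: g'(2) s)
  qed
  \<comment> \<open>The orbit map intertwines \<open>Ad k\<close> with the tangent map of k at the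
    fixed point, and the latter scales \<open>g\<close> there.\<close>
  have Ad_conformal: "\<exists>s. \<forall>u v. Q (G.Ad k u) (G.Ad k v) = s * Q u v"
    if "k \<in> H" "k \<in> fst c" "ginv k \<in> fst c" for k
  proof -
    have fixed: "act k o' = o'" using that(1) by (simp add: H)
    obtain s where s: "\<And>u v. g d o' (tangent_map d d (act k) o' u) (tangent_map d d (act k) o' v) = s o' * g d o' u v"
      using conformal d fixed unfolding conformal_map_def by metis
    have "Q (G.Ad k u) (G.Ad k v) = s o' * Q u v" for u v
      unfolding r G.isotropy_equivariant[OF action d(1) chart_d d(2) that(2,3) fixed, symmetric] s by simp
    then show ?thesis by blast
  qed
  interpret homogeneous_conformal_coords p q \<sigma> "lie_bracket gmul e c" \<alpha>1
  proof (intro homogeneous_conformal_coords.intro homogeneous_conformal.intro homogeneous_conformal_axioms.intro)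
    show "nu_involution p q \<sigma>" by (rule nu_involution_axioms)
    show form: "involutive_form (\<lambda>x. nu p q *v (x :: (real, 'n) vec))"
      by (rule involutive_form.intro) (simp_all add: nu_nu nu_sym)
    show "bilinear (lie_bracket gmul e c)" by (rule G.bilinear_bracket)
    show "lie_bracket gmul e c u v = - lie_bracket gmul e c v u" for u v by (rule G.bracket_skew)
    show "lie_bracket gmul e c u (lie_bracket gmul e c v w) =
      lie_bracket gmul e c (lie_bracket gmul e c u v) w + lie_bracket gmul e c v (lie_bracket gmul e c u w)" for u v w
      by (rule G.jacobi)
    show "linear \<alpha>1" "surj \<alpha>1" by (rule \<alpha>1_iso)+
    show "\<exists>s. \<forall>u v. involutive_form.b (\<lambda>x. nu p q *v x) (\<alpha>1 (lie_bracket gmul e c Y u)) (\<alpha>1 v)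
        + involutive_form.b (\<lambda>x. nu p q *v x) (\<alpha>1 u) (\<alpha>1 (lie_bracket gmul e c Y v))
        = s * involutive_form.b (\<lambda>x. nu p q *v x) (\<alpha>1 u) (\<alpha>1 v)" if "\<alpha>1 Y = 0" for Y
    proof -
      \<comment> \<open>This supplies a one-parameter subgroup in H, along which the conformality of
        \<open>Ad\<close> is differentiated.\<close>
      have "Y \<in> subgroup_lie_algebra AK gmul e c H" using that h_iff h by blast
      from G.isotropy_infinitesimal[OF Q this Ad_conformal]
      show ?thesis unfolding involutive_form.b_def[OF form] Q_def by blast
    qed
  qed
  show ?thesis
  proof (rule normal_extension)
    fix \<alpha> :: "'l \<Rightarrow> 'n bmat" and \<kappa> :: "(real, 'n) vec \<Rightarrow> (real, 'n) vec \<Rightarrow> 'n bmat"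
    assume \<alpha>: "linear \<alpha>" "range \<alpha> \<subseteq> so_conf p q"
      "\<And>Y1 Yh. \<alpha>1 Yh = 0 \<Longrightarrow> mat_bracket (\<alpha> Y1) (\<alpha> Yh) - \<alpha> (lie_bracket gmul e c Y1 Yh) = 0"
      "\<And>Y. x_part (\<alpha> Y) = \<alpha>1 Y"
    and \<kappa>: "bilinear \<kappa>" "\<And>u. \<kappa> u u = 0" "\<And>u v. \<kappa> u v \<in> so_conf p q"
      "\<And>Y1 Y2. \<kappa> (\<alpha>1 Y1) (\<alpha>1 Y2) = mat_bracket (\<alpha> Y1) (\<alpha> Y2) - \<alpha> (lie_bracket gmul e c Y1 Y2)"
      "\<And>(X :: 'n \<Rightarrow> 'l) (Z :: 'n \<Rightarrow> 'n bmat) Y. span (range (\<lambda>i. \<alpha>1 (X i))) = UNIV \<Longrightarrow> \<forall>i. Z i \<in> range (pos_elem p q) \<Longrightarrow>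
        \<forall>i j. killing_form (so_conf p q) (Z i) (neg_elem p q (\<alpha>1 (X j))) = (if i = j then 1 else 0) \<Longrightarrow>
        (\<Sum>i\<in>UNIV. mat_bracket (Z i) (\<kappa> (\<alpha>1 Y) (\<alpha>1 (X i)))) = 0"
    have quotient: "\<exists>Y. W - \<alpha> Y \<in> par_conf p q" if "W \<in> so_conf p q" for W
    proof
      show "W - \<alpha> (sec (x_part W)) \<in> par_conf p q"
        using that \<alpha>(2) by (intro par_confI subspace_diff subspace_so_conf) (auto simp: x_part_diff \<alpha>(4) sec(2))
    qed
    have "\<alpha> Y \<in> par_conf p q \<longleftrightarrow> Y \<in> h" for Y
      using par_confI[of "\<alpha> Y"] x_part_par_conf[of "\<alpha> Y"] \<alpha>(2,4) h_iff by auto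
    then show ?thesis
      using \<alpha> \<kappa> quotient
      by (intro exI[of _ \<alpha>] conjI exI[of _ \<kappa>]) (auto simp: h_iff)
  qed
qed

end
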